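(* Let $\delta=\frac12\sqrt{\kappa/2}$ and $Q=\frac{\kappa^2}{8\nu}$. In the elliptical single-index setting described in the context, with $\Psi=\|\cdot\|_1$, there exist constants $c,c_0,c_1,C_0,C_1>0$ depending only on $\nu,\kappa,\nu_q$ such that the following holds for any $\beta,t>2$. Suppose there is $\theta_0\in\mathbb R^d$ with $\|\theta_0\|_0=s$ (exactly $s$ nonzero coordinates) and $$\|\eta\theta_*-\theta_0\|_1\le c\,\frac{s\sqrt{\log(ed/s)}}{\sqrt N}.$$ If $$N\ge c_0\left(\frac{\delta t+\beta\sqrt{s\log(ed/s)}}{\delta Q}\right)^2+\frac4{Q^2}\frac{(\mathbb E[\mu^2])^2\lambda_{\max}(\mathbf\Sigma)}{d^2}\qquad\text{and}\qquad\lambda=c_1\beta\sqrt{\log(ed/s)/N},$$ then with probability at least $1-e^{-\beta}-e^{-t^2}$, $$\|\widehat\theta_N-\eta\theta_*\|_2\le C_0\frac{\beta\sqrt{s\log(ed/s)}}{\sqrt N},\qquad\|\widehat\theta_N-\eta\theta_*\|_1\le C_1\frac{\beta s\sqrt{\log(ed/s)}}{\sqrt N}.$$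
   Context: Model: $(\mathbf x_i,y_i)$, $i=1,\dots,N$, are i.i.d. copies of $(\mathbf x,y)$, $\mathbf x\in\mathbb R^d$, $\mathbb E[\mathbf x]=0$, $y_i=f(\langle\mathbf x_i,\theta_*\rangle,\xi_i)$ with $f:\mathbb R^2\to\mathbb R$ an arbitrary fixed unknown function and $\xi_i$ i.i.d. noise independent of $\mathbf x_i$. The vector $\mathbf x$ is elliptically symmetric: $\mathbf x\stackrel d=\mu\mathbf BU$, where $\mu$ is a scalar random variable, $\mathbf B$ is a fixed $d\times d$ matrix with $\mathbf B\mathbf B^T=\mathbf\Sigma:=\mathbb E[\mathbf x\mathbf x^T]$, and $U$ is uniform on the unit sphere $\mathbb S^{d-1}$, independent of $\mu$. $\lambda_{\max}(\mathbf\Sigma)$ is the largest eigenvalue of $\mathbf\Sigma$. Normalization: $\|\mathbf\Sigma^{1/2}\theta_*\|_2=1$, and $\eta:=\mathbb E[y\langle\mathbf x,\theta_*\rangle]\neq0$. Assumptions: for an exponent $q=4(1+\epsilon)$, $\epsilon>0$, and constants $\nu,\nu_q,\kappa>0$: $\sup_{\mathbf v\in\mathbb S^{d-1}}\mathbb E|\langle\mathbf x,\mathbf v\rangle|^4\le\nu$; $\mathbb E[|y|^q]^{1/q}\le\nu_q$ and $\mathbb E[|x_j|^q]^{1/q}\le\nu_q$ for every coordinate $x_j$ of $\mathbf x$; $\inf_{\mathbf v\in\mathbb S^{d-1}}\mathbb E|\langle\mathbf x,\mathbf v\rangle|^2\ge\kappa$. The exponent $q$ is regarded as a fixed (absolute)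 constant. Truncation: with $\tau=N^{2/(q+4)}$, $\widetilde{\mathbf x}_i=\frac{\sqrt d\,\mathbf x_i}{\|\mathbf x_i\|_2}\left(\frac{\|\mathbf x_i\|_2}{\sqrt d}\wedge\tau\right)$ and $\widetilde y_i=\mathrm{sign}(y_i)(|y_i|\wedge\tau)$. Estimator: $\widehat\theta_N\in\operatorname{argmin}_{\theta\in\mathbb R^d}\frac1N\sum_{i=1}^N(\langle\widetilde{\mathbf x}_i,\theta\rangle-\widetilde y_i)^2+\lambda\Psi(\theta)$. *)

theory Defs
  imports "HOL-Probability.Probability" "Jordan_Normal_Form.Char_Poly"
begin

(* The constants of the theorem must not depend on the dimension, so the dimension cannot be a
   type: vectors of R^d are functions on {..<d}, and d x d matrices are functions of two indices
   below d. *)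

definition Rd :: "nat \<Rightarrow> (nat \<Rightarrow> real) set" where
  "Rd d = {..<d} \<rightarrow>\<^sub>E UNIV"

abbreviation borel_Rd :: "nat \<Rightarrow> (nat \<Rightarrow> real) measure" where
  "borel_Rd d \<equiv> Pi\<^sub>M {..<d} (\<lambda>_. borel)"

definition dotp :: "nat \<Rightarrow> (nat \<Rightarrow> real) \<Rightarrow> (nat \<Rightarrow> real) \<Rightarrow> real" where
  "dotp d u v = (\<Sum>i<d. u i * v i)"

definition norm1 :: "nat \<Rightarrow> (nat \<Rightarrow> real) \<Rightarrow> real" where
  "norm1 d v = (\<Sum>i<d. \<bar>v i\<bar>)"

definition norm2 :: "nat \<Rightarrow> (nat \<Rightarrow> real) \<Rightarrow> real" where
  "norm2 d v = L2_set v {..<d}"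

definition norm0 :: "nat \<Rightarrow> (nat \<Rightarrow> real) \<Rightarrow> nat" where
  "norm0 d v = card {i. i < d \<and> v i \<noteq> 0}"

definition unit_sphere :: "nat \<Rightarrow> (nat \<Rightarrow> real) set" where
  "unit_sphere d = {v \<in> Rd d. norm2 d v = 1}"

definition matvec :: "nat \<Rightarrow> (nat \<Rightarrow> nat \<Rightarrow> real) \<Rightarrow> (nat \<Rightarrow> real) \<Rightarrow> (nat \<Rightarrow> real)" where
  "matvec d A v = (\<lambda>i\<in>{..<d}. \<Sum>j<d. A i j * v j)"

definition is_psd_sqrt :: "nat \<Rightarrow> (nat \<Rightarrow> nat \<Rightarrow> real) \<Rightarrow> (nat \<Rightarrow> nat \<Rightarrow> real) \<Rightarrow> bool" where
  "is_psd_sqrt d H S \<longleftrightarrow>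
     (\<forall>i<d. \<forall>j<d. H i j = H j i) \<and>
     (\<forall>v\<in>Rd d. 0 \<le> dotp d v (matvec d H v)) \<and>
     (\<forall>i<d. \<forall>j<d. (\<Sum>k<d. H i k * H k j) = S i j)"

definition lambda_max :: "nat \<Rightarrow> (nat \<Rightarrow> nat \<Rightarrow> real) \<Rightarrow> real" where
  "lambda_max d S = Max {k. eigenvalue (Matrix.mat d d (\<lambda>(i, j). S i j)) k}"

(* The normalised surface measure of the unit sphere: the mass of A is the Lebesgue measure of
   the cone {r a | 0 < r <= 1, a in A} divided by that of the unit ball, that is, the law of
   V / |V| for V uniform on the unit ball without the origin. *)
definition sphere_uniform :: "nat \<Rightarrow> (nat \<Rightarrow> real) measure" where
  "sphere_uniform d =
     distr (uniform_measure (Pi\<^sub>M {..<d} (\<lambda>_. lborel)) {v \<in> Rd d. 0 < norm2 d v \<and> norm2 d v \<le> 1})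
       (borel_Rd d) (\<lambda>v. \<lambda>i\<in>{..<d}. v i / norm2 d v)"

definition second_moment :: "(nat \<Rightarrow> real) measure \<Rightarrow> nat \<Rightarrow> nat \<Rightarrow> real" where
  "second_moment P i j = (LINT x|P. x i * x j)"

(* P is the law of x and Mu the law of the scalar factor mu. The product measure expresses that
   mu and U are independent. *)
definition elliptical ::
  "nat \<Rightarrow> (nat \<Rightarrow> real) measure \<Rightarrow> real measure \<Rightarrow> (nat \<Rightarrow> nat \<Rightarrow> real) \<Rightarrow> bool" where
  "elliptical d P Mu B \<longleftrightarrow>
     prob_space Mu \<and> sets Mu = sets borel \<and>
     P = distr (Mu \<Otimes>\<^sub>M sphere_uniform d) (borel_Rd d)
           (\<lambda>(m, u). \<lambda>i\<in>{..<d}. m * matvec d B u i) \<and>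
     (\<forall>i<d. \<forall>j<d. (\<Sum>k<d. B i k * B j k) = second_moment P i j)"

definition Lq_norm_le :: "'a measure \<Rightarrow> real \<Rightarrow> ('a \<Rightarrow> real) \<Rightarrow> real \<Rightarrow> bool" where
  "Lq_norm_le M q g K \<longleftrightarrow>
     integrable M (\<lambda>z. \<bar>g z\<bar> powr q) \<and> (LINT z|M. \<bar>g z\<bar> powr q) powr (1 / q) \<le> K"

(* One observation is a pair (x, xi); its response is f(<x, theta>, xi). *)
definition response ::
  "nat \<Rightarrow> (real \<times> real \<Rightarrow> real) \<Rightarrow> (nat \<Rightarrow> real) \<Rightarrow> (nat \<Rightarrow> real) \<times> real \<Rightarrow> real" where
  "response d f \<theta> z = f (dotp d (fst z) \<theta>, snd z)"

(* P is the law of x and R the law of the noise, so a pair (x, xi) has law P x R. The function f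
   is arbitrary; only the response has to be a random variable. *)
definition single_index_model ::
  "nat \<Rightarrow> (nat \<Rightarrow> real) measure \<Rightarrow> real measure \<Rightarrow> (real \<times> real \<Rightarrow> real) \<Rightarrow> (nat \<Rightarrow> real) \<Rightarrow> bool" where
  "single_index_model d P R f \<theta> \<longleftrightarrow>
     prob_space P \<and> sets P = sets (borel_Rd d) \<and>
     prob_space R \<and> sets R = sets borel \<and>
     response d f \<theta> \<in> borel_measurable (P \<Otimes>\<^sub>M R) \<and>
     (\<forall>j<d. integrable P (\<lambda>x. x j) \<and> (LINT x|P. x j) = 0)"

definition eta ::
  "nat \<Rightarrow> (nat \<Rightarrow> real) measure \<Rightarrow> real measure \<Rightarrow> (real \<times> real \<Rightarrow> real) \<Rightarrow> (nat \<Rightarrow> real) \<Rightarrow> real" where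
  "eta d P R f \<theta> = (LINT z|(P \<Otimes>\<^sub>M R). response d f \<theta> z * dotp d (fst z) \<theta>)"

definition moment_assumptions ::
  "nat \<Rightarrow> (nat \<Rightarrow> real) measure \<Rightarrow> real measure \<Rightarrow> (real \<times> real \<Rightarrow> real) \<Rightarrow> (nat \<Rightarrow> real)
     \<Rightarrow> real \<Rightarrow> real \<Rightarrow> real \<Rightarrow> real \<Rightarrow> bool" where
  "moment_assumptions d P R f \<theta> q \<nu> \<nu>q \<kappa> \<longleftrightarrow>
     (SUP v\<in>unit_sphere d. \<integral>\<^sup>+x. ennreal (\<bar>dotp d x v\<bar> ^ 4) \<partial>P) \<le> ennreal \<nu> \<and>
     Lq_norm_le (P \<Otimes>\<^sub>M R) q (response d f \<theta>) \<nu>q \<and>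
     (\<forall>j<d. Lq_norm_le P q (\<lambda>x. x j) \<nu>q) \<and>
     (INF v\<in>unit_sphere d. \<integral>\<^sup>+x. ennreal (\<bar>dotp d x v\<bar> ^ 2) \<partial>P) \<ge> ennreal \<kappa>"

(* The canonical space of N i.i.d. observations; sample point w has i-th observation w i. *)
definition sample_space ::
  "nat \<Rightarrow> (nat \<Rightarrow> real) measure \<Rightarrow> real measure \<Rightarrow> (nat \<Rightarrow> (nat \<Rightarrow> real) \<times> real) measure" where
  "sample_space N P R = Pi\<^sub>M {..<N} (\<lambda>_. P \<Otimes>\<^sub>M R)"

definition trunc_level :: "nat \<Rightarrow> real \<Rightarrow> real" where
  "trunc_level N q = real N powr (2 / (q + 4))"

definition trunc_vec :: "nat \<Rightarrow> real \<Rightarrow> (nat \<Rightarrow> real) \<Rightarrow> (nat \<Rightarrow> real)" where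
  "trunc_vec d \<tau> x =
     (\<lambda>i\<in>{..<d}. sqrt (real d) * x i / norm2 d x * min (norm2 d x / sqrt (real d)) \<tau>)"

definition trunc_real :: "real \<Rightarrow> real \<Rightarrow> real" where
  "trunc_real \<tau> y = sgn y * min \<bar>y\<bar> \<tau>"

definition lasso_objective ::
  "nat \<Rightarrow> nat \<Rightarrow> real \<Rightarrow> real \<Rightarrow> (nat \<Rightarrow> (nat \<Rightarrow> real)) \<Rightarrow> (nat \<Rightarrow> real) \<Rightarrow> (nat \<Rightarrow> real) \<Rightarrow> real" where
  "lasso_objective d N \<tau> lam x y \<theta> =
     1 / real N * (\<Sum>i<N. (dotp d (trunc_vec d \<tau> (x i)) \<theta> - trunc_real \<tau> (y i))\<^sup>2) + lam * norm1 d \<theta>"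

definition is_estimator ::
  "nat \<Rightarrow> nat \<Rightarrow> real \<Rightarrow> real \<Rightarrow> (nat \<Rightarrow> (nat \<Rightarrow> real)) \<Rightarrow> (nat \<Rightarrow> real) \<Rightarrow> (nat \<Rightarrow> real) \<Rightarrow> bool" where
  "is_estimator d N q lam x y \<theta> \<longleftrightarrow>
     is_arg_min (lasso_objective d N (trunc_level N q) lam x y) (\<lambda>\<theta>. \<theta> \<in> Rd d) \<theta>"

end

(* Truncation makes every coordinate of a design vector a product W * G of a bounded radial factor and
   a sub-Gaussian angular one: ellipticity and B B^T >= kappa I give |B U| >= sqrt kappa, and caps of
   the sphere are small. Invariance of the law under a reflection shows that the population gradient
   at eta * theta vanishes, so the truncation bias O(1 / sqrt N) is all that remains.

   For the noise, multipliers are split at the level sqrt (N / L), L = ln (e d / s) + beta. Below it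
   Bernstein's bound holds on the scale sqrt L; above it so few terms remain that Cauchy-Schwarz
   suffices. Exponential moments of single coordinates then control the linear form on the whole
   space, because the part of the coordinates above a threshold has small Euclidean norm.

   The quadratic form is bounded below on integer vectors of l1-norm at most m by a union bound over
   lower tails of nonnegative variables, and Maurey's empirical method extends this to all vectors at
   the price of a multiple of the squared l1-norm over m. The usual basic inequality for the Lasso
   combines both events. *)

theory Submission
  imports Defs "Jordan_Normal_Form.Spectral_Radius"
begin

section \<open>Exponential moments and linear forms\<close>

text \<open>With little more than four moments, the product of a response and a coordinate has
  little more than two, so all exponential integrability must come from the direction of the design
  vector, which is sub-Gaussian whatever its radius. Radius, response and direction are not
  independent. Weighted moments replace independence: Young's inequality separates a polynomial
  factor from a Gaussian one, at a price governed by the gap between \<open>q\<close> and 4.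

  The level \<open>N powr (2 / (q + 4))\<close> meets two demands. Its fourth power is at most
  \<open>N\<close>, which keeps the squared multiplier divided by \<open>N\<close> exponentially
  integrable. Its power \<open>q / 4 + 1\<close> equals \<open>sqrt N\<close>, which is the gain
  needed in the truncation bias.

  A rate in \<open>ln (e d / s)\<close> instead of \<open>ln d\<close> rules out maxima over
  coordinates. Markov's inequality is therefore applied once to a sum of \<open>d\<close>
  exponentials, and \<open>d\<close> is rewritten as \<open>s\<close> times the exponential of
  \<open>ln (d / s)\<close>. The factor \<open>s\<close> that is left is paid for by the term
  \<open>sqrt s * norm2\<close>.

  Curvature is proved for the design truncated at level 1, which lies below the actual level, so
  that its constants do not depend on \<open>N\<close>.\<close>

lemma exp_le_quadratic: "exp x \<le> 1 + x + x\<^sup>2 * exp \<bar>x\<bar>" for x :: real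
proof -
  obtain t where t: "\<bar>t\<bar> \<le> \<bar>x\<bar>" "exp x = (\<Sum>m<2. x ^ m / fact m) + exp t / fact 2 * x ^ 2"
    using Maclaurin_exp_le[of x 2] by blast
  have "exp t / 2 * x\<^sup>2 \<le> exp \<bar>x\<bar> * x\<^sup>2"
    using t(1) by (intro mult_right_mono) (smt (verit) exp_le_cancel_iff exp_gt_zero field_sum_of_halves, simp)
  then show ?thesis using t(2) by (simp add: numeral_2_eq_2 mult.commute)
qed

text \<open>Convexity of \<open>exp\<close> between 0 and \<open>y\<close>. It moves a small factor
  out of the exponent, and in \<open>mlt_exp_m2\<close> this is how a factor of order
  \<open>1 / N\<close> appears in front of an exponential.\<close>

lemma exp_mult_le_chord:
  fixes x y :: real
  assumes "0 \<le> x" "x \<le> 1"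
  shows "exp (x * y) \<le> 1 + x * (exp y - 1)"
proof -
  have "exp ((1 - x) *\<^sub>R 0 + x *\<^sub>R y) \<le> (1 - x) * exp 0 + x * exp y"
    using convex_onD[OF exp_convex, of x 0 y] assms by simp
  then show ?thesis by (simp add: algebra_simps)
qed

text \<open>Young's inequality for the exponents \<open>q / p\<close> and \<open>q / (q - p)\<close>
  without its constants: whichever of \<open>h\<close> and \<open>x powr (q - p)\<close> is larger,
  one of the two terms alone dominates the product.\<close>

lemma powr_mult_le_add:
  fixes x h p q :: real
  assumes "0 \<le> x" "0 \<le> h" "0 \<le> p" "p < q"
  shows "x powr p * h \<le> x powr q + h powr (q / (q - p))"
proof (cases "x = 0 \<or> h = 0")
  case False
  then have pos: "x > 0" "h > 0" using assms by auto
  show ?thesis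
  proof (cases "h \<le> x powr (q - p)")
    case True
    then have "x powr p * h \<le> x powr p * x powr (q - p)"
      by (intro mult_left_mono) auto
    also have "\<dots> = x powr q" by (simp flip: powr_add)
    finally show ?thesis using powr_ge_zero[of h "q / (q - p)"] by linarith
  next
    case False
    then have "(x powr (q - p)) powr (p / (q - p)) \<le> h powr (p / (q - p))"
      using assms by (intro powr_mono2) auto
    then have "x powr p \<le> h powr (p / (q - p))"
      using assms by (simp add: powr_powr)
    then have "x powr p * h \<le> h powr (p / (q - p)) * h powr 1"
      using pos by (intro mult_mono) auto
    also have "\<dots> = h powr (p / (q - p) + 1)" by (rule powr_add [symmetric])
    also have "p / (q - p) + 1 = q / (q - p)" using assms by (simp add: field_simps)
    finally show ?thesis using powr_ge_zero[of x q] by linarith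
  qed
qed (use assms in auto)

lemma sum_mult_le_L2:
  "(\<Sum>j<d. f j * \<bar>v j\<bar>) \<le> sqrt (\<Sum>j<d. (f j)\<^sup>2) * norm2 d v"
proof -
  have "(\<Sum>j<d. f j * \<bar>v j\<bar>) \<le> (\<Sum>j<d. \<bar>f j\<bar> * \<bar>v j\<bar>)"
    by (intro sum_mono mult_right_mono) auto
  also have "\<dots> \<le> L2_set f {..<d} * L2_set v {..<d}"
    by (rule L2_set_mult_ineq)
  finally show ?thesis by (simp add: norm2_def L2_set_def)
qed

text \<open>This replaces chaining: exponential moments of the single coordinates control the dual norm of
  \<open>\<lambda>v. a * norm1 d v + sqrt (2 * s) * norm2 d v\<close>, because the part of \<open>Y\<close> above the level \<open>a\<close> has
  squared Euclidean norm at most \<open>2 * s\<close>.\<close>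

lemma sum_mult_le_of_exp_sum:
  fixes Y v :: "nat \<Rightarrow> real"
  assumes "(\<Sum>j<d. exp (Y j)) \<le> s * exp a" "s \<ge> 0"
  shows "(\<Sum>j<d. Y j * \<bar>v j\<bar>) \<le> a * norm1 d v + sqrt (2 * s) * norm2 d v"
proof -
  define E where "E j = max 0 (Y j - a)" for j
  have E2: "(E j)\<^sup>2 \<le> 2 * exp (Y j - a)" for j
  proof (cases "Y j - a \<ge> 0")
    case True
    then show ?thesis using exp_lower_Taylor_quadratic[OF True]
      by (simp add: E_def max_def)
  next
    case False
    then show ?thesis by (simp add: E_def max_def)
  qed
  have "(\<Sum>j<d. (E j)\<^sup>2) \<le> (\<Sum>j<d. 2 * exp (Y j - a))"
    by (intro sum_mono E2)
  also have "\<dots> = 2 * exp (- a) * (\<Sum>j<d. exp (Y j))"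
    by (simp add: sum_distrib_left exp_diff exp_minus field_simps)
  also have "\<dots> \<le> 2 * exp (- a) * (s * exp a)"
    by (intro mult_left_mono assms) auto
  also have "\<dots> = 2 * s" by (simp add: exp_minus field_simps)
  finally have S: "(\<Sum>j<d. (E j)\<^sup>2) \<le> 2 * s" .
  have "(\<Sum>j<d. Y j * \<bar>v j\<bar>) \<le> (\<Sum>j<d. (a + E j) * \<bar>v j\<bar>)"
    by (intro sum_mono mult_right_mono) (auto simp: E_def)
  also have "\<dots> = a * norm1 d v + (\<Sum>j<d. E j * \<bar>v j\<bar>)"
    by (simp add: norm1_def algebra_simps sum.distrib sum_distrib_left)
  also have "(\<Sum>j<d. E j * \<bar>v j\<bar>) \<le> sqrt (\<Sum>j<d. (E j)\<^sup>2) * norm2 d v"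
    by (rule sum_mult_le_L2)
  also have "\<dots> \<le> sqrt (2 * s) * norm2 d v"
    using S by (intro mult_right_mono) (auto simp: norm2_def L2_set_nonneg)
  finally show ?thesis by simp
qed

text \<open>Cauchy-Schwarz over the observations produces square roots of exponentially integrable
  sums. AM-GM between \<open>a\<close> and \<open>Y j\<close> reduces them to the linear case, and
  dividing by \<open>sqrt a\<close> restores the scale.\<close>

lemma sum_sqrt_mult_le_of_exp_sum:
  fixes Y v :: "nat \<Rightarrow> real"
  assumes "(\<Sum>j<d. exp (Y j)) \<le> s * exp a" "s \<ge> 0" "a > 0" "\<And>j. j < d \<Longrightarrow> Y j \<ge> 0"
  shows "(\<Sum>j<d. sqrt (Y j) * \<bar>v j\<bar>) \<le> sqrt a * norm1 d v + sqrt s / sqrt a * norm2 d v"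
proof -
  have amgm: "sqrt a * sqrt (Y j) \<le> a / 2 + Y j / 2" if "j < d" for j
    using arith_geo_mean_sqrt[of a "Y j"] assms(3) assms(4)[OF that]
    by (simp add: real_sqrt_mult field_simps)
  have "sqrt a * (\<Sum>j<d. sqrt (Y j) * \<bar>v j\<bar>) = (\<Sum>j<d. (sqrt a * sqrt (Y j)) * \<bar>v j\<bar>)"
    by (simp add: sum_distrib_left mult.assoc)
  also have "\<dots> \<le> (\<Sum>j<d. (a / 2 + Y j / 2) * \<bar>v j\<bar>)"
    by (intro sum_mono mult_right_mono amgm) auto
  also have "\<dots> = a / 2 * norm1 d v + (\<Sum>j<d. Y j * \<bar>v j\<bar>) / 2"
    by (simp add: norm1_def algebra_simps sum.distrib sum_distrib_left sum_divide_distrib)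
  also have "\<dots> \<le> a / 2 * norm1 d v + (a * norm1 d v + sqrt (2 * s) * norm2 d v) / 2"
    using sum_mult_le_of_exp_sum[OF assms(1,2), of v] by simp
  also have "\<dots> = a * norm1 d v + sqrt (s / 2) * norm2 d v"
    using assms(2) by (simp add: real_sqrt_mult real_sqrt_divide field_simps)
  also have "sqrt (s / 2) * norm2 d v \<le> sqrt s * norm2 d v"
    using assms(2) by (intro mult_right_mono) (auto simp: norm2_def L2_set_nonneg)
  finally have "(\<Sum>j<d. sqrt (Y j) * \<bar>v j\<bar>) \<le> (a * norm1 d v + sqrt s * norm2 d v) / sqrt a"
    using assms(3) by (simp add: field_simps)
  also have "\<dots> = sqrt a * norm1 d v + sqrt s / sqrt a * norm2 d v"
    using assms(3) by (simp add: field_simps flip: real_sqrt_mult)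
  finally show ?thesis .
qed

lemma (in prob_space) prob_gt_le_Markov:
  fixes g :: "'a \<Rightarrow> real"
  assumes [measurable]: "g \<in> borel_measurable M" and "\<And>x. 0 \<le> g x"
    and "(\<integral>\<^sup>+x. ennreal (g x) \<partial>M) \<le> ennreal b" "0 < a" "0 \<le> b"
  shows "prob {x \<in> space M. a < g x} \<le> b / a"
proof -
  have "emeasure M {x \<in> space M. a < g x} \<le> emeasure M {x \<in> space M. 1 \<le> ennreal (1 / a) * ennreal (g x)}"
    using assms(2,4) by (intro emeasure_mono) (auto simp flip: ennreal_mult ennreal_1 simp: field_simps)
  also have "\<dots> \<le> ennreal (1 / a) * (\<integral>\<^sup>+x. ennreal (g x) * indicator (space M) x \<partial>M)"
    by (rule nn_integral_Markov_inequality) auto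
  also have "(\<integral>\<^sup>+x. ennreal (g x) * indicator (space M) x \<partial>M) = (\<integral>\<^sup>+x. ennreal (g x) \<partial>M)"
    by (intro nn_integral_cong) auto
  also have "ennreal (1 / a) * \<dots> \<le> ennreal (1 / a) * ennreal b"
    by (intro mult_left_mono assms) auto
  also have "\<dots> = ennreal (b / a)"
    using assms(4,5) by (simp flip: ennreal_mult)
  finally show ?thesis
    using assms(4,5) by (simp add: emeasure_eq_measure)
qed

lemma nn_integral_PiM_exp_sum:
  fixes h :: "'a \<Rightarrow> real"
  assumes "prob_space M" "h \<in> borel_measurable M"
    and "(\<integral>\<^sup>+x. ennreal (exp (h x)) \<partial>M) \<le> ennreal b" "0 \<le> b"
  shows "(\<integral>\<^sup>+\<omega>. ennreal (exp (\<Sum>i<N. h (\<omega> i))) \<partial>PiM {..<N} (\<lambda>_. M)) \<le> ennreal (b ^ N)"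
proof -
  interpret prob_space M by fact
  interpret product_sigma_finite "\<lambda>_::nat. M" by standard
  note [measurable] = assms(2)
  have "(\<integral>\<^sup>+\<omega>. ennreal (exp (\<Sum>i<N. h (\<omega> i))) \<partial>PiM {..<N} (\<lambda>_. M))
      = (\<integral>\<^sup>+\<omega>. (\<Prod>i<N. ennreal (exp (h (\<omega> i)))) \<partial>PiM {..<N} (\<lambda>_. M))"
    by (simp add: exp_sum prod_ennreal)
  also have "\<dots> = (\<Prod>i<N. (\<integral>\<^sup>+x. ennreal (exp (h x)) \<partial>M))"
    by (rule product_nn_integral_prod) auto
  also have "\<dots> \<le> (\<Prod>i<N. ennreal b)"
    by (induction N) (auto intro!: mult_mono assms(3))
  also have "\<dots> = ennreal (b ^ N)" using assms(4) by (simp add: ennreal_power)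
  finally show ?thesis .
qed

section \<open>The multiplier process\<close>

lemma borel_measurable_PiM_sum:
  fixes h :: "'a \<Rightarrow> real"
  assumes [measurable]: "h \<in> borel_measurable M"
  shows "(\<lambda>\<omega>. \<Sum>i<N. h (\<omega> i)) \<in> borel_measurable (PiM {..<N} (\<lambda>_. M))"
  by (intro borel_measurable_sum measurable_compose[OF measurable_component_singleton]) auto

text \<open>One application of Markov's inequality to the whole sum of exponentials. A union bound
  over \<open>J\<close> would retain only a bound on the largest term; the bound on the sum is what
  lets the coordinates above a level be counted.\<close>

lemma (in prob_space) exp_sum_event:
  fixes h :: "'k \<Rightarrow> 'a \<Rightarrow> real" and N :: nat and b p :: real
  assumes J: "finite J" "J \<noteq> {}" and h: "\<And>k. k \<in> J \<Longrightarrow> h k \<in> borel_measurable M"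
    and b: "\<And>k. k \<in> J \<Longrightarrow> (\<integral>\<^sup>+x. ennreal (exp (h k x)) \<partial>M) \<le> ennreal b" "b > 0" and "p > 0"
  shows "\<exists>A\<in>sets (PiM {..<N} (\<lambda>_. M)). measure (PiM {..<N} (\<lambda>_. M)) A \<ge> 1 - p \<and>
    (\<forall>\<omega>\<in>A. (\<Sum>k\<in>J. exp (\<Sum>i<N. h k (\<omega> i))) \<le> card J * b ^ N / p)"
proof -
  define S where "S = PiM {..<N} (\<lambda>_. M)"
  interpret S: prob_space S unfolding S_def by (intro prob_space_PiM prob_space_axioms)
  define g where "g \<omega> = (\<Sum>k\<in>J. exp (\<Sum>i<N. h k (\<omega> i)))" for \<omega> :: "nat \<Rightarrow> 'a"
  have meas: "(\<lambda>\<omega>. exp (\<Sum>i<N. h k (\<omega> i))) \<in> borel_measurable S" if "k \<in> J" for k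
    unfolding S_def using h[OF that]
    by (intro borel_measurable_exp[THEN measurable_compose[rotated]] borel_measurable_PiM_sum)
  have g: "g \<in> borel_measurable S" unfolding g_def by (intro borel_measurable_sum meas)
  have g0: "0 \<le> g \<omega>" for \<omega> by (simp add: g_def sum_nonneg)
  define a where "a = card J * b ^ N / p"
  have a: "a > 0" using J b(2) \<open>p > 0\<close> by (simp add: a_def card_gt_0_iff)
  have "(\<integral>\<^sup>+\<omega>. ennreal (g \<omega>) \<partial>S) = (\<integral>\<^sup>+\<omega>. (\<Sum>k\<in>J. ennreal (exp (\<Sum>i<N. h k (\<omega> i)))) \<partial>S)"
    unfolding g_def by (intro nn_integral_cong) (simp flip: sum_ennreal)
  also have "\<dots> = (\<Sum>k\<in>J. (\<integral>\<^sup>+\<omega>. ennreal (exp (\<Sum>i<N. h k (\<omega> i))) \<partial>S))"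
    using meas by (subst nn_integral_sum) auto
  also have "\<dots> \<le> (\<Sum>k\<in>J. ennreal (b ^ N))"
    unfolding S_def using b by (intro sum_mono nn_integral_PiM_exp_sum[OF prob_space_axioms] h) auto
  also have "\<dots> = ennreal (card J * b ^ N)"
    using b(2) by (simp add: ennreal_of_nat_eq_real_of_nat flip: ennreal_mult)
  finally have "S.prob {\<omega> \<in> space S. a < g \<omega>} \<le> card J * b ^ N / a"
    using g g0 a b(2) by (intro S.prob_gt_le_Markov) auto
  also have "\<dots> = p" using J b(2) by (simp add: a_def card_gt_0_iff)
  finally have "S.prob (space S - {\<omega> \<in> space S. a < g \<omega>}) \<ge> 1 - p"
    using g by (simp add: S.prob_compl)
  moreover have "space S - {\<omega> \<in> space S. a < g \<omega>} \<in> sets S" using g by measurable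
  ultimately show ?thesis unfolding S_def a_def g_def
    by (intro bexI[of _ "space S - {\<omega> \<in> space S. a < g \<omega>}"]) (auto simp: S_def a_def g_def)
qed

lemma ln_dim_ratio:
  assumes "0 < s" "s \<le> d"
  shows "ln (exp 1 * real d / real s) = 1 + ln (real d / real s)" "0 \<le> ln (real d / real s)"
  using assms by (auto simp: ln_mult ln_div)

text \<open>\<open>m\<close> is a heavy-tailed multiplier and \<open>G j\<close> a sub-Gaussian
  coordinate that may depend on it. Instead of independence, \<open>m2_exp_G2\<close> requires the
  second moment of \<open>m\<close> to survive a Gaussian weight in each \<open>G j\<close>.\<close>

locale multiplier = prob_space M for M :: "'a measure" +
  fixes m :: "'a \<Rightarrow> real" and G :: "nat \<Rightarrow> 'a \<Rightarrow> real" and d :: nat and c C :: real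
  assumes m_meas [measurable]: "m \<in> borel_measurable M"
    and G_meas: "j < d \<Longrightarrow> G j \<in> borel_measurable M"
    and c_pos: "c > 0" and C_pos: "C > 0"
    and m2_exp_G2: "j < d \<Longrightarrow> (\<integral>\<^sup>+x. ennreal ((m x)\<^sup>2 * exp (c * (G j x)\<^sup>2)) \<partial>M) \<le> ennreal C"
begin

definition small :: "real \<Rightarrow> nat \<Rightarrow> 'a \<Rightarrow> real" where
  "small K j x = (if \<bar>m x\<bar> \<le> K then m x * G j x else 0)"

lemma small_meas: "j < d \<Longrightarrow> small K j \<in> borel_measurable M"
  unfolding small_def using G_meas[measurable] by measurable

lemma integrable_m2_exp_G2:
  assumes "j < d"
  shows "integrable M (\<lambda>x. (m x)\<^sup>2 * exp (c * (G j x)\<^sup>2))"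
    and "(LINT x|M. (m x)\<^sup>2 * exp (c * (G j x)\<^sup>2)) \<le> C"
proof -
  note [measurable] = G_meas[OF assms]
  show I: "integrable M (\<lambda>x. (m x)\<^sup>2 * exp (c * (G j x)\<^sup>2))"
    using le_less_trans[OF m2_exp_G2[OF assms]] by (intro integrableI_nonneg) auto
  have "ennreal (LINT x|M. (m x)\<^sup>2 * exp (c * (G j x)\<^sup>2)) \<le> ennreal C"
    using m2_exp_G2[OF assms] by (subst nn_integral_eq_integral[symmetric]) (use I in auto)
  then show "(LINT x|M. (m x)\<^sup>2 * exp (c * (G j x)\<^sup>2)) \<le> C"
    using C_pos by (simp add: ennreal_le_iff)
qed

text \<open>The exponent \<open>c * g\<^sup>2\<close> is spent in two halves: one absorbs the factor
  \<open>g\<^sup>2\<close>, the other dominates the linear exponent because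
  \<open>2 * \<bar>g\<bar> \<le> 1 + g\<^sup>2\<close>.\<close>

lemma sq_mult_exp_le: "g\<^sup>2 * exp (c * \<bar>g\<bar>) \<le> 2 / c * exp (c / 2) * exp (c * g\<^sup>2)" for g :: real
proof -
  have "c * g\<^sup>2 / 2 \<le> exp (c * g\<^sup>2 / 2)" using exp_ge_add_one_self[of "c * g\<^sup>2 / 2"] by linarith
  then have 1: "g\<^sup>2 \<le> 2 / c * exp (c * g\<^sup>2 / 2)" using c_pos by (simp add: field_simps)
  have "2 * \<bar>g\<bar> \<le> 1 + g\<^sup>2" using zero_le_power2[of "\<bar>g\<bar> - 1"] by (simp add: power2_eq_square algebra_simps)
  then have "c * (2 * \<bar>g\<bar>) \<le> c * (1 + g\<^sup>2)" using c_pos by (intro mult_left_mono) auto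
  then have 2: "exp (c * \<bar>g\<bar>) \<le> exp (c / 2 + c * g\<^sup>2 / 2)" by (simp add: algebra_simps)
  have "g\<^sup>2 * exp (c * \<bar>g\<bar>) \<le> (2 / c * exp (c * g\<^sup>2 / 2)) * exp (c / 2 + c * g\<^sup>2 / 2)"
    using 1 2 c_pos by (intro mult_mono) auto
  also have "\<dots> = 2 / c * exp (c / 2) * exp (c * g\<^sup>2)"
    by (simp add: mult_exp_exp)
  finally show ?thesis .
qed

lemma abs_le_exp_sq: "\<bar>g\<bar> \<le> (1 + 1 / c) * exp (c * g\<^sup>2)" for g :: real
proof -
  have "c * g\<^sup>2 \<le> exp (c * g\<^sup>2)" using exp_ge_add_one_self[of "c * g\<^sup>2"] by linarith
  then have "g\<^sup>2 \<le> 1 / c * exp (c * g\<^sup>2)" using c_pos by (simp add: field_simps)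
  moreover have "\<bar>g\<bar> \<le> 1 + g\<^sup>2"
    using zero_le_power2[of "\<bar>g\<bar> - 1"] by (simp add: power2_eq_square algebra_simps)
  moreover have "1 \<le> exp (c * g\<^sup>2)" using c_pos by simp
  moreover have "(1 + 1 / c) * exp (c * g\<^sup>2) = exp (c * g\<^sup>2) + 1 / c * exp (c * g\<^sup>2)"
    by (simp add: algebra_simps)
  ultimately show ?thesis by linarith
qed

lemma integrable_mG:
  assumes "j < d"
  shows "integrable M (\<lambda>x. m x * G j x)"
proof -
  note [measurable] = G_meas[OF assms]
  have "integrable M (\<lambda>x. 1 / c * ((m x)\<^sup>2 * exp (c * (G j x)\<^sup>2)) + 1)"
    using integrable_m2_exp_G2[OF assms] by auto
  then show ?thesis
  proof (rule Bochner_Integration.integrable_bound)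
    show "AE x in M. norm (m x * G j x) \<le> norm (1 / c * ((m x)\<^sup>2 * exp (c * (G j x)\<^sup>2)) + 1)"
    proof (intro AE_I2)
      fix x
      have "c * (G j x)\<^sup>2 \<le> exp (c * (G j x)\<^sup>2)"
        using exp_ge_add_one_self[of "c * (G j x)\<^sup>2"] by linarith
      then have "(m x)\<^sup>2 * (c * (G j x)\<^sup>2) \<le> (m x)\<^sup>2 * exp (c * (G j x)\<^sup>2)"
        by (intro mult_left_mono) auto
      then have "(m x * G j x)\<^sup>2 \<le> 1 / c * ((m x)\<^sup>2 * exp (c * (G j x)\<^sup>2))"
        using c_pos by (simp add: field_simps)
      moreover have "\<bar>m x * G j x\<bar> \<le> 1 + (m x * G j x)\<^sup>2"
        using zero_le_power2[of "\<bar>m x * G j x\<bar> - 1"] by (simp add: power2_eq_square algebra_simps)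
      ultimately show "norm (m x * G j x) \<le> norm (1 / c * ((m x)\<^sup>2 * exp (c * (G j x)\<^sup>2)) + 1)"
        using c_pos by auto
    qed
  qed auto
qed

lemma integrable_small:
  assumes "j < d"
  shows "integrable M (small K j)"
  by (rule Bochner_Integration.integrable_bound[OF integrable_mG[OF assms]])
    (use small_meas[OF assms] in \<open>auto simp: small_def\<close>)

text \<open>Where the multiplier exceeds \<open>K\<close> it is at most its square over
  \<open>K\<close>. For \<open>K = sqrt (N / L)\<close> the shift of the mean is of order
  \<open>sqrt (L / N)\<close>, which is within the target rate.\<close>

lemma abs_expectation_large_le:
  assumes "j < d" "K > 0"
  shows "\<bar>(LINT x|M. m x * G j x) - (LINT x|M. small K j x)\<bar> \<le> (1 + 1 / c) * C / K"
proof -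
  note [measurable] = G_meas[OF assms(1)] small_meas[OF assms(1)]
  note int = integrable_mG[OF assms(1)] integrable_small[OF assms(1)]
  have pw: "\<bar>m x * G j x - small K j x\<bar> \<le> (1 + 1 / c) / K * ((m x)\<^sup>2 * exp (c * (G j x)\<^sup>2))" for x
  proof (cases "\<bar>m x\<bar> \<le> K")
    case True
    then show ?thesis using c_pos assms by (simp add: small_def)
  next
    case False
    have "\<bar>m x\<bar> * K \<le> \<bar>m x\<bar> * \<bar>m x\<bar>" using False by (intro mult_left_mono) auto
    then have "\<bar>m x\<bar> \<le> (m x)\<^sup>2 / K" using assms by (simp add: field_simps power2_eq_square)
    then have "\<bar>m x\<bar> * \<bar>G j x\<bar> \<le> (m x)\<^sup>2 / K * ((1 + 1 / c) * exp (c * (G j x)\<^sup>2))"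
      using abs_le_exp_sq[of "G j x"] assms by (intro mult_mono) auto
    then show ?thesis using False by (simp add: small_def abs_mult algebra_simps add_divide_distrib)
  qed
  have "\<bar>(LINT x|M. m x * G j x) - (LINT x|M. small K j x)\<bar> = \<bar>LINT x|M. m x * G j x - small K j x\<bar>"
    using int by simp
  also have "\<dots> \<le> (LINT x|M. \<bar>m x * G j x - small K j x\<bar>)" by (rule integral_abs_bound)
  also have "\<dots> \<le> (LINT x|M. (1 + 1 / c) / K * ((m x)\<^sup>2 * exp (c * (G j x)\<^sup>2)))"
    using int integrable_m2_exp_G2[OF assms(1)] pw by (intro integral_mono) auto
  also have "\<dots> = (1 + 1 / c) / K * (LINT x|M. (m x)\<^sup>2 * exp (c * (G j x)\<^sup>2))" by simp
  also have "\<dots> \<le> (1 + 1 / c) / K * C"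
    using integrable_m2_exp_G2[OF assms(1)] c_pos assms by (intro mult_left_mono) auto
  finally show ?thesis by simp
qed

text \<open>Bernstein's argument. Below the level, \<open>\<bar>\<theta>\<bar> * K \<le> c\<close>
  makes the exponent at most linear in \<open>\<bar>G j\<bar>\<close> with slope \<open>c\<close>.
  The quadratic remainder still carries \<open>(m x)\<^sup>2\<close>, and
  \<open>sq_mult_exp_le\<close> brings it into the form covered by \<open>m2_exp_G2\<close>.\<close>

lemma mgf_small:
  assumes "j < d" "K > 0" "\<bar>\<theta>\<bar> * K \<le> c"
  shows "(\<integral>\<^sup>+x. ennreal (exp (\<theta> * (small K j x - (LINT x|M. small K j x)))) \<partial>M)
    \<le> ennreal (exp (\<theta>\<^sup>2 * (2 / c * exp (c / 2) * C)))"
proof -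
  note [measurable] = G_meas[OF assms(1)] small_meas[OF assms(1)]
  note int = integrable_small[OF assms(1)] integrable_m2_exp_G2[OF assms(1)]
  define \<mu> where "\<mu> = (LINT x|M. small K j x)"
  define A where "A = 2 / c * exp (c / 2)"
  have A: "A > 0" using c_pos by (simp add: A_def)
  have pw: "exp (\<theta> * small K j x)
      \<le> 1 + \<theta> * small K j x + \<theta>\<^sup>2 * A * ((m x)\<^sup>2 * exp (c * (G j x)\<^sup>2))" for x
  proof (cases "\<bar>m x\<bar> \<le> K")
    case True
    have "\<bar>\<theta>\<bar> * \<bar>m x\<bar> \<le> \<bar>\<theta>\<bar> * K" using True by (intro mult_left_mono) auto
    then have "\<bar>\<theta> * m x\<bar> \<le> c" using assms by (simp add: abs_mult)
    then have "\<bar>\<theta> * m x\<bar> * \<bar>G j x\<bar> \<le> c * \<bar>G j x\<bar>" by (intro mult_right_mono) auto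
    then have "exp \<bar>\<theta> * small K j x\<bar> \<le> exp (c * \<bar>G j x\<bar>)" using True by (simp add: small_def abs_mult mult.assoc)
    then have "(\<theta> * small K j x)\<^sup>2 * exp \<bar>\<theta> * small K j x\<bar> \<le> (\<theta> * m x * G j x)\<^sup>2 * exp (c * \<bar>G j x\<bar>)"
      using True by (intro mult_mono) (auto simp: small_def mult.assoc)
    also have "\<dots> = (\<theta> * m x)\<^sup>2 * ((G j x)\<^sup>2 * exp (c * \<bar>G j x\<bar>))" by (simp add: power_mult_distrib)
    also have "\<dots> \<le> (\<theta> * m x)\<^sup>2 * (A * exp (c * (G j x)\<^sup>2))"
      unfolding A_def by (intro mult_left_mono sq_mult_exp_le) auto
    finally show ?thesis using exp_le_quadratic[of "\<theta> * small K j x"] by (simp add: power_mult_distrib algebra_simps)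
  next
    case False
    then show ?thesis using A by (simp add: small_def)
  qed
  have "(\<integral>\<^sup>+x. ennreal (exp (\<theta> * small K j x)) \<partial>M)
     \<le> (\<integral>\<^sup>+x. ennreal (1 + \<theta> * small K j x + \<theta>\<^sup>2 * A * ((m x)\<^sup>2 * exp (c * (G j x)\<^sup>2))) \<partial>M)"
    using pw by (intro nn_integral_mono ennreal_leI) auto
  also have "\<dots> = ennreal (LINT x|M. 1 + \<theta> * small K j x + \<theta>\<^sup>2 * A * ((m x)\<^sup>2 * exp (c * (G j x)\<^sup>2)))"
    using int by (intro nn_integral_eq_integral) (auto intro!: AE_I2 order_trans[OF exp_ge_zero pw])
  also have "(LINT x|M. 1 + \<theta> * small K j x + \<theta>\<^sup>2 * A * ((m x)\<^sup>2 * exp (c * (G j x)\<^sup>2)))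
     = 1 + \<theta> * \<mu> + \<theta>\<^sup>2 * A * (LINT x|M. (m x)\<^sup>2 * exp (c * (G j x)\<^sup>2))"
    using int by (simp add: \<mu>_def prob_space)
  also have "\<dots> \<le> 1 + \<theta> * \<mu> + \<theta>\<^sup>2 * A * C"
    using int A by (intro add_left_mono mult_left_mono) auto
  also have "\<dots> \<le> exp (\<theta> * \<mu> + \<theta>\<^sup>2 * (A * C))"
    using exp_ge_add_one_self[of "\<theta> * \<mu> + \<theta>\<^sup>2 * (A * C)"] by (simp add: algebra_simps)
  finally have *: "(\<integral>\<^sup>+x. ennreal (exp (\<theta> * small K j x)) \<partial>M) \<le> ennreal (exp (\<theta> * \<mu> + \<theta>\<^sup>2 * (A * C)))"
    by (simp add: ennreal_leI)
  have "(\<integral>\<^sup>+x. ennreal (exp (\<theta> * (small K j x - \<mu>))) \<partial>M)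
     = (\<integral>\<^sup>+x. ennreal (exp (- \<theta> * \<mu>)) * ennreal (exp (\<theta> * small K j x)) \<partial>M)"
    by (intro nn_integral_cong) (simp flip: ennreal_mult add: mult_exp_exp algebra_simps)
  also have "\<dots> = ennreal (exp (- \<theta> * \<mu>)) * (\<integral>\<^sup>+x. ennreal (exp (\<theta> * small K j x)) \<partial>M)"
    by (rule nn_integral_cmult) measurable
  also have "\<dots> \<le> ennreal (exp (- \<theta> * \<mu>)) * ennreal (exp (\<theta> * \<mu> + \<theta>\<^sup>2 * (A * C)))"
    by (intro mult_left_mono *) auto
  also have "\<dots> = ennreal (exp (\<theta>\<^sup>2 * (A * C)))"
    by (simp flip: ennreal_mult add: mult_exp_exp)
  finally show ?thesis by (simp add: \<mu>_def A_def)
qed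

text \<open>The exponent vanishes below the level, and above it 1 is at most
  \<open>(m x)\<^sup>2 / K\<^sup>2\<close>, so the integral exceeds 1 by at most
  \<open>C / K\<^sup>2\<close>. With \<open>K\<^sup>2 = N / L\<close> the product over all
  \<open>N\<close> observations stays below \<open>exp (C * L)\<close>.\<close>

lemma mgf_large:
  assumes "j < d" "K > 0"
  shows "(\<integral>\<^sup>+x. ennreal (exp (if \<bar>m x\<bar> \<le> K then 0 else c * (G j x)\<^sup>2)) \<partial>M) \<le> ennreal (exp (C / K\<^sup>2))"
proof -
  note [measurable] = G_meas[OF assms(1)]
  have pw: "exp (if \<bar>m x\<bar> \<le> K then 0 else c * (G j x)\<^sup>2) \<le> 1 + 1 / K\<^sup>2 * ((m x)\<^sup>2 * exp (c * (G j x)\<^sup>2))" for x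
  proof (cases "\<bar>m x\<bar> \<le> K")
    case False
    then have "K\<^sup>2 \<le> (m x)\<^sup>2" using assms by (simp flip: abs_le_square_iff)
    then have "K\<^sup>2 * exp (c * (G j x)\<^sup>2) \<le> (m x)\<^sup>2 * exp (c * (G j x)\<^sup>2)" by (intro mult_right_mono) auto
    then have "exp (c * (G j x)\<^sup>2) \<le> 1 / K\<^sup>2 * ((m x)\<^sup>2 * exp (c * (G j x)\<^sup>2))"
      using assms by (simp add: field_simps)
    then show ?thesis using False by simp
  qed simp
  have "(\<integral>\<^sup>+x. ennreal (exp (if \<bar>m x\<bar> \<le> K then 0 else c * (G j x)\<^sup>2)) \<partial>M)
     \<le> (\<integral>\<^sup>+x. ennreal (1 + 1 / K\<^sup>2 * ((m x)\<^sup>2 * exp (c * (G j x)\<^sup>2))) \<partial>M)"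
    using pw by (intro nn_integral_mono ennreal_leI)
  also have "\<dots> = (\<integral>\<^sup>+x. 1 + ennreal (1 / K\<^sup>2) * ennreal ((m x)\<^sup>2 * exp (c * (G j x)\<^sup>2)) \<partial>M)"
    by (intro nn_integral_cong) (simp flip: ennreal_mult ennreal_1 ennreal_plus)
  also have "\<dots> = 1 + ennreal (1 / K\<^sup>2) * (\<integral>\<^sup>+x. ennreal ((m x)\<^sup>2 * exp (c * (G j x)\<^sup>2)) \<partial>M)"
    by (simp add: nn_integral_add nn_integral_cmult emeasure_space_1)
  also have "\<dots> \<le> 1 + ennreal (1 / K\<^sup>2) * ennreal C"
    by (intro add_left_mono mult_left_mono m2_exp_G2 assms) auto
  also have "\<dots> = ennreal (1 + C / K\<^sup>2)"
    using C_pos by (simp flip: ennreal_mult ennreal_1 ennreal_plus)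
  also have "\<dots> \<le> ennreal (exp (C / K\<^sup>2))" by (intro ennreal_leI exp_ge_add_one_self)
  finally show ?thesis .
qed

end

context multiplier
begin

text \<open>The level \<open>K = sqrt (N / L)\<close> splits the multipliers: below it the sums are sub-Gaussian up to
  the scale \<open>sqrt L\<close>, above it so few terms remain that Cauchy-Schwarz suffices.\<close>

lemma noise_small_event:
  fixes N :: nat and L \<beta> :: real
  assumes "0 < s" "s \<le> d" "N > 0" "\<beta> > 2" and L: "L = 1 + ln (d / s) + \<beta>"
  defines "C4 \<equiv> 2 / c * exp (c / 2) * C"
  shows "\<exists>A\<in>sets (PiM {..<N} (\<lambda>_. M)).
    measure (PiM {..<N} (\<lambda>_. M)) A \<ge> 1 - exp (- \<beta>) / 3 \<and>
    (\<forall>\<omega>\<in>A. \<forall>v. (\<Sum>j<d. \<bar>\<Sum>i<N. small (sqrt (N / L)) j (\<omega> i) - (LINT x|M. small (sqrt (N / L)) j x)\<bar> * \<bar>v j\<bar>)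
       \<le> sqrt (N / L) / c * ((2 + c\<^sup>2 * C4) * L * norm1 d v + sqrt (2 * real s) * norm2 d v))"
proof -
  have lnds: "ln (d / s) \<ge> 0" using ln_dim_ratio assms(1,2) by auto
  then have Lpos: "L > 0" using assms(4) L by linarith
  define K where "K = sqrt (N / L)"
  have K: "K > 0" "K\<^sup>2 = N / L" using Lpos assms(3) by (auto simp: K_def)
  \<comment> \<open>The largest value that \<open>mgf_small\<close> admits; it makes the total
    variance term a multiple of \<open>L\<close>.\<close>
  define \<theta> where "\<theta> = c / K"
  have \<theta>: "\<theta> > 0" using K c_pos by (simp add: \<theta>_def)
  have N\<theta>: "real N * \<theta>\<^sup>2 = c\<^sup>2 * L" using K Lpos assms by (simp add: \<theta>_def power_divide)
  define h where "h j x = small K j x - (LINT x|M. small K j x)" for j x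
  \<comment> \<open>Both signs are included because the exponential of an absolute value is at most
    the sum of the two signed exponentials.\<close>
  define J where "J = {1, - 1 :: real} \<times> {..<d}"
  have dpos: "d > 0" using assms by simp
  then have J: "finite J" "J \<noteq> {}" "card J = 2 * d" by (auto simp: J_def card_cartesian_product)
  define b where "b = exp (\<theta>\<^sup>2 * C4)"
  have bN: "b ^ N = exp (c\<^sup>2 * C4 * L)"
  proof -
    have "b ^ N = exp (real N * \<theta>\<^sup>2 * C4)" by (simp flip: exp_of_nat_mult add: b_def mult.assoc)
    then show ?thesis unfolding N\<theta> by (simp add: mult_ac)
  qed
  have "\<exists>A\<in>sets (PiM {..<N} (\<lambda>_. M)). measure (PiM {..<N} (\<lambda>_. M)) A \<ge> 1 - exp (- \<beta>) / 3 \<and>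
    (\<forall>\<omega>\<in>A. (\<Sum>k\<in>J. exp (\<Sum>i<N. fst k * \<theta> * h (snd k) (\<omega> i))) \<le> card J * b ^ N / (exp (- \<beta>) / 3))"
  proof (rule exp_sum_event[OF J(1,2)])
    fix k assume k: "k \<in> J"
    have m: "h (snd k) \<in> borel_measurable M"
      unfolding h_def using k small_meas[of "snd k"] by (auto simp: J_def)
    show "(\<lambda>x. fst k * \<theta> * h (snd k) x) \<in> borel_measurable M" using m by measurable
    have "\<bar>fst k\<bar> = 1" using k by (auto simp: J_def)
    moreover from this have "(fst k * \<theta>)\<^sup>2 = \<theta>\<^sup>2" by (metis mult_1 power2_abs power_mult_distrib one_power2)
    ultimately show "(\<integral>\<^sup>+x. ennreal (exp (fst k * \<theta> * h (snd k) x)) \<partial>M) \<le> ennreal b"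
      using mgf_small[of "snd k" K "fst k * \<theta>"] k K \<theta>
      by (simp add: h_def b_def C4_def J_def abs_mult mem_Times_iff) (simp add: \<theta>_def)
  qed (auto simp: b_def)
  then obtain A where A: "A \<in> sets (PiM {..<N} (\<lambda>_. M))" "measure (PiM {..<N} (\<lambda>_. M)) A \<ge> 1 - exp (- \<beta>) / 3"
    "\<And>\<omega>. \<omega> \<in> A \<Longrightarrow> (\<Sum>k\<in>J. exp (\<Sum>i<N. fst k * \<theta> * h (snd k) (\<omega> i))) \<le> card J * b ^ N / (exp (- \<beta>) / 3)"
    by blast
  have "(\<Sum>j<d. \<bar>\<Sum>i<N. h j (\<omega> i)\<bar> * \<bar>v j\<bar>)
       \<le> K / c * ((2 + c\<^sup>2 * C4) * L * norm1 d v + sqrt (2 * real s) * norm2 d v)" if "\<omega> \<in> A" for \<omega> v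
  proof -
    define Y where "Y j = \<theta> * \<bar>\<Sum>i<N. h j (\<omega> i)\<bar>" for j
    have "exp (Y j) \<le> (\<Sum>\<sigma>\<in>{1, - 1}. exp (\<Sum>i<N. \<sigma> * \<theta> * h j (\<omega> i)))" for j
    proof -
      have "Y j = (\<Sum>i<N. 1 * \<theta> * h j (\<omega> i)) \<or> Y j = (\<Sum>i<N. - 1 * \<theta> * h j (\<omega> i))"
        by (auto simp: Y_def abs_if sum_negf sum_distrib_left)
      then show ?thesis by (auto simp: sum_negf)
    qed
    then have "(\<Sum>j<d. exp (Y j)) \<le> (\<Sum>j<d. \<Sum>\<sigma>\<in>{1, - 1}. exp (\<Sum>i<N. \<sigma> * \<theta> * h j (\<omega> i)))"
      by (intro sum_mono)
    also have "\<dots> = (\<Sum>\<sigma>\<in>{1, - 1}. \<Sum>j<d. exp (\<Sum>i<N. \<sigma> * \<theta> * h j (\<omega> i)))" by (rule sum.swap)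
    also have "\<dots> = (\<Sum>k\<in>J. exp (\<Sum>i<N. fst k * \<theta> * h (snd k) (\<omega> i)))"
      unfolding J_def sum.cartesian_product by (simp add: case_prod_beta')
    also have "\<dots> \<le> card J * b ^ N / (exp (- \<beta>) / 3)" by (rule A(3)[OF that])
    also have "\<dots> = 6 * (d * exp (c\<^sup>2 * C4 * L) * exp \<beta>)" unfolding J(3) bN by (simp add: exp_minus field_simps)
    \<comment> \<open>The factor 6 is two signs times the 3 from the failure probability, and it is
      absorbed by \<open>exp 2\<close>. Replacing \<open>d\<close> by
      \<open>s * exp (ln (d / s))\<close> leaves only the factor \<open>s\<close> in front, the rest
      being part of \<open>L\<close>.\<close>
    also have "\<dots> \<le> real s * exp ((2 + c\<^sup>2 * C4) * L)"
    proof -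
      have "(5 / 2) * (5 / 2) \<le> exp 1 * exp (1::real)"
        using exp_lower_Taylor_quadratic[of 1] by (intro mult_mono) auto
      then have "(6::real) \<le> exp 2" by (simp add: mult_exp_exp)
      then have "6 * (d * exp (c\<^sup>2 * C4 * L) * exp \<beta>) \<le> exp 2 * (d * exp (c\<^sup>2 * C4 * L) * exp \<beta>)"
        by (rule mult_right_mono) simp
      also have "\<dots> = exp 2 * (s * exp (ln (d / s)) * exp (c\<^sup>2 * C4 * L) * exp \<beta>)" using dpos assms(1) by simp
      also have "\<dots> = s * exp (2 + ln (d / s) + c\<^sup>2 * C4 * L + \<beta>)" by (simp add: exp_add)
      also have "\<dots> \<le> s * exp ((2 + c\<^sup>2 * C4) * L)"
        using assms(1,4) lnds unfolding L by (intro mult_left_mono) (auto simp: algebra_simps)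
      finally show ?thesis .
    qed
    finally have "(\<Sum>j<d. Y j * \<bar>v j\<bar>) \<le> (2 + c\<^sup>2 * C4) * L * norm1 d v + sqrt (2 * real s) * norm2 d v"
      by (rule sum_mult_le_of_exp_sum) auto
    moreover have "(\<Sum>j<d. Y j * \<bar>v j\<bar>) = \<theta> * (\<Sum>j<d. \<bar>\<Sum>i<N. h j (\<omega> i)\<bar> * \<bar>v j\<bar>)"
      by (simp add: Y_def sum_distrib_left mult_ac)
    ultimately have "(\<Sum>j<d. \<bar>\<Sum>i<N. h j (\<omega> i)\<bar> * \<bar>v j\<bar>) \<le> 1 / \<theta> * ((2 + c\<^sup>2 * C4) * L * norm1 d v + sqrt (2 * real s) * norm2 d v)"
      using \<theta> by (simp add: field_simps)
    then show ?thesis by (simp add: \<theta>_def)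
  qed
  then show ?thesis using A(1,2) unfolding h_def K_def by blast
qed

text \<open>Cauchy-Schwarz over the observations bounds the contribution of large multipliers by the
  root of the sum of all \<open>(m (\<omega> i))\<^sup>2\<close> times the root of the sum of
  \<open>(G j (\<omega> i))\<^sup>2\<close> over the large ones. The hypothesis \<open>m2\<close>
  controls the first factor and \<open>mgf_large\<close> the second; each event costs a third of
  \<open>exp (- \<beta>)\<close>.\<close>

lemma noise_large_event:
  fixes N :: nat and L \<beta> :: real
  assumes "0 < s" "s \<le> d" "N > 0" "\<beta> > 2" and L: "L = 1 + ln (d / s) + \<beta>"
    and m2: "(\<integral>\<^sup>+x. ennreal (exp (c * (m x)\<^sup>2 / N)) \<partial>M) \<le> ennreal (exp (C / N))"
  shows "\<exists>A\<in>sets (PiM {..<N} (\<lambda>_. M)).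
    measure (PiM {..<N} (\<lambda>_. M)) A \<ge> 1 - 2 / 3 * exp (- \<beta>) \<and>
    (\<forall>\<omega>\<in>A. \<forall>v. (\<Sum>j<d. \<bar>\<Sum>i<N. m (\<omega> i) * G j (\<omega> i) - small (sqrt (N / L)) j (\<omega> i)\<bar> * \<bar>v j\<bar>)
       \<le> sqrt N * sqrt ((C + 2) * \<beta>) / c * (sqrt ((2 + C) * L) * norm1 d v + sqrt s * norm2 d v))"
proof -
  define S where "S = PiM {..<N} (\<lambda>_. M)"
  interpret S: prob_space S unfolding S_def by (intro prob_space_PiM prob_space_axioms)
  have lnds: "ln (d / s) \<ge> 0" using ln_dim_ratio assms(1,2) by auto
  then have Lpos: "L \<ge> 1" using assms(4) L by linarith
  define K where "K = sqrt (N / L)"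
  have K: "K > 0" "K\<^sup>2 = N / L" using Lpos assms(3) by (auto simp: K_def)
  define h where "h j x = (if \<bar>m x\<bar> \<le> K then 0 else c * (G j x)\<^sup>2)" for j x
  have dpos: "d > 0" using assms by simp
  have "\<exists>A\<in>sets S. S.prob A \<ge> 1 - exp (- \<beta>) / 3 \<and>
    (\<forall>\<omega>\<in>A. (\<Sum>j<d. exp (\<Sum>i<N. h j (\<omega> i))) \<le> card {..<d} * exp (C / K\<^sup>2) ^ N / (exp (- \<beta>) / 3))"
    unfolding S_def
  proof (rule exp_sum_event)
    fix j assume "j \<in> {..<d}"
    then show "h j \<in> borel_measurable M" "(\<integral>\<^sup>+x. ennreal (exp (h j x)) \<partial>M) \<le> ennreal (exp (C / K\<^sup>2))"
      unfolding h_def using G_meas[measurable] by (auto intro!: mgf_large[OF _ K(1)])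
  qed (use dpos in auto)
  moreover have "card {..<d} * exp (C / K\<^sup>2) ^ N / (exp (- \<beta>) / 3) = 3 * (d * exp (C * L) * exp \<beta>)"
    using K Lpos assms(3) by (simp add: exp_minus field_simps flip: exp_of_nat_mult)
  ultimately obtain A1 where A1: "A1 \<in> sets S" "S.prob A1 \<ge> 1 - exp (- \<beta>) / 3"
    "\<And>\<omega>. \<omega> \<in> A1 \<Longrightarrow> (\<Sum>j<d. exp (\<Sum>i<N. h j (\<omega> i))) \<le> 3 * (d * exp (C * L) * exp \<beta>)" by auto
  define r where "r \<omega> = (\<Sum>i<N. c * (m (\<omega> i))\<^sup>2 / N)" for \<omega> :: "nat \<Rightarrow> 'a"
  \<comment> \<open>The one-element index set turns \<open>exp_sum_event\<close> into a plain
    exponential Markov bound for the sum of squared multipliers.\<close>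
  have "\<exists>A\<in>sets S. S.prob A \<ge> 1 - exp (- \<beta>) / 3 \<and>
    (\<forall>\<omega>\<in>A. (\<Sum>k\<in>{()}. exp (\<Sum>i<N. c * (m (\<omega> i))\<^sup>2 / N)) \<le> card {()} * exp (C / N) ^ N / (exp (- \<beta>) / 3))"
    unfolding S_def by (rule exp_sum_event) (use m2 in auto)
  then obtain A2 where A2: "A2 \<in> sets S" "S.prob A2 \<ge> 1 - exp (- \<beta>) / 3"
    "\<And>\<omega>. \<omega> \<in> A2 \<Longrightarrow> exp (r \<omega>) \<le> exp (C / N) ^ N / (exp (- \<beta>) / 3)" by (auto simp: r_def)
  have r_le: "r \<omega> \<le> C + 2 + \<beta>" if "\<omega> \<in> A2" for \<omega>
  proof -
    have "exp (r \<omega>) \<le> exp C * (3 * exp \<beta>)"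
      using A2(3)[OF that] assms(3) by (simp add: exp_minus field_simps flip: exp_of_nat_mult)
    also have "\<dots> \<le> exp C * (exp 2 * exp \<beta>)"
      using exp_ge_add_one_self[of 2] by (intro mult_left_mono mult_right_mono) auto
    also have "\<dots> = exp (C + 2 + \<beta>)" by (simp add: exp_add)
    finally show ?thesis by simp
  qed
  define A where "A = A1 \<inter> A2"
  have A_sets: "A \<in> sets S" using A1(1) A2(1) by (simp add: A_def)
  have "S.prob (A1 \<union> A2) = S.prob A1 + S.prob A2 - S.prob (A1 \<inter> A2)"
    using A1(1) A2(1) by (intro measure_Un3) (auto simp: fmeasurable_def S.emeasure_eq_measure)
  then have PA: "S.prob A \<ge> 1 - 2 / 3 * exp (- \<beta>)"
    using A1(2) A2(2) S.prob_le_1[of "A1 \<union> A2"] unfolding A_def by linarith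
  have "(\<Sum>j<d. \<bar>\<Sum>i<N. m (\<omega> i) * G j (\<omega> i) - small K j (\<omega> i)\<bar> * \<bar>v j\<bar>)
       \<le> sqrt N * sqrt ((C + 2) * \<beta>) / c * (sqrt ((2 + C) * L) * norm1 d v + sqrt s * norm2 d v)" if "\<omega> \<in> A" for \<omega> v
  proof -
    define Y where "Y j = (\<Sum>i<N. h j (\<omega> i))" for j
    have Y0: "Y j \<ge> 0" for j using c_pos by (auto simp: Y_def h_def intro!: sum_nonneg)
    have "(\<Sum>j<d. exp (Y j)) \<le> 3 * (d * exp (C * L) * exp \<beta>)"
      using A1(3) that by (simp add: Y_def A_def)
    also have "\<dots> \<le> real s * exp ((2 + C) * L)"
    proof -
      have "(3::real) \<le> exp 2" using exp_ge_add_one_self[of 2] by simp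
      then have "3 * (d * exp (C * L) * exp \<beta>) \<le> exp 2 * (d * exp (C * L) * exp \<beta>)"
        by (rule mult_right_mono) simp
      also have "\<dots> = exp 2 * (s * exp (ln (d / s)) * exp (C * L) * exp \<beta>)" using dpos assms(1) by simp
      also have "\<dots> = s * exp (2 + ln (d / s) + C * L + \<beta>)" by (simp add: exp_add)
      also have "\<dots> \<le> s * exp ((2 + C) * L)"
        using assms(1,4) lnds unfolding L by (intro mult_left_mono) (auto simp: algebra_simps)
      finally show ?thesis .
    qed
    finally have "(\<Sum>j<d. sqrt (Y j) * \<bar>v j\<bar>) \<le> sqrt ((2 + C) * L) * norm1 d v + sqrt s / sqrt ((2 + C) * L) * norm2 d v"
      using Lpos C_pos by (intro sum_sqrt_mult_le_of_exp_sum Y0) auto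
    also have "\<dots> \<le> sqrt ((2 + C) * L) * norm1 d v + sqrt s / 1 * norm2 d v"
    proof -
      have "1 * 1 \<le> (2 + C) * L" using Lpos C_pos by (intro mult_mono) auto
      then show ?thesis by (intro add_left_mono mult_right_mono divide_left_mono) (auto simp: norm2_def L2_set_nonneg)
    qed
    finally have B: "(\<Sum>j<d. sqrt (Y j) * \<bar>v j\<bar>) \<le> sqrt ((2 + C) * L) * norm1 d v + sqrt s * norm2 d v" by simp
    have "(\<Sum>i<N. (m (\<omega> i))\<^sup>2) = N / c * r \<omega>"
      using assms(3) c_pos by (simp add: r_def field_simps flip: sum_divide_distrib sum_distrib_left)
    also have "\<dots> \<le> N / c * ((C + 2) * \<beta>)"
    proof -
      have "r \<omega> \<le> C + 2 + \<beta>" using that r_le by (simp add: A_def)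
      also have "\<dots> \<le> (C + 2) * \<beta>"
      proof -
        have "C * 1 \<le> C * \<beta>" using C_pos assms(4) by (intro mult_left_mono) auto
        then show ?thesis using assms(4) by (simp add: algebra_simps)
      qed
      finally show ?thesis using c_pos by (intro mult_left_mono) auto
    qed
    finally have m2': "(\<Sum>i<N. (m (\<omega> i))\<^sup>2) \<le> N / c * ((C + 2) * \<beta>)" .
    have one: "\<bar>\<Sum>i<N. m (\<omega> i) * G j (\<omega> i) - small K j (\<omega> i)\<bar> \<le> sqrt N * sqrt ((C + 2) * \<beta>) / c * sqrt (Y j)" for j
    proof -
      have "\<bar>\<Sum>i<N. m (\<omega> i) * G j (\<omega> i) - small K j (\<omega> i)\<bar>
         \<le> (\<Sum>i<N. \<bar>m (\<omega> i) * G j (\<omega> i) - small K j (\<omega> i)\<bar>)" by (rule sum_abs)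
      also have "\<dots> \<le> (\<Sum>i<N. \<bar>m (\<omega> i)\<bar> * \<bar>sqrt (h j (\<omega> i) / c)\<bar>)"
        using c_pos by (intro sum_mono) (auto simp: small_def h_def abs_mult)
      also have "\<dots> \<le> L2_set (\<lambda>i. m (\<omega> i)) {..<N} * L2_set (\<lambda>i. sqrt (h j (\<omega> i) / c)) {..<N}"
        by (rule L2_set_mult_ineq)
      also have "L2_set (\<lambda>i. sqrt (h j (\<omega> i) / c)) {..<N} = sqrt (Y j / c)"
        using c_pos by (auto simp: L2_set_def Y_def h_def sum_divide_distrib intro!: sum.cong)
      also have "L2_set (\<lambda>i. m (\<omega> i)) {..<N} * sqrt (Y j / c) \<le> sqrt (N / c * ((C + 2) * \<beta>)) * sqrt (Y j / c)"
        unfolding L2_set_def using m2' Y0[of j] c_pos by (intro mult_right_mono) auto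
      also have "\<dots> = sqrt N * sqrt ((C + 2) * \<beta>) / c * sqrt (Y j)"
        using c_pos by (simp add: real_sqrt_mult real_sqrt_divide)
      finally show ?thesis .
    qed
    have "(\<Sum>j<d. \<bar>\<Sum>i<N. m (\<omega> i) * G j (\<omega> i) - small K j (\<omega> i)\<bar> * \<bar>v j\<bar>)
       \<le> (\<Sum>j<d. sqrt N * sqrt ((C + 2) * \<beta>) / c * sqrt (Y j) * \<bar>v j\<bar>)"
      by (intro sum_mono mult_right_mono one) auto
    also have "\<dots> = sqrt N * sqrt ((C + 2) * \<beta>) / c * (\<Sum>j<d. sqrt (Y j) * \<bar>v j\<bar>)"
      by (simp add: sum_distrib_left mult.assoc)
    also have "\<dots> \<le> sqrt N * sqrt ((C + 2) * \<beta>) / c * (sqrt ((2 + C) * L) * norm1 d v + sqrt s * norm2 d v)"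
      using B c_pos C_pos assms(4) by (intro mult_left_mono) auto
    finally show ?thesis .
  qed
  then show ?thesis using A_sets PA unfolding S_def K_def by blast
qed

end

text \<open>The coefficients collected at the end of \<open>noise_bound\<close>: the first two
  summands come from the small multipliers, the third from the large ones, \<open>C\<close> from the
  assumed bias and the last from the mean that is lost by cutting at \<open>K\<close>.\<close>

definition noise_const :: "real \<Rightarrow> real \<Rightarrow> real" where
  "noise_const c C = 2 * (2 + c\<^sup>2 * (2 / c * exp (c / 2) * C)) / c + 2 / c
     + 3 * (2 + C) / c + C + 2 * (1 + 1 / c) * C"

lemma noise_const_pos: "c > 0 \<Longrightarrow> C > 0 \<Longrightarrow> noise_const c C > 0"
  unfolding noise_const_def by (intro add_pos_pos) (auto intro!: add_pos_pos divide_pos_pos mult_pos_pos)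

text \<open>Every coordinate sum splits into a centred part with small multipliers, a part with
  large multipliers and \<open>N\<close> times a mean. All three are of order \<open>sqrt L\<close>
  or \<open>sqrt \<beta> * sqrt L\<close> after normalisation, hence of order
  \<open>\<beta> * sqrt l\<close>. The Euclidean term carries the weight \<open>sqrt s\<close> from
  the exponential sums.\<close>

lemma (in multiplier) noise_bound:
  fixes N :: nat and \<beta> :: real
  assumes "0 < s" "s \<le> d" "N > 0" "\<beta> > 2"
    and m2: "(\<integral>\<^sup>+x. ennreal (exp (c * (m x)\<^sup>2 / N)) \<partial>M) \<le> ennreal (exp (C / N))"
    and bias: "\<And>j. j < d \<Longrightarrow> \<bar>LINT x|M. m x * G j x\<bar> \<le> C / sqrt N"
  shows "\<exists>A\<in>sets (PiM {..<N} (\<lambda>_. M)).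
    measure (PiM {..<N} (\<lambda>_. M)) A \<ge> 1 - exp (- \<beta>) \<and>
    (\<forall>\<omega>\<in>A. \<forall>v. \<bar>1 / N * (\<Sum>i<N. m (\<omega> i) * (\<Sum>j<d. G j (\<omega> i) * v j))\<bar>
       \<le> noise_const c C * (\<beta> * sqrt (ln (exp 1 * d / s) / N)) * (norm1 d v + sqrt s * norm2 d v))"
proof -
  define l where "l = ln (exp 1 * d / s)"
  define L where "L = l + \<beta>"
  have l: "l = 1 + ln (d / s)" "l \<ge> 1" using ln_dim_ratio[OF assms(1,2)] by (auto simp: l_def)
  have L: "L = 1 + ln (d / s) + \<beta>" using l by (simp add: L_def)
  have Lpos: "L \<ge> 1" using l assms by (simp add: L_def)
  \<comment> \<open>Both \<open>\<beta>\<close> and \<open>l\<close> are at least 1, so their sum is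
    at most twice their product. This is where the rate acquires \<beta> as a factor.\<close>
  have L2: "L \<le> 2 * \<beta> * l"
  proof -
    have "1 * l \<le> \<beta> * l" "\<beta> * 1 \<le> \<beta> * l" using l(2) assms(4) mult_right_mono[of 1 \<beta> l] mult_left_mono[of 1 l \<beta>] by linarith+
    then show ?thesis by (simp add: L_def)
  qed
  define S where "S = PiM {..<N} (\<lambda>_. M)"
  interpret S: prob_space S unfolding S_def by (intro prob_space_PiM prob_space_axioms)
  define C4 where "C4 = 2 / c * exp (c / 2) * C"
  have C4: "C4 > 0" using c_pos C_pos by (simp add: C4_def)
  define K where "K = sqrt (N / L)"
  have K: "K > 0" using Lpos assms(3) by (auto simp: K_def)
  define \<mu> where "\<mu> j = (LINT x|M. small K j x)" for j
  obtain A1 where A1: "A1 \<in> sets S" "S.prob A1 \<ge> 1 - exp (- \<beta>) / 3"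
    "\<And>\<omega> v. \<omega> \<in> A1 \<Longrightarrow> (\<Sum>j<d. \<bar>\<Sum>i<N. small K j (\<omega> i) - \<mu> j\<bar> * \<bar>v j\<bar>)
       \<le> K / c * ((2 + c\<^sup>2 * C4) * L * norm1 d v + sqrt (2 * real s) * norm2 d v)"
    using noise_small_event[OF assms(1-4) L] unfolding S_def K_def \<mu>_def C4_def by blast
  obtain A2 where A2: "A2 \<in> sets S" "S.prob A2 \<ge> 1 - 2 / 3 * exp (- \<beta>)"
    "\<And>\<omega> v. \<omega> \<in> A2 \<Longrightarrow> (\<Sum>j<d. \<bar>\<Sum>i<N. m (\<omega> i) * G j (\<omega> i) - small K j (\<omega> i)\<bar> * \<bar>v j\<bar>)
       \<le> sqrt N * sqrt ((C + 2) * \<beta>) / c * (sqrt ((2 + C) * L) * norm1 d v + sqrt s * norm2 d v)"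
    using noise_large_event[OF assms(1-4) L m2] unfolding S_def K_def by blast
  have "S.prob (A1 \<inter> A2) \<ge> 1 - exp (- \<beta>)"
  proof -
    have "S.prob (A1 \<union> A2) = S.prob A1 + S.prob A2 - S.prob (A1 \<inter> A2)"
      using A1(1) A2(1) by (intro measure_Un3) (auto simp: fmeasurable_def S.emeasure_eq_measure)
    then show ?thesis using A1(2) A2(2) S.prob_le_1[of "A1 \<union> A2"] by linarith
  qed
  moreover have "A1 \<inter> A2 \<in> sets S" using A1 A2 by auto
  moreover have "\<bar>1 / N * (\<Sum>i<N. m (\<omega> i) * (\<Sum>j<d. G j (\<omega> i) * v j))\<bar>
       \<le> noise_const c C * (\<beta> * sqrt (l / N)) * (norm1 d v + sqrt s * norm2 d v)"
    if \<omega>: "\<omega> \<in> A1 \<inter> A2" for \<omega> v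
  proof -
    define n1 where "n1 = norm1 d v"
    define n2 where "n2 = sqrt s * norm2 d v"
    have n: "n1 \<ge> 0" "n2 \<ge> 0" by (auto simp: n1_def n2_def norm1_def norm2_def sum_nonneg L2_set_nonneg)
    define B where "B = \<beta> * sqrt l"
    have B1: "1 \<le> B"
    proof -
      have "1 * 1 \<le> \<beta> * sqrt l" using l assms(4) by (intro mult_mono) auto
      then show ?thesis by (simp add: B_def)
    qed
    have B2: "4 * \<beta>\<^sup>2 * l = (2 * B)\<^sup>2" using l by (simp add: B_def power_mult_distrib)
    have \<beta>l: "\<beta> * l \<le> \<beta>\<^sup>2 * l"
      using l assms(4) by (intro mult_right_mono) (auto simp: power2_eq_square)
    have B20: "0 \<le> \<beta>\<^sup>2 * l" using l by simp
    have sL: "sqrt L \<le> 2 * B"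
    proof (rule real_le_lsqrt)
      show "L \<le> (2 * B)\<^sup>2" using L2 \<beta>l B20 B2 by linarith
    qed (use B1 in auto)
    have sbL: "sqrt \<beta> * sqrt L \<le> 2 * B"
      unfolding real_sqrt_mult[symmetric]
    proof (rule real_le_lsqrt)
      have "\<beta> * L \<le> \<beta> * (2 * \<beta> * l)" using L2 assms(4) by (intro mult_left_mono) auto
      also have "\<dots> = 2 * (\<beta>\<^sup>2 * l)" by (simp add: power2_eq_square)
      finally show "\<beta> * L \<le> (2 * B)\<^sup>2" using B20 B2 by linarith
    qed (use B1 in auto)
    have sb: "sqrt \<beta> \<le> B"
    proof -
      have "sqrt \<beta> * 1 \<le> \<beta> * sqrt l"
        using l assms(4) by (intro mult_mono real_le_lsqrt) (auto simp: power2_eq_square)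
      then show ?thesis by (simp add: B_def)
    qed
    \<comment> \<open>Once a factor \<open>R\<close> is pulled out, only \<beta> and
      \<open>L\<close> remain, because \<open>K * R = 1 / sqrt L\<close> and
      \<open>1 / K = sqrt L * R\<close>.\<close>
    define R where "R = 1 / sqrt N"
    have R: "R > 0" "1 / N = R * R" "sqrt N * R = 1" "N * (R * R) = 1" using assms(3) by (auto simp: R_def)
    have KR: "K * R = 1 / sqrt L" "1 / K = sqrt L * R" using Lpos assms(3) by (auto simp: K_def R_def real_sqrt_divide)
    have \<mu>: "\<bar>\<mu> j\<bar> \<le> R * (C + (1 + 1 / c) * C * sqrt L)" if "j < d" for j
    proof -
      have "\<bar>\<mu> j\<bar> \<le> C / sqrt N + (1 + 1 / c) * C / K"
        using abs_expectation_large_le[OF that K] bias[OF that] unfolding \<mu>_def by linarith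
      also have "\<dots> = R * (C + (1 + 1 / c) * C * sqrt L)"
        using KR(2) by (simp add: R_def divide_inverse algebra_simps)
      finally show ?thesis .
    qed
    define W0 where "W0 = N * (R * (C + (1 + 1 / c) * C * sqrt L))"
    have "(\<Sum>i<N. m (\<omega> i) * (\<Sum>j<d. G j (\<omega> i) * v j)) = (\<Sum>j<d. (\<Sum>i<N. m (\<omega> i) * G j (\<omega> i)) * v j)"
      by (simp add: sum_distrib_left sum_distrib_right mult.assoc) (rule sum.swap)
    also have "\<bar>\<dots>\<bar> \<le> (\<Sum>j<d. \<bar>\<Sum>i<N. m (\<omega> i) * G j (\<omega> i)\<bar> * \<bar>v j\<bar>)"
      by (rule order_trans[OF sum_abs]) (simp add: abs_mult)
    also have "\<dots> \<le> (\<Sum>j<d. (\<bar>\<Sum>i<N. small K j (\<omega> i) - \<mu> j\<bar> + \<bar>\<Sum>i<N. m (\<omega> i) * G j (\<omega> i) - small K j (\<omega> i)\<bar>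
        + W0) * \<bar>v j\<bar>)"
    proof (intro sum_mono mult_right_mono)
      fix j assume "j \<in> {..<d}"
      then have "N * \<bar>\<mu> j\<bar> \<le> W0" unfolding W0_def using \<mu> by (intro mult_left_mono) auto
      moreover have "(\<Sum>i<N. m (\<omega> i) * G j (\<omega> i))
        = (\<Sum>i<N. small K j (\<omega> i) - \<mu> j) + (\<Sum>i<N. m (\<omega> i) * G j (\<omega> i) - small K j (\<omega> i)) + N * \<mu> j"
        by (simp add: sum_subtractf)
      moreover have "\<bar>N * \<mu> j\<bar> = N * \<bar>\<mu> j\<bar>" by (simp add: abs_mult)
      ultimately show "\<bar>\<Sum>i<N. m (\<omega> i) * G j (\<omega> i)\<bar> \<le> \<bar>\<Sum>i<N. small K j (\<omega> i) - \<mu> j\<bar>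
         + \<bar>\<Sum>i<N. m (\<omega> i) * G j (\<omega> i) - small K j (\<omega> i)\<bar> + W0"
        by linarith
    qed auto
    also have "\<dots> = (\<Sum>j<d. \<bar>\<Sum>i<N. small K j (\<omega> i) - \<mu> j\<bar> * \<bar>v j\<bar>)
       + (\<Sum>j<d. \<bar>\<Sum>i<N. m (\<omega> i) * G j (\<omega> i) - small K j (\<omega> i)\<bar> * \<bar>v j\<bar>)
       + W0 * n1"
      by (simp add: n1_def norm1_def distrib_right sum.distrib sum_distrib_left)
    also have "\<dots> \<le> K / c * ((2 + c\<^sup>2 * C4) * L * n1 + sqrt 2 * n2)
       + sqrt N * sqrt ((C + 2) * \<beta>) / c * (sqrt ((2 + C) * L) * n1 + n2)
       + W0 * n1"
      using A1(3)[of \<omega> v] A2(3)[of \<omega> v] \<omega> by (simp add: n1_def n2_def real_sqrt_mult mult.assoc)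
    finally have "\<bar>1 / N * (\<Sum>i<N. m (\<omega> i) * (\<Sum>j<d. G j (\<omega> i) * v j))\<bar>
       \<le> (R * R) * (K / c * ((2 + c\<^sup>2 * C4) * L * n1 + sqrt 2 * n2)
       + sqrt N * sqrt ((C + 2) * \<beta>) / c * (sqrt ((2 + C) * L) * n1 + n2)
       + W0 * n1)"
      unfolding R(2)[symmetric] by (simp add: abs_mult divide_right_mono)
    also have "\<dots> = R * ((K * R) / c * ((2 + c\<^sup>2 * C4) * L * n1 + sqrt 2 * n2)
       + (sqrt N * R) * sqrt ((C + 2) * \<beta>) / c * (sqrt ((2 + C) * L) * n1 + n2)
       + (N * (R * R)) * (C + (1 + 1 / c) * C * sqrt L) * n1)"
      by (simp add: W0_def algebra_simps)
    also have "\<dots> = R * (((2 + c\<^sup>2 * C4) / c * sqrt L * n1 + sqrt 2 / c / sqrt L * n2)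
       + ((C + 2) / c * (sqrt \<beta> * sqrt L) * n1 + sqrt (C + 2) / c * sqrt \<beta> * n2)
       + (C + (1 + 1 / c) * C * sqrt L) * n1)"
    proof -
      have 1: "1 / sqrt L * L = sqrt L" using Lpos by (simp add: real_div_sqrt)
      have 2: "sqrt (C + 2) * sqrt (C + 2) = C + 2" using C_pos by simp
      have "1 / sqrt L / c * ((2 + c\<^sup>2 * C4) * L * n1 + sqrt 2 * n2)
          = (2 + c\<^sup>2 * C4) / c * (1 / sqrt L * L) * n1 + sqrt 2 / c / sqrt L * n2"
        by (simp add: distrib_left distrib_right mult_ac add_divide_distrib)
      moreover have "sqrt ((C + 2) * \<beta>) / c * (sqrt ((2 + C) * L) * n1 + n2)
          = sqrt (C + 2) * sqrt (C + 2) / c * (sqrt \<beta> * sqrt L) * n1 + sqrt (C + 2) / c * sqrt \<beta> * n2"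
        unfolding real_sqrt_mult add.commute[of 2 C] by (simp add: distrib_left mult_ac del: real_sqrt_mult_self)
      ultimately show ?thesis unfolding KR R 1 2 by simp
    qed
    also have "\<dots> \<le> R * (((2 + c\<^sup>2 * C4) / c * (2 * B) * n1 + 2 / c * B * n2)
       + ((C + 2) / c * (2 * B) * n1 + (C + 2) / c * B * n2)
       + (C * B + (1 + 1 / c) * C * (2 * B)) * n1)"
    proof -
      have i1: "(2 + c\<^sup>2 * C4) / c * sqrt L * n1 \<le> (2 + c\<^sup>2 * C4) / c * (2 * B) * n1"
        using sL n C4 c_pos by (intro mult_right_mono mult_left_mono) auto
      have i2: "sqrt 2 / c / sqrt L * n2 \<le> 2 / c * B * n2"
      proof (rule mult_right_mono)
        have "sqrt 2 / c / sqrt L \<le> sqrt 2 / c / 1" using Lpos c_pos by (intro divide_left_mono) auto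
        also have "\<dots> \<le> 2 / c" using c_pos real_le_lsqrt[of 2 2] by (simp add: divide_right_mono)
        also have "\<dots> \<le> 2 / c * B" using B1 c_pos mult_left_mono[of 1 B "2 / c"] by simp
        finally show "sqrt 2 / c / sqrt L \<le> 2 / c * B" .
      qed fact
      have i3: "(C + 2) / c * (sqrt \<beta> * sqrt L) * n1 \<le> (C + 2) / c * (2 * B) * n1"
        using sbL n C_pos c_pos by (intro mult_right_mono mult_left_mono) auto
      have i4: "sqrt (C + 2) / c * sqrt \<beta> * n2 \<le> (C + 2) / c * B * n2"
      proof (intro mult_right_mono mult_mono divide_right_mono)
        have "(C + 2) * 1 \<le> (C + 2) * (C + 2)" using C_pos by (intro mult_left_mono) auto
        then show "sqrt (C + 2) \<le> C + 2" using C_pos by (intro real_le_lsqrt) (auto simp: power2_eq_square)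
      qed (use sb n C_pos c_pos B1 assms(4) in auto)
      have i5: "(C + (1 + 1 / c) * C * sqrt L) * n1 \<le> (C * B + (1 + 1 / c) * C * (2 * B)) * n1"
        using sL B1 n C_pos c_pos by (intro mult_right_mono add_mono mult_left_mono) auto
      show ?thesis using i1 i2 i3 i4 i5 R(1) by (intro mult_left_mono) auto
    qed
    also have "\<dots> \<le> R * (B * noise_const c C * (n1 + n2))"
    proof (intro mult_left_mono)
      define a1 where "a1 = (2 + c\<^sup>2 * C4) / c"
      define a2 where "a2 = 1 / c"
      define a3 where "a3 = (C + 2) / c"
      define a4 where "a4 = (1 + 1 / c) * C"
      have a: "a1 \<ge> 0" "a2 \<ge> 0" "a3 \<ge> 0" "a4 \<ge> 0"
        using C_pos c_pos C4 by (auto simp: a1_def a2_def a3_def a4_def)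
      have nc: "noise_const c C = 2 * a1 + 2 * a2 + 3 * a3 + C + 2 * a4"
        unfolding noise_const_def C4_def[symmetric] a1_def a2_def a3_def a4_def
        by (simp add: add.commute[of 2 C])
      have "(2 * a1 + 2 * a3 + C + 2 * a4) * n1 \<le> noise_const c C * n1"
        "(2 * a2 + a3) * n2 \<le> noise_const c C * n2"
        using a n C_pos by (auto intro!: mult_right_mono simp: nc)
      then have "B * ((2 * a1 + 2 * a3 + C + 2 * a4) * n1 + (2 * a2 + a3) * n2) \<le> B * (noise_const c C * (n1 + n2))"
        using B1 by (intro mult_left_mono) (auto simp: distrib_left)
      moreover have "2 / c = 2 * a2" by (simp add: a2_def)
      ultimately show "(2 + c\<^sup>2 * C4) / c * (2 * B) * n1 + 2 / c * B * n2 +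
          ((C + 2) / c * (2 * B) * n1 + (C + 2) / c * B * n2) + (C * B + (1 + 1 / c) * C * (2 * B)) * n1
          \<le> B * noise_const c C * (n1 + n2)"
        unfolding a1_def[symmetric] a3_def[symmetric] a4_def[symmetric] by (simp add: algebra_simps)
    qed (use R in auto)
    also have "\<dots> = noise_const c C * (\<beta> * sqrt (l / N)) * (n1 + n2)"
      by (simp add: R_def B_def real_sqrt_divide)
    finally show ?thesis by (simp add: n1_def n2_def)
  qed
  ultimately show ?thesis unfolding S_def l_def by blast
qed

section \<open>Deterministic estimates for quadratic forms and the Lasso\<close>

definition bilin :: "nat \<Rightarrow> (nat \<Rightarrow> nat \<Rightarrow> real) \<Rightarrow> (nat \<Rightarrow> real) \<Rightarrow> (nat \<Rightarrow> real) \<Rightarrow> real" where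
  "bilin d A u v = (\<Sum>j<d. u j * (\<Sum>k<d. A j k * v k))"

lemma bilin_add:
  "bilin d A (\<lambda>i. u i + w i) v = bilin d A u v + bilin d A w v"
  "bilin d A v (\<lambda>i. u i + w i) = bilin d A v u + bilin d A v w"
  by (simp_all add: bilin_def algebra_simps sum.distrib)

lemma bilin_scale:
  "bilin d A (\<lambda>i. r * u i) v = r * bilin d A u v"
  "bilin d A v (\<lambda>i. r * u i) = r * bilin d A v u"
  by (simp_all add: bilin_def sum_distrib_left mult_ac)

definition coord_vec :: "nat \<Rightarrow> nat \<Rightarrow> real" where
  "coord_vec j k = (if k = j then 1 else 0)"

lemma sum_unit: "j < d \<Longrightarrow> (\<Sum>k<d. f k * coord_vec j k) = f j"
  by (subst sum.cong[OF refl, of _ _ "\<lambda>k. if k = j then f k else 0"]) (auto simp: coord_vec_def)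

lemma sum_unit': "j < d \<Longrightarrow> (\<Sum>k<d. coord_vec j k * f k) = f j"
  using sum_unit[of j d f] by (simp add: mult.commute)

lemma bilin_unit:
  assumes "j < d"
  shows "bilin d A (coord_vec j) v = (\<Sum>k<d. A j k * v k)"
    and "bilin d A v (coord_vec j) = (\<Sum>k<d. v k * A k j)"
  using assms by (simp_all add: bilin_def sum_unit sum_unit')

lemma bilin_add_unit:
  assumes "j < d"
  shows "bilin d A (\<lambda>i. w i + r * coord_vec j i) (\<lambda>i. w i + r * coord_vec j i)
    = bilin d A w w + r * ((\<Sum>k<d. A j k * w k) + (\<Sum>k<d. w k * A k j)) + r\<^sup>2 * A j j"
  using assms by (simp add: bilin_add bilin_scale bilin_unit sum_unit sum_unit' power2_eq_square algebra_simps)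

text \<open>The weights \<open>\<bar>y j\<bar>\<close> form a probability distribution, so the left
  side is the mean of the form at \<open>w\<close> plus a random signed coordinate vector with mean
  \<open>y\<close>. The last two terms on the right are its variance in this form. An index with
  \<open>y j = 0\<close> has weight zero, so the value of \<open>sgn\<close> there is
  immaterial.\<close>

lemma weighted_bilin_add_unit:
  assumes "norm1 d y = 1"
  shows "(\<Sum>j<d. \<bar>y j\<bar> * bilin d A (\<lambda>i. w i + sgn (y j) * coord_vec j i) (\<lambda>i. w i + sgn (y j) * coord_vec j i))
    = bilin d A (\<lambda>i. w i + y i) (\<lambda>i. w i + y i) + (\<Sum>j<d. \<bar>y j\<bar> * A j j) - bilin d A y y"
proof -
  have "\<bar>y j\<bar> * bilin d A (\<lambda>i. w i + sgn (y j) * coord_vec j i) (\<lambda>i. w i + sgn (y j) * coord_vec j i)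
     = \<bar>y j\<bar> * bilin d A w w + y j * (\<Sum>k<d. A j k * w k) + y j * (\<Sum>k<d. w k * A k j) + \<bar>y j\<bar> * A j j"
    if "j < d" for j
    unfolding bilin_add_unit[OF that] by (cases "y j = 0") (auto simp: algebra_simps sgn_if power2_eq_square abs_if)
  then have "(\<Sum>j<d. \<bar>y j\<bar> * bilin d A (\<lambda>i. w i + sgn (y j) * coord_vec j i) (\<lambda>i. w i + sgn (y j) * coord_vec j i))
    = norm1 d y * bilin d A w w + bilin d A y w + (\<Sum>j<d. y j * (\<Sum>k<d. w k * A k j)) + (\<Sum>j<d. \<bar>y j\<bar> * A j j)"
    by (simp add: sum.distrib bilin_def norm1_def sum_distrib_right)
  also have "(\<Sum>j<d. y j * (\<Sum>k<d. w k * A k j)) = bilin d A w y"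
    unfolding bilin_def sum_distrib_left by (subst sum.swap) (simp add: mult_ac)
  finally show ?thesis using assms by (simp add: bilin_add)
qed

text \<open>Derandomised empirical method of Maurey: the quantity below is the expectation of the form at
  \<open>u\<close> plus \<open>r\<close> independent signed coord_vec vectors with mean \<open>y\<close>.\<close>

lemma maurey_nonneg:
  assumes y: "norm1 d y = 1"
    and "\<And>j. j < d \<Longrightarrow> u j \<in> \<int>"
    and "\<And>u'. (\<And>j. j < d \<Longrightarrow> u' j \<in> \<int>) \<Longrightarrow> norm1 d u' \<le> norm1 d u + r \<Longrightarrow> 0 \<le> bilin d A u' u'"
  shows "0 \<le> bilin d A (\<lambda>i. u i + real r * y i) (\<lambda>i. u i + real r * y i)
    + real r * ((\<Sum>j<d. \<bar>y j\<bar> * A j j) - bilin d A y y)"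
  using assms(2,3)
proof (induction r arbitrary: u)
  case 0
  then show ?case by simp
next
  case (Suc r)
  \<comment> \<open>The variance of a single draw. It does not depend on \<open>u\<close>, so
    independent draws accumulate it linearly in \<open>r\<close>.\<close>
  define T where "T = (\<Sum>j<d. \<bar>y j\<bar> * A j j) - bilin d A y y"
  have step: "0 \<le> bilin d A (\<lambda>i. (u i + real r * y i) + sgn (y j) * coord_vec j i) (\<lambda>i. (u i + real r * y i) + sgn (y j) * coord_vec j i) + real r * T"
    if "j < d" for j
  proof -
    define u' where "u' i = u i + sgn (y j) * coord_vec j i" for i
    have "norm1 d u' \<le> (\<Sum>i<d. \<bar>u i\<bar> + coord_vec j i)"
      unfolding norm1_def u'_def
      by (intro sum_mono order_trans[OF abs_triangle_ineq] add_left_mono) (auto simp: coord_vec_def abs_mult sgn_if)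
    also have "\<dots> = norm1 d u + 1" using that sum_unit[OF that, of "\<lambda>_. 1"] by (simp add: sum.distrib norm1_def)
    finally have n: "norm1 d u' \<le> norm1 d u + 1" .
    have "0 \<le> bilin d A (\<lambda>i. u' i + real r * y i) (\<lambda>i. u' i + real r * y i) + real r * T"
      unfolding T_def
    proof (rule Suc.IH)
      show "u' i \<in> \<int>" if "i < d" for i
        unfolding u'_def coord_vec_def using Suc.prems(1)[OF that] by (auto simp: sgn_if)
      show "0 \<le> bilin d A u'' u''" if "\<And>i. i < d \<Longrightarrow> u'' i \<in> \<int>" "norm1 d u'' \<le> norm1 d u' + real r" for u''
        using Suc.prems(2)[of u''] that n by simp
    qed
    then show ?thesis by (simp add: u'_def add_ac)
  qed
  have "0 \<le> (\<Sum>j<d. \<bar>y j\<bar> * (bilin d A (\<lambda>i. (u i + real r * y i) + sgn (y j) * coord_vec j i) (\<lambda>i. (u i + real r * y i) + sgn (y j) * coord_vec j i) + real r * T))"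
    by (intro sum_nonneg mult_nonneg_nonneg step) auto
  also have "\<dots> = bilin d A (\<lambda>i. (u i + real r * y i) + y i) (\<lambda>i. (u i + real r * y i) + y i) + T + norm1 d y * (real r * T)"
    by (simp only: distrib_left sum.distrib weighted_bilin_add_unit[OF y]) (simp add: T_def norm1_def sum_distrib_right)
  finally show ?case unfolding T_def[symmetric] using y by (simp add: algebra_simps)
qed

text \<open>With \<open>y\<close> the normalised \<open>v\<close>, taking \<open>m\<close> draws
  from zero gives \<open>m\<^sup>2\<close> times the form at \<open>y\<close> plus \<open>m\<close>
  times the variance. The variance subtracts the form at \<open>y\<close> once per draw, whence
  \<open>m - 1\<close> in the denominator and the condition \<open>m \<ge> 2\<close>.\<close>

lemma maurey_lower_bound:
  assumes int: "\<And>u. (\<And>j. j < d \<Longrightarrow> u j \<in> \<int>) \<Longrightarrow> norm1 d u \<le> real m \<Longrightarrow> 0 \<le> bilin d A u u"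
    and diag: "\<And>j. j < d \<Longrightarrow> A j j \<le> A0" and "m \<ge> 2"
  shows "bilin d A v v \<ge> - (A0 / (real m - 1)) * (norm1 d v)\<^sup>2"
proof (cases "norm1 d v = 0")
  case True
  then have "\<And>j. j < d \<Longrightarrow> v j = 0" by (auto simp: norm1_def sum_nonneg_eq_0_iff)
  then show ?thesis using True by (simp add: bilin_def)
next
  case False
  define n where "n = norm1 d v"
  have n: "n > 0" using False by (auto simp: n_def norm1_def sum_nonneg less_le)
  define y where "y j = (1 / n) * v j" for j
  have y: "norm1 d y = 1"
    using n by (simp add: norm1_def y_def abs_mult flip: sum_divide_distrib) (simp add: n_def norm1_def)
  have "0 \<le> bilin d A (\<lambda>i. 0 + real m * y i) (\<lambda>i. 0 + real m * y i) + real m * ((\<Sum>j<d. \<bar>y j\<bar> * A j j) - bilin d A y y)"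
    by (rule maurey_nonneg[OF y, of "\<lambda>_. 0"]) (use int in \<open>auto simp: norm1_def\<close>)
  also have "\<dots> = m * ((m - 1) * bilin d A y y + (\<Sum>j<d. \<bar>y j\<bar> * A j j))"
    using \<open>m \<ge> 2\<close> by (simp add: bilin_scale algebra_simps of_nat_diff)
  finally have "0 \<le> (real m - 1) * bilin d A y y + (\<Sum>j<d. \<bar>y j\<bar> * A j j)"
    using \<open>m \<ge> 2\<close> by (simp add: zero_le_mult_iff of_nat_diff)
  also have "(\<Sum>j<d. \<bar>y j\<bar> * A j j) \<le> (\<Sum>j<d. \<bar>y j\<bar> * A0)"
    by (intro sum_mono mult_left_mono diag) auto
  also have "\<dots> = A0" using y by (simp add: norm1_def flip: sum_distrib_right)
  finally have "- (A0 / (real m - 1)) \<le> bilin d A y y"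
    using \<open>m \<ge> 2\<close> by (simp add: field_simps)
  also have "\<dots> = bilin d A v v / n\<^sup>2"
  proof -
    have "y = (\<lambda>j. 1 / n * v j)" by (simp add: y_def fun_eq_iff)
    then show ?thesis by (simp only: bilin_scale) (simp add: power2_eq_square)
  qed
  finally have "- (A0 / (real m - 1)) * n\<^sup>2 \<le> bilin d A v v" using n by (simp add: pos_le_divide_eq)
  then show ?thesis by (simp add: n_def)
qed

text \<open>Decomposability of the l1-norm around an approximately sparse point. On the support of
  \<open>\<theta>0\<close> the loss per coordinate is at most \<open>2 * \<bar>v j\<bar>\<close>,
  and Cauchy-Schwarz over \<open>s\<close> indices sums it. Off the support
  \<open>\<theta> j\<close> is itself the approximation error, and it is charged twice.\<close>

lemma norm1_diff_lower:
  assumes "norm0 d \<theta>0 = s" "norm1 d (\<lambda>i. \<theta> i - \<theta>0 i) \<le> \<rho>"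
  shows "norm1 d (\<lambda>i. \<theta> i + v i) - norm1 d \<theta> \<ge> norm1 d v - 2 * (sqrt s * norm2 d v) - 2 * \<rho>"
proof -
  define f where "f j = (if \<theta>0 j \<noteq> 0 then 1 else 0 :: real)" for j
  have pw: "\<bar>\<theta> j + v j\<bar> - \<bar>\<theta> j\<bar> \<ge> \<bar>v j\<bar> - 2 * (f j * \<bar>v j\<bar>) - 2 * \<bar>\<theta> j - \<theta>0 j\<bar>" for j
  proof -
    have "\<bar>v j\<bar> \<le> \<bar>\<theta> j + v j\<bar> + \<bar>\<theta> j\<bar>" "\<bar>\<theta> j\<bar> \<le> \<bar>\<theta> j + v j\<bar> + \<bar>v j\<bar>" "0 \<le> \<bar>\<theta> j - \<theta>0 j\<bar>"
      by linarith+
    then show ?thesis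
    proof (cases "\<theta>0 j = 0")
      case False
      then have "f j * \<bar>v j\<bar> = \<bar>v j\<bar>" by (simp add: f_def)
      then show ?thesis using \<open>\<bar>\<theta> j\<bar> \<le> \<bar>\<theta> j + v j\<bar> + \<bar>v j\<bar>\<close> \<open>0 \<le> \<bar>\<theta> j - \<theta>0 j\<bar>\<close> by linarith
    qed (simp add: f_def)
  qed
  have "(\<Sum>j<d. \<bar>\<theta> j + v j\<bar> - \<bar>\<theta> j\<bar>) \<ge> (\<Sum>j<d. \<bar>v j\<bar> - 2 * (f j * \<bar>v j\<bar>) - 2 * \<bar>\<theta> j - \<theta>0 j\<bar>)"
    by (intro sum_mono pw)
  then have "norm1 d (\<lambda>i. \<theta> i + v i) - norm1 d \<theta> \<ge> norm1 d v - 2 * (\<Sum>j<d. f j * \<bar>v j\<bar>) - 2 * norm1 d (\<lambda>i. \<theta> i - \<theta>0 i)"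
    by (simp add: sum_subtractf norm1_def flip: sum_distrib_left)
  moreover have "(\<Sum>j<d. f j * \<bar>v j\<bar>) \<le> sqrt s * norm2 d v"
  proof -
    have "(\<Sum>j<d. (f j)\<^sup>2) = (\<Sum>j\<in>{i. i < d \<and> \<theta>0 i \<noteq> 0}. 1)"
      by (rule sum.mono_neutral_cong_right) (auto simp: f_def)
    also have "\<dots> = s" using assms(1) by (simp add: norm0_def)
    finally show ?thesis using sum_mult_le_L2[of f v d] by simp
  qed
  ultimately show ?thesis using assms(2) by linarith
qed

text \<open>The cross term occurs with factor 2, so noise at level \<open>lam / 8\<close> costs a
  quarter of \<open>lam\<close> in each norm. Against the coefficients 1 and 2 of
  \<open>norm1_diff_lower\<close> this leaves \<open>3 / 4\<close> and \<open>9 / 4\<close>.\<close>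

lemma lasso_basic_inequality:
  fixes X :: "nat \<Rightarrow> nat \<Rightarrow> real"
  assumes opt: "1 / real N * (\<Sum>i<N. (dotp d (X i) \<theta>h - Y i)\<^sup>2) + lam * norm1 d \<theta>h
      \<le> 1 / real N * (\<Sum>i<N. (dotp d (X i) \<theta> - Y i)\<^sup>2) + lam * norm1 d \<theta>"
    and v: "v = (\<lambda>i. \<theta>h i - \<theta> i)" and lam: "lam > 0"
    and noise: "\<bar>1 / real N * (\<Sum>i<N. (Y i - dotp d (X i) \<theta>) * dotp d (X i) v)\<bar>
      \<le> lam / 8 * (norm1 d v + sqrt s * norm2 d v)"
    and \<theta>0: "norm0 d \<theta>0 = s" "norm1 d (\<lambda>i. \<theta> i - \<theta>0 i) \<le> \<rho>"
  shows "1 / real N * (\<Sum>i<N. (dotp d (X i) v)\<^sup>2) + lam * (3 / 4 * norm1 d v) \<le> lam * (9 / 4 * (sqrt s * norm2 d v) + 2 * \<rho>)"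
proof -
  have d: "dotp d (X i) \<theta>h = dotp d (X i) \<theta> + dotp d (X i) v" for i
    by (simp add: dotp_def v algebra_simps sum_subtractf)
  have "(\<Sum>i<N. (dotp d (X i) \<theta>h - Y i)\<^sup>2) = (\<Sum>i<N. (dotp d (X i) v)\<^sup>2)
     - 2 * (\<Sum>i<N. (Y i - dotp d (X i) \<theta>) * dotp d (X i) v) + (\<Sum>i<N. (dotp d (X i) \<theta> - Y i)\<^sup>2)"
    unfolding d sum_distrib_left sum_subtractf[symmetric] sum.distrib[symmetric]
    by (intro sum.cong) (auto simp: power2_eq_square algebra_simps)
  then have "1 / real N * (\<Sum>i<N. (dotp d (X i) \<theta>h - Y i)\<^sup>2) = 1 / real N * (\<Sum>i<N. (dotp d (X i) v)\<^sup>2)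
     - 2 * (1 / real N * (\<Sum>i<N. (Y i - dotp d (X i) \<theta>) * dotp d (X i) v)) + 1 / real N * (\<Sum>i<N. (dotp d (X i) \<theta> - Y i)\<^sup>2)"
    by (simp only: distrib_left right_diff_distrib mult.left_commute[of "1 / real N" 2])
  then have 1: "1 / real N * (\<Sum>i<N. (dotp d (X i) v)\<^sup>2) + lam * (norm1 d \<theta>h - norm1 d \<theta>)
     \<le> 2 * (lam / 8 * (norm1 d v + sqrt s * norm2 d v))"
    using opt noise unfolding right_diff_distrib by linarith
  have "norm1 d \<theta>h = norm1 d (\<lambda>i. \<theta> i + v i)" by (simp add: v)
  then have "lam * (norm1 d \<theta>h - norm1 d \<theta>) \<ge> lam * (norm1 d v - 2 * (sqrt s * norm2 d v) - 2 * \<rho>)"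
    using norm1_diff_lower[OF \<theta>0, of v] lam by (intro mult_left_mono) auto
  then show ?thesis using 1 by (simp add: algebra_simps)
qed

text \<open>The proof splits on whether the approximation error \<open>\<rho>\<close> is at most
  \<open>sqrt s * n2\<close>. If it is, \<open>n1 \<le> 6 * (sqrt s * n2)\<close>, so the l1-defect
  is at most \<open>36 * b * n2\<^sup>2\<close>. The condition \<open>72 * b \<le> a\<close> makes
  this half of the curvature, and the other half yields the rate. If it is not,
  \<open>\<rho>\<close> itself bounds the error.\<close>

lemma lasso_rates:
  fixes n1 n2 q lam a b s \<rho> k :: real
  assumes basic: "q + lam * (3 / 4 * n1) \<le> lam * (9 / 4 * (sqrt s * n2) + 2 * \<rho>)"
    and curv: "q \<ge> a * n2\<^sup>2 - b * n1\<^sup>2 / s" and "q \<ge> 0" "lam > 0" "s > 0" "a > 0" "b \<ge> 0" "72 * b \<le> a"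
    and "n1 \<ge> 0" "n2 \<ge> 0" "0 \<le> \<rho>" "\<rho> \<le> k * s * lam" "k \<ge> 0"
  shows "n2 \<le> (10 / a + k) * (lam * sqrt s)" "n1 \<le> (30 / a + 6 * k) * (lam * s)"
proof -
  have "lam * (3 / 4 * n1) \<le> lam * (9 / 4 * (sqrt s * n2) + 2 * \<rho>)" using basic \<open>q \<ge> 0\<close> by linarith
  then have "3 / 4 * n1 \<le> 9 / 4 * (sqrt s * n2) + 2 * \<rho>" using \<open>lam > 0\<close> by (rule mult_left_le_imp_le)
  then have n1: "n1 \<le> 3 * (sqrt s * n2) + 8 / 3 * \<rho>" by linarith
  show n2: "n2 \<le> (10 / a + k) * (lam * sqrt s)"
  proof (cases "\<rho> \<le> sqrt s * n2")
    case True
    then have "n1 \<le> 6 * (sqrt s * n2)" using n1 \<open>0 \<le> \<rho>\<close> by linarith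
    then have "n1\<^sup>2 \<le> (6 * (sqrt s * n2))\<^sup>2" using assms by (intro power_mono) auto
    then have "b * n1\<^sup>2 / s \<le> b * (6 * (sqrt s * n2))\<^sup>2 / s"
      using assms by (intro divide_right_mono mult_left_mono) auto
    also have "\<dots> = 36 * b * n2\<^sup>2" using \<open>s > 0\<close> by (simp add: power_mult_distrib)
    also have "\<dots> \<le> a / 2 * n2\<^sup>2" using assms by (intro mult_right_mono) auto
    finally have "a / 2 * n2\<^sup>2 \<le> q" using curv by linarith
    also have "q \<le> lam * (9 / 4 * (sqrt s * n2) + 2 * \<rho>)"
      using basic mult_nonneg_nonneg[of lam "3 / 4 * n1"] \<open>lam > 0\<close> \<open>n1 \<ge> 0\<close> by linarith
    also have "\<dots> \<le> lam * (5 * (sqrt s * n2))"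
      using True assms by (intro mult_left_mono) auto
    finally have *: "a / 2 * n2\<^sup>2 \<le> lam * (5 * (sqrt s * n2))" .
    have "n2 \<le> 10 / a * (lam * sqrt s)"
    proof (cases "n2 = 0")
      case False
      then have "n2 > 0" using assms by simp
      then have "a / 2 * n2 \<le> lam * (5 * sqrt s)" using * by (simp add: power2_eq_square)
      then show ?thesis using \<open>a > 0\<close> by (simp add: field_simps)
    qed (use assms in auto)
    also have "\<dots> \<le> (10 / a + k) * (lam * sqrt s)" using assms by (intro mult_right_mono) auto
    finally show ?thesis .
  next
    case False
    then have "sqrt s * n2 \<le> k * s * lam" using assms by linarith
    also have "\<dots> = sqrt s * (k * (lam * sqrt s))" using \<open>s > 0\<close> by simp
    finally have "n2 \<le> k * (lam * sqrt s)" using \<open>s > 0\<close> by simp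
    also have "\<dots> \<le> (10 / a + k) * (lam * sqrt s)" using assms by (intro mult_right_mono) auto
    finally show ?thesis .
  qed
  have "sqrt s * n2 \<le> sqrt s * ((10 / a + k) * (lam * sqrt s))" using n2 \<open>s > 0\<close> by (intro mult_left_mono) auto
  also have "\<dots> = (10 / a + k) * (lam * s)" using \<open>s > 0\<close> by simp
  finally have "sqrt s * n2 \<le> (10 / a + k) * (lam * s)" .
  moreover have "(30 / a + 6 * k) * (lam * s) = 3 * ((10 / a + k) * (lam * s)) + 3 * (k * s * lam)"
    by (simp add: algebra_simps)
  ultimately show "n1 \<le> (30 / a + 6 * k) * (lam * s)" using n1 assms by linarith
qed

section \<open>Counting integer vectors of bounded l1-norm\<close>

lemma finite_int_vectors:
  "finite {u \<in> {..<d} \<rightarrow>\<^sub>E (real_of_int ` {- int m..int m}). norm1 d u \<le> real m}"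
  by (rule finite_subset[OF _ finite_PiE[of "{..<d}" "\<lambda>_. real_of_int ` {- int m..int m}"]]) auto

text \<open>Rankin's trick with \<open>exp (- \<theta>) = s / (s + d)\<close>.\<close>

lemma card_int_vectors_le:
  assumes "0 < s" "s \<le> d"
  shows "real (card {u \<in> {..<d} \<rightarrow>\<^sub>E (real_of_int ` {- int m..int m}). norm1 d u \<le> real m})
    \<le> exp ((real m + 2 * real s) * ln (exp 1 * real d / real s))"
proof -
  define U where "U = {..<d} \<rightarrow>\<^sub>E (real_of_int ` {- int m..int m})"
  define V where "V = {u \<in> U. norm1 d u \<le> real m}"
  define \<theta> where "\<theta> = ln (1 + d / s)"
  have ds: "real d / real s \<ge> 1" using assms by simp
  have \<theta>: "\<theta> > 0" "exp \<theta> = 1 + d / s" using ds by (auto simp: \<theta>_def)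
  define x where "x = exp (- \<theta>)"
  have "0 < real d / real s" using assms by simp
  then have x: "0 < x" "x < 1" "x = 1 / (1 + d / s)" using \<theta> unfolding x_def by (simp_all add: exp_minus inverse_eq_divide del: zero_less_divide_iff)
  \<comment> \<open>The two-sided geometric series is at most \<open>(1 + x) / (1 - x)\<close>, and
    the choice of \<open>x\<close> makes this equal to \<open>1 + 2 * s / d\<close>. The product
    over \<open>d\<close> coordinates then costs only \<open>exp (2 * s)\<close>.\<close>
  have geo: "(\<Sum>k\<in>real_of_int ` {- int m..int m}. exp (- \<theta> * \<bar>k\<bar>)) \<le> exp (2 * s / d)"
  proof -
    have "(\<Sum>k\<in>real_of_int ` {- int m..int m}. exp (- \<theta> * \<bar>k\<bar>)) = (\<Sum>k\<in>{- int m..int m}. x ^ nat \<bar>k\<bar>)"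
      by (subst sum.reindex) (auto simp: x_def inj_on_def simp flip: exp_of_nat_mult intro!: sum.cong)
    also have "\<dots> \<le> (\<Sum>k\<in>{0..int m} \<union> {- int m..- 1}. x ^ nat \<bar>k\<bar>)"
      using x by (intro sum_mono2) auto
    also have "\<dots> = (\<Sum>k\<in>{0..int m}. x ^ nat \<bar>k\<bar>) + (\<Sum>k\<in>{- int m..- 1}. x ^ nat \<bar>k\<bar>)"
      by (rule sum.union_disjoint) auto
    also have "(\<Sum>k\<in>{0..int m}. x ^ nat \<bar>k\<bar>) = (\<Sum>k<Suc m. x ^ k)"
      by (rule sum.reindex_bij_witness[of _ int nat]) auto
    also have "(\<Sum>k\<in>{- int m..- 1}. x ^ nat \<bar>k\<bar>) = (\<Sum>k<m. x ^ Suc k)"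
      by (rule sum.reindex_bij_witness[of _ "\<lambda>k. - int (Suc k)" "\<lambda>k. nat (- k - 1)"]) (auto simp: nat_diff_distrib Suc_nat_eq_nat_zadd1)
    also have "(\<Sum>k<Suc m. x ^ k) + (\<Sum>k<m. x ^ Suc k) \<le> 1 / (1 - x) + x * (1 / (1 - x))"
    proof (rule add_mono)
      have *: "(\<Sum>k<n. x ^ k) \<le> 1 / (1 - x)" for n
      proof -
        have "(\<Sum>k<n. x ^ k) = (1 - x ^ n) / (1 - x)"
          using x(1,2) geometric_sum[of x n] by (simp add: minus_divide_right flip: minus_divide_left)
            (metis minus_diff_eq minus_divide_divide)
        also have "\<dots> \<le> 1 / (1 - x)" using x(1,2) by (intro divide_right_mono) auto
        finally show ?thesis .
      qed
      show "(\<Sum>k<Suc m. x ^ k) \<le> 1 / (1 - x)" by (rule *)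
      have "(\<Sum>k<m. x ^ Suc k) = x * (\<Sum>k<m. x ^ k)" by (simp add: sum_distrib_left)
      also have "\<dots> \<le> x * (1 / (1 - x))" using x * by (intro mult_left_mono) auto
      finally show "(\<Sum>k<m. x ^ Suc k) \<le> x * (1 / (1 - x))" .
    qed
    also have "\<dots> = 1 + 2 * s / d"
    proof -
      have "1 - x = (d / s) * x" using x(3) ds by (simp add: field_simps)
      then have "1 / (1 - x) + x * (1 / (1 - x)) = (1 + x) / ((d / s) * x)" by (simp only: add_divide_distrib) simp
      also have "\<dots> = (1 / x + 1) * (s / d)" using x(1) assms by (simp add: field_simps)
      also have "1 / x = 1 + d / s" by (simp add: x(3))
      also have "(1 + d / s + 1) * (s / d) = 1 + 2 * s / d" using assms by (simp add: field_simps)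
      finally show ?thesis .
    qed
    also have "\<dots> \<le> exp (2 * s / d)" by (rule exp_ge_add_one_self)
    finally show ?thesis .
  qed
  have fU: "finite U" unfolding U_def by (intro finite_PiE) auto
  have "real (card V) = (\<Sum>u\<in>V. 1)" by simp
  also have "\<dots> \<le> (\<Sum>u\<in>V. exp (\<theta> * (real m - norm1 d u)))"
    using \<theta> by (intro sum_mono) (auto simp: V_def)
  also have "\<dots> \<le> (\<Sum>u\<in>U. exp (\<theta> * (real m - norm1 d u)))"
    using fU by (intro sum_mono2) (auto simp: V_def)
  also have "\<dots> = exp (\<theta> * m) * (\<Sum>u\<in>U. \<Prod>j<d. exp (- \<theta> * \<bar>u j\<bar>))"
  proof -
    have "\<theta> * (real m - norm1 d u) = \<theta> * m + (\<Sum>j<d. - \<theta> * \<bar>u j\<bar>)" for u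
      by (simp add: norm1_def sum_distrib_left right_diff_distrib sum_negf)
    then show ?thesis by (simp only: exp_add exp_sum[OF finite_lessThan] sum_distrib_left)
  qed
  also have "(\<Sum>u\<in>U. \<Prod>j<d. exp (- \<theta> * \<bar>u j\<bar>)) = (\<Prod>j<d. \<Sum>k\<in>real_of_int ` {- int m..int m}. exp (- \<theta> * \<bar>k\<bar>))"
    unfolding U_def by (subst prod_sum_PiE) auto
  also have "\<dots> \<le> (\<Prod>j<d. exp (2 * s / d))"
    using geo by (intro prod_mono) (auto intro: sum_nonneg)
  also have "\<dots> = exp (2 * s)" using assms by (simp flip: exp_of_nat_mult)
  also have "exp (\<theta> * m) * exp (2 * s) = exp (m * \<theta> + 2 * s * 1)" by (simp add: mult_exp_exp mult.commute)
  also have "\<dots> \<le> exp (m * ln (exp 1 * d / s) + 2 * s * ln (exp 1 * d / s))"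
  proof -
    have "1 + d / s \<le> exp 1 * (d / s)"
      using ds exp_ge_add_one_self[of 1] mult_right_mono[of 2 "exp 1" "d / s"] by simp
    then have "\<theta> \<le> ln (exp 1 * d / s)" unfolding \<theta>_def using ds by (subst ln_le_cancel_iff) auto
    moreover have "1 \<le> ln (exp 1 * d / s)" using assms by (simp add: ln_mult ln_div)
    ultimately show ?thesis using mult_left_mono[of 1 "ln (exp 1 * d / s)" "2 * real s"]
      by (intro iffD2[OF exp_le_cancel_iff] add_mono mult_left_mono) auto
  qed
  finally show ?thesis by (simp add: V_def U_def distrib_right)
qed

section \<open>Restricted curvature of random quadratic forms\<close>

text \<open>A union bound over the \<open>d\<close> coordinates has to be paid from the sample size,
  which is measured in \<open>s * ln (e d / s)\<close>. Writing \<open>ln d\<close> as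
  \<open>ln s + ln (d / s)\<close> shows that this budget covers it.\<close>

lemma dim_le_exp:
  assumes "0 < s" "s \<le> d"
  shows "real d \<le> exp (real s * ln (exp 1 * real d / real s))"
proof -
  have l: "ln (exp 1 * real d / real s) = 1 + ln (d / s)" "0 \<le> ln (d / s)"
    using ln_dim_ratio[OF assms] by auto
  have "real d = exp (ln s + ln (d / s))" using assms by (simp add: exp_add)
  also have "\<dots> \<le> exp (s * (1 + ln (d / s)))"
  proof -
    have "ln s \<le> real s" using assms ln_le_minus_one[of "real s"] by simp
    moreover have "1 * ln (d / s) \<le> s * ln (d / s)" using l assms by (intro mult_right_mono) auto
    ultimately show ?thesis by (simp add: distrib_left)
  qed
  finally show ?thesis by (simp only: l(1))
qed

lemma norm2_sq: "(norm2 d u)\<^sup>2 = (\<Sum>j<d. (u j)\<^sup>2)"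
  by (simp add: norm2_def L2_set_def sum_nonneg)

text \<open>For a nonnegative argument the negative exponential lies below its second-order Taylor
  polynomial, so two moments of \<open>X\<close> already give an exponential bound on the lower
  tail, without any boundedness.\<close>

lemma (in prob_space) exp_lower_tail:
  fixes X :: "'a \<Rightarrow> real" and N :: nat
  assumes [measurable]: "X \<in> borel_measurable M" and X0: "\<And>x. 0 \<le> X x"
    and int: "integrable M (\<lambda>x. (X x)\<^sup>2)" "integrable M X"
    and EX: "(LINT x|M. X x) \<ge> a" and EX2: "(LINT x|M. (X x)\<^sup>2) \<le> b" and "a > 0" "b > 0"
  shows "measure (PiM {..<N} (\<lambda>_. M)) {\<omega> \<in> space (PiM {..<N} (\<lambda>_. M)). (\<Sum>i<N. X (\<omega> i)) < N * (a / 4)}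
     \<le> exp (- (N * (a\<^sup>2 / (4 * b))))"
proof -
  define S where "S = PiM {..<N} (\<lambda>_. M)"
  interpret S: prob_space S unfolding S_def by (intro prob_space_PiM prob_space_axioms)
  \<comment> \<open>The minimiser of \<open>- \<gamma> * a + \<gamma>\<^sup>2 / 2 * b\<close>, with
    value \<open>- a\<^sup>2 / (2 * b)\<close>. The threshold \<open>a / 4\<close> gives back half
    of this exponent.\<close>
  define \<gamma> where "\<gamma> = a / b"
  have \<gamma>: "\<gamma> > 0" using assms by (simp add: \<gamma>_def)
  have quad: "exp (- x) \<le> 1 - x + x\<^sup>2 / 2" if "x \<ge> 0" for x :: real
  proof -
    have "\<exists>t. \<bar>t\<bar> \<le> \<bar>- x\<bar> \<and> exp (- x) = (\<Sum>m<3. (- x) ^ m / fact m) + exp t / fact 3 * (- x) ^ 3"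
      by (rule Maclaurin_exp_le)
    then obtain t where "exp (- x) = (\<Sum>m<3. (- x) ^ m / fact m) + exp t / fact 3 * (- x) ^ 3" by blast
    moreover have "exp t / fact 3 * (- x) ^ 3 \<le> 0"
      using that by (intro mult_nonneg_nonpos) (auto simp: power3_eq_cube)
    ultimately show ?thesis by (simp add: numeral_3_eq_3 fact_numeral power2_eq_square)
  qed
  have "(\<integral>\<^sup>+x. ennreal (exp (- \<gamma> * X x)) \<partial>M) \<le> (\<integral>\<^sup>+x. ennreal (1 - \<gamma> * X x + \<gamma>\<^sup>2 / 2 * (X x)\<^sup>2) \<partial>M)"
    using quad[of "\<gamma> * X _"] \<gamma> X0
    by (intro nn_integral_mono ennreal_leI) (simp add: power_mult_distrib)
  also have "\<dots> = ennreal (LINT x|M. 1 - \<gamma> * X x + \<gamma>\<^sup>2 / 2 * (X x)\<^sup>2)"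
  proof (rule nn_integral_eq_integral)
    show "AE x in M. 0 \<le> 1 - \<gamma> * X x + \<gamma>\<^sup>2 / 2 * (X x)\<^sup>2"
    proof (intro AE_I2)
      fix x
      have "exp (- (\<gamma> * X x)) \<le> 1 - \<gamma> * X x + (\<gamma> * X x)\<^sup>2 / 2" using quad[of "\<gamma> * X x"] \<gamma> X0 by simp
      moreover have "0 < exp (- (\<gamma> * X x))" by simp
      moreover have "(\<gamma> * X x)\<^sup>2 / 2 = \<gamma>\<^sup>2 / 2 * (X x)\<^sup>2" by (simp add: power_mult_distrib)
      ultimately show "0 \<le> 1 - \<gamma> * X x + \<gamma>\<^sup>2 / 2 * (X x)\<^sup>2" by linarith
    qed
  qed (use int in auto)
  also have "(LINT x|M. 1 - \<gamma> * X x + \<gamma>\<^sup>2 / 2 * (X x)\<^sup>2) = 1 - \<gamma> * (LINT x|M. X x) + \<gamma>\<^sup>2 / 2 * (LINT x|M. (X x)\<^sup>2)"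
    using int by (simp add: prob_space)
  also have "\<dots> \<le> 1 - \<gamma> * a + \<gamma>\<^sup>2 / 2 * b"
    using EX EX2 \<gamma> by (intro add_mono diff_mono mult_left_mono) auto
  also have "\<dots> = 1 + - (a\<^sup>2 / (2 * b))"
    using \<open>b > 0\<close> by (simp add: \<gamma>_def power2_eq_square field_simps)
  also have "\<dots> \<le> exp (- (a\<^sup>2 / (2 * b)))" by (rule exp_ge_add_one_self)
  finally have "(\<integral>\<^sup>+x. ennreal (exp (- \<gamma> * X x)) \<partial>M) \<le> ennreal (exp (- (a\<^sup>2 / (2 * b))))"
    by (simp add: ennreal_leI)
  then have "(\<integral>\<^sup>+\<omega>. ennreal (exp (\<Sum>i<N. - \<gamma> * X (\<omega> i))) \<partial>S) \<le> ennreal (exp (- (a\<^sup>2 / (2 * b))) ^ N)"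
    unfolding S_def by (intro nn_integral_PiM_exp_sum[OF prob_space_axioms]) auto
  moreover have "(\<lambda>\<omega>. exp (\<Sum>i<N. - \<gamma> * X (\<omega> i))) \<in> borel_measurable S"
    unfolding S_def
    by (intro borel_measurable_exp[THEN measurable_compose[rotated]] borel_measurable_PiM_sum) measurable
  ultimately have "S.prob {\<omega> \<in> space S. exp (- \<gamma> * (N * (a / 4))) < exp (\<Sum>i<N. - \<gamma> * X (\<omega> i))}
      \<le> exp (- (a\<^sup>2 / (2 * b))) ^ N / exp (- \<gamma> * (N * (a / 4)))"
    by (intro S.prob_gt_le_Markov) auto
  also have "\<dots> = exp (- (N * (a\<^sup>2 / (4 * b))))"
  proof -
    have "real N * - (a\<^sup>2 / (2 * b)) - - \<gamma> * (N * (a / 4)) = - (N * (a\<^sup>2 / (4 * b)))"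
      using \<open>b > 0\<close> by (simp add: \<gamma>_def power2_eq_square field_simps)
    then show ?thesis by (simp flip: exp_of_nat_mult exp_diff)
  qed
  also have "{\<omega> \<in> space S. exp (- \<gamma> * (N * (a / 4))) < exp (\<Sum>i<N. - \<gamma> * X (\<omega> i))}
     = {\<omega> \<in> space S. (\<Sum>i<N. X (\<omega> i)) < N * (a / 4)}"
    using \<gamma> by (simp flip: sum_distrib_left add: sum_negf)
  finally show ?thesis by (simp add: S_def)
qed

text \<open>Two union bounds are taken. \<open>N1\<close> pays for the integer vectors of l1-norm at
  most \<open>m\<close>, where squares of linear forms are nonnegative variables with a second
  moment bounded by \<nu>. \<open>N2\<close> pays for the \<open>d\<close> diagonal entries, which
  enter Maurey's error term. Each failure has probability at most
  \<open>exp (- t\<^sup>2 - 1)\<close>, and twice that is below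
  \<open>exp (- t\<^sup>2)\<close>.\<close>

lemma (in prob_space) restricted_curvature:
  fixes Z :: "nat \<Rightarrow> 'a \<Rightarrow> real"
  assumes Z: "\<And>j. j < d \<Longrightarrow> Z j \<in> borel_measurable M"
    and int4: "\<And>u. integrable M (\<lambda>x. (dotp d (\<lambda>j. Z j x) u) ^ 4)"
    and E4: "\<And>u. (LINT x|M. (dotp d (\<lambda>j. Z j x) u) ^ 4) \<le> \<nu> * (norm2 d u) ^ 4"
    and E2: "\<And>u. (LINT x|M. (dotp d (\<lambda>j. Z j x) u)\<^sup>2) \<ge> k * (norm2 d u)\<^sup>2"
    and expZ: "\<And>j. j < d \<Longrightarrow> (\<integral>\<^sup>+x. ennreal (exp (c * (Z j x)\<^sup>2)) \<partial>M) \<le> ennreal C"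
    and pos: "k > 0" "\<nu> > 0" "c > 0" "C \<ge> 1" and sd: "0 < s" "s \<le> d" and "m \<ge> 2" "N > 0"
    and N1: "k\<^sup>2 / (4 * \<nu>) * N \<ge> t\<^sup>2 + 1 + (real m + 2 * real s) * ln (exp 1 * d / s)"
    and N2: "real N \<ge> t\<^sup>2 + 1 + s * ln (exp 1 * d / s)"
  shows "\<exists>A\<in>sets (PiM {..<N} (\<lambda>_. M)). measure (PiM {..<N} (\<lambda>_. M)) A \<ge> 1 - exp (- t\<^sup>2) \<and>
    (\<forall>\<omega>\<in>A. \<forall>v. 1 / real N * (\<Sum>i<N. (dotp d (\<lambda>j. Z j (\<omega> i)) v)\<^sup>2)
       \<ge> k / 4 * (norm2 d v)\<^sup>2 - ((ln C + 1) / c) / (real m - 1) * (norm1 d v)\<^sup>2)"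
proof -
  define S where "S = PiM {..<N} (\<lambda>_. M)"
  interpret S: prob_space S unfolding S_def by (intro prob_space_PiM prob_space_axioms)
  \<comment> \<open>Chosen so that \<open>c * A0 = ln C + 1\<close>: the moment factor
    \<open>C ^ N\<close> cancels and \<open>exp (- N)\<close> remains.\<close>
  define A0 where "A0 = (ln C + 1) / c"
  define l where "l = ln (exp 1 * d / s)"
  define X where "X u x = (dotp d (\<lambda>j. Z j x) u)\<^sup>2" for u x
  have X_meas: "X u \<in> borel_measurable M" for u
    unfolding X_def dotp_def using Z by measurable
  define V where "V = {u \<in> {..<d} \<rightarrow>\<^sub>E (real_of_int ` {- int m..int m}). norm1 d u \<le> real m}"
  define bad where "bad u = {\<omega> \<in> space S. (\<Sum>i<N. X u (\<omega> i)) < N * (k * (norm2 d u)\<^sup>2 / 4)}" for u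
  define worse where "worse j = {\<omega> \<in> space S. exp (N * (c * A0)) < exp (\<Sum>i<N. c * (Z j (\<omega> i))\<^sup>2)}" for j
  have X_sum: "(\<lambda>\<omega>. \<Sum>i<N. X u (\<omega> i)) \<in> borel_measurable S" for u
    unfolding S_def by (intro borel_measurable_PiM_sum X_meas)
  have bad_sets: "bad u \<in> sets S" for u unfolding bad_def using X_sum by measurable
  have worse_meas: "(\<lambda>\<omega>. exp (\<Sum>i<N. c * (Z j (\<omega> i))\<^sup>2)) \<in> borel_measurable S" if "j < d" for j
    unfolding S_def using Z[OF that]
    by (intro borel_measurable_exp[THEN measurable_compose[rotated]] borel_measurable_PiM_sum) measurable
  have worse_sets: "worse j \<in> sets S" if "j < d" for j
    unfolding worse_def using worse_meas[OF that] by measurable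
  have bad_prob: "S.prob (bad u) \<le> exp (- (k\<^sup>2 / (4 * \<nu>) * N))" for u
  proof (cases "norm2 d u = 0")
    case True
    then have "bad u = {}" by (auto simp: bad_def X_def not_less intro!: sum_nonneg)
    then show ?thesis by simp
  next
    case False
    then have n: "norm2 d u > 0" by (simp add: norm2_def less_le L2_set_nonneg)
    have i4: "integrable M (\<lambda>x. (X u x)\<^sup>2)" using int4[of u] by (simp add: X_def flip: power_mult)
    have i2: "integrable M (X u)"
    proof (rule Bochner_Integration.integrable_bound[of M "\<lambda>x. 1 + (X u x)\<^sup>2"])
      show "AE x in M. norm (X u x) \<le> norm (1 + (X u x)\<^sup>2)"
      proof (intro AE_I2)
        fix x show "norm (X u x) \<le> norm (1 + (X u x)\<^sup>2)"
          using zero_le_power2[of "\<bar>X u x\<bar> - 1"] by (simp add: power2_eq_square algebra_simps)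
      qed
    qed (use i4 X_meas in auto)
    have "S.prob (bad u) \<le> exp (- (N * ((k * (norm2 d u)\<^sup>2)\<^sup>2 / (4 * (\<nu> * (norm2 d u) ^ 4)))))"
      unfolding bad_def S_def
    proof (rule exp_lower_tail[OF X_meas _ i4 i2])
      show "k * (norm2 d u)\<^sup>2 \<le> (LINT x|M. X u x)" using E2[of u] by (simp add: X_def)
      show "(LINT x|M. (X u x)\<^sup>2) \<le> \<nu> * (norm2 d u) ^ 4" using E4[of u] by (simp add: X_def flip: power_mult)
    qed (use pos n in \<open>auto simp: X_def\<close>)
    \<comment> \<open>Mean squared and second moment scale in the same way, so every vector has the
      same failure probability and only the number of vectors matters.\<close>
    also have "(k * (norm2 d u)\<^sup>2)\<^sup>2 / (4 * (\<nu> * (norm2 d u) ^ 4)) = k\<^sup>2 / (4 * \<nu>)"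
      using n by (simp add: power_mult_distrib flip: power_mult)
    finally show ?thesis by (simp add: mult.commute)
  qed
  have worse_prob: "S.prob (worse j) \<le> exp (- real N)" if "j < d" for j
  proof -
    have "(\<integral>\<^sup>+\<omega>. ennreal (exp (\<Sum>i<N. c * (Z j (\<omega> i))\<^sup>2)) \<partial>S) \<le> ennreal (C ^ N)"
      unfolding S_def using Z[OF that] pos
      by (intro nn_integral_PiM_exp_sum[OF prob_space_axioms] expZ that) auto
    then have "S.prob (worse j) \<le> C ^ N / exp (N * (c * A0))"
      unfolding worse_def using worse_meas[OF that] pos by (intro S.prob_gt_le_Markov) auto
    also have "C ^ N = exp (N * ln C)" using pos by (simp add: exp_of_nat_mult)
    also have "exp (N * ln C) / exp (N * (c * A0)) = exp (- real N)"
    proof -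
      have "c * A0 = ln C + 1" using pos by (simp add: A0_def)
      then show ?thesis by (simp add: distrib_left flip: exp_diff)
    qed
    finally show ?thesis .
  qed
  define B where "B = (\<Union>u\<in>V. bad u) \<union> (\<Union>j<d. worse j)"
  have finV: "finite V" unfolding V_def by (rule finite_int_vectors)
  have B_sets: "B \<in> sets S" unfolding B_def using finV bad_sets worse_sets by (intro sets.Un sets.finite_UN) auto
  have "S.prob B \<le> S.prob (\<Union>u\<in>V. bad u) + S.prob (\<Union>j<d. worse j)"
    unfolding B_def using finV bad_sets worse_sets by (intro measure_Un_le) auto
  also have "S.prob (\<Union>u\<in>V. bad u) \<le> (\<Sum>u\<in>V. S.prob (bad u))"
    using finV bad_sets by (intro measure_UNION_le) auto
  also have "\<dots> \<le> (\<Sum>u\<in>V. exp (- (k\<^sup>2 / (4 * \<nu>) * N)))" by (intro sum_mono bad_prob)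
  also have "\<dots> = card V * exp (- (k\<^sup>2 / (4 * \<nu>) * N))" by simp
  also have "\<dots> \<le> exp ((real m + 2 * real s) * l) * exp (- (k\<^sup>2 / (4 * \<nu>) * N))"
    unfolding V_def l_def using sd by (intro mult_right_mono card_int_vectors_le) auto
  also have "\<dots> = exp ((real m + 2 * real s) * l - k\<^sup>2 / (4 * \<nu>) * N)" by (simp add: mult_exp_exp)
  also have "\<dots> \<le> exp (- t\<^sup>2 - 1)" using N1 by (simp add: l_def)
  also have "S.prob (\<Union>j<d. worse j) \<le> (\<Sum>j<d. S.prob (worse j))"
    using worse_sets by (intro measure_UNION_le) auto
  also have "\<dots> \<le> (\<Sum>j<d. exp (- real N))" by (intro sum_mono worse_prob) auto
  also have "\<dots> = d * exp (- real N)" by simp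
  also have "\<dots> \<le> exp (s * l) * exp (- real N)"
    unfolding l_def using dim_le_exp[OF sd] by (intro mult_right_mono) auto
  also have "\<dots> = exp (s * l - N)" by (simp add: mult_exp_exp)
  also have "\<dots> \<le> exp (- t\<^sup>2 - 1)" using N2 by (simp add: l_def)
  finally have "S.prob B \<le> 2 * exp (- t\<^sup>2 - 1)" by simp
  also have "2 * exp (- t\<^sup>2 - 1) = 2 * (exp (- t\<^sup>2) / exp 1)" by (simp add: exp_diff)
  also have "\<dots> \<le> exp (- t\<^sup>2)"
  proof -
    have "2 * exp (- t\<^sup>2) \<le> exp 1 * exp (- t\<^sup>2)" using exp_ge_add_one_self[of 1] by (intro mult_right_mono) auto
    then show ?thesis by (simp add: field_simps)
  qed
  finally have PB: "S.prob B \<le> exp (- t\<^sup>2)" .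
  have "1 / real N * (\<Sum>i<N. (dotp d (\<lambda>j. Z j (\<omega> i)) v)\<^sup>2)
       \<ge> k / 4 * (norm2 d v)\<^sup>2 - A0 / (real m - 1) * (norm1 d v)\<^sup>2" if \<omega>: "\<omega> \<in> space S - B" for \<omega> v
  proof -
    \<comment> \<open>The empirical Gram matrix minus \<open>k / 4\<close> times the identity. Off
      the exceptional event it is nonnegative on the counted integer vectors, which is the
      hypothesis of \<open>maurey_lower_bound\<close>.\<close>
    define A where "A j l = 1 / N * (\<Sum>i<N. Z j (\<omega> i) * Z l (\<omega> i)) - k / 4 * coord_vec j l" for j l
    have bil: "bilin d A u u = 1 / N * (\<Sum>i<N. X u (\<omega> i)) - k / 4 * (norm2 d u)\<^sup>2" for u
    proof -
      have "bilin d A u u = (\<Sum>j<d. \<Sum>l<d. u j * (1 / N * (\<Sum>i<N. Z j (\<omega> i) * Z l (\<omega> i))) * u l) - (\<Sum>j<d. u j * (k / 4 * (\<Sum>l<d. coord_vec j l * u l)))"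
      proof -
        define r where "r j l = 1 / N * (\<Sum>i<N. Z j (\<omega> i) * Z l (\<omega> i))" for j l
        have "A = (\<lambda>j l. r j l - k / 4 * coord_vec j l)" by (simp add: A_def r_def fun_eq_iff)
        then show ?thesis unfolding r_def[symmetric]
          by (simp add: bilin_def left_diff_distrib right_diff_distrib sum_subtractf sum_distrib_left mult_ac)
      qed
      also have "(\<Sum>j<d. u j * (k / 4 * (\<Sum>l<d. coord_vec j l * u l))) = k / 4 * (norm2 d u)\<^sup>2"
        unfolding norm2_sq sum_distrib_left[of "k / 4" "\<lambda>j. (u j)\<^sup>2"]
        by (intro sum.cong) (auto simp: sum_unit' power2_eq_square)
      also have "(\<Sum>j<d. \<Sum>l<d. u j * (1 / N * (\<Sum>i<N. Z j (\<omega> i) * Z l (\<omega> i))) * u l)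
         = 1 / N * (\<Sum>j<d. \<Sum>l<d. \<Sum>i<N. (Z j (\<omega> i) * u j) * (Z l (\<omega> i) * u l))"
      proof -
        have "(\<Sum>j<d. \<Sum>l<d. u j * (r * (\<Sum>i<N. Z j (\<omega> i) * Z l (\<omega> i))) * u l)
         = r * (\<Sum>j<d. \<Sum>l<d. \<Sum>i<N. (Z j (\<omega> i) * u j) * (Z l (\<omega> i) * u l))" for r
          by (simp add: sum_distrib_left sum_distrib_right mult_ac)
        then show ?thesis .
      qed
      also have "(\<Sum>j<d. \<Sum>l<d. \<Sum>i<N. (Z j (\<omega> i) * u j) * (Z l (\<omega> i) * u l)) = (\<Sum>i<N. X u (\<omega> i))"
      proof -
        have "(\<Sum>j<d. \<Sum>l<d. \<Sum>i<N. (Z j (\<omega> i) * u j) * (Z l (\<omega> i) * u l))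
           = (\<Sum>j<d. \<Sum>i<N. \<Sum>l<d. (Z j (\<omega> i) * u j) * (Z l (\<omega> i) * u l))"
          by (intro sum.cong refl sum.swap)
        also have "\<dots> = (\<Sum>i<N. \<Sum>j<d. \<Sum>l<d. (Z j (\<omega> i) * u j) * (Z l (\<omega> i) * u l))" by (rule sum.swap)
        also have "\<dots> = (\<Sum>i<N. X u (\<omega> i))"
          by (simp add: X_def dotp_def power2_eq_square sum_product)
        finally show ?thesis .
      qed
      finally show ?thesis .
    qed
    have "bilin d A v v \<ge> - (A0 / (real m - 1)) * (norm1 d v)\<^sup>2"
    proof (rule maurey_lower_bound[OF _ _ \<open>m \<ge> 2\<close>])
      fix j assume j: "j < d"
      then have "\<omega> \<notin> worse j" using \<omega> by (auto simp: B_def)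
      then have "(\<Sum>i<N. c * (Z j (\<omega> i))\<^sup>2) \<le> N * (c * A0)" using \<omega> by (simp add: worse_def)
      then have "(\<Sum>i<N. (Z j (\<omega> i))\<^sup>2) \<le> N * A0" using pos by (simp flip: sum_distrib_left add: mult.left_commute)
      then have "1 / N * (\<Sum>i<N. Z j (\<omega> i) * Z j (\<omega> i)) \<le> A0" using \<open>N > 0\<close> by (simp add: power2_eq_square field_simps)
      then show "A j j \<le> A0" using pos by (simp add: A_def coord_vec_def)
    next
      fix u :: "nat \<Rightarrow> real" assume u: "\<And>j. j < d \<Longrightarrow> u j \<in> \<int>" "norm1 d u \<le> real m"
      \<comment> \<open>The finite set \<open>V\<close> consists of extensional functions; values of
        \<open>u\<close> outside the index range affect neither the form nor the norms.\<close>
      define u' where "u' = restrict u {..<d}"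
      have uu: "X u' = X u" "norm2 d u' = norm2 d u" "norm1 d u' = norm1 d u"
        by (auto simp: X_def u'_def dotp_def norm2_def norm1_def L2_set_def)
      have "u' \<in> V"
      proof -
        have "u j \<in> real_of_int ` {- int m..int m}" if "j < d" for j
        proof -
          have "u j \<in> \<int>" using u(1)[OF that] .
          then obtain z where z: "u j = of_int z" by (auto elim: Ints_cases)
          have "\<bar>u j\<bar> \<le> norm1 d u" unfolding norm1_def using that by (intro member_le_sum) auto
          then have "\<bar>real_of_int z\<bar> \<le> real m" using u(2) z by simp
          then have "z \<in> {- int m..int m}" by (auto simp: abs_le_iff)
          then show ?thesis using z by auto
        qed
        then show ?thesis using u(2) by (auto simp: V_def u'_def norm1_def)
      qed
      then have "\<omega> \<notin> bad u'" using \<omega> by (auto simp: B_def)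
      then have "N * (k * (norm2 d u)\<^sup>2 / 4) \<le> (\<Sum>i<N. X u (\<omega> i))" using \<omega> by (simp add: bad_def uu)
      then show "0 \<le> bilin d A u u" using \<open>N > 0\<close> by (simp add: bil field_simps)
    qed
    then show ?thesis by (simp add: bil X_def)
  qed
  moreover have "space S - B \<in> sets S" "S.prob (space S - B) \<ge> 1 - exp (- t\<^sup>2)"
    using B_sets PB by (auto simp: S.prob_compl)
  ultimately show ?thesis unfolding S_def A0_def by blast
qed

section \<open>Lebesgue measure and the uniform distribution on the sphere\<close>

interpretation lborel_prod: product_sigma_finite "\<lambda>_::nat. lborel :: real measure"
  by standard

abbreviation lborel_Rd :: "nat set \<Rightarrow> (nat \<Rightarrow> real) measure" where
  "lborel_Rd I \<equiv> Pi\<^sub>M I (\<lambda>_. lborel)"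

lemma sets_lborel_Rd: "sets (lborel_Rd I) = sets (Pi\<^sub>M I (\<lambda>_. borel))"
  by (intro sets_PiM_cong) auto

lemma emeasure_lborel_affine:
  fixes A :: "real set"
  assumes "A \<in> sets borel" "c \<noteq> 0"
  shows "ennreal \<bar>c\<bar> * emeasure lborel ((\<lambda>x. t + c * x) -` A) = emeasure lborel A"
proof -
  have "emeasure lborel A = emeasure (density (distr lborel borel (\<lambda>x. t + c * x)) (\<lambda>_. ennreal \<bar>c\<bar>)) A"
    using lborel_real_affine[OF assms(2), of t] by simp
  also have "\<dots> = ennreal \<bar>c\<bar> * emeasure (distr lborel borel (\<lambda>x. t + c * x)) A"
    using assms(1) by (simp add: emeasure_density nn_integral_cmult_indicator)
  also have "emeasure (distr lborel borel (\<lambda>x. t + c * x)) A = emeasure lborel ((\<lambda>x. t + c * x) -` A)"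
    using assms(1) by (subst emeasure_distr) auto
  finally show ?thesis by simp
qed

lemma affine_measurable_lborel_Rd:
  "(\<lambda>x. \<lambda>i\<in>I. a i + r * x i) \<in> lborel_Rd I \<rightarrow>\<^sub>M lborel_Rd I"
  by (intro measurable_restrict) measurable

text \<open>Such a map acts on each coordinate separately, so preimages of boxes are boxes and
  uniqueness of the product measure reduces the claim to one dimension. A reflection mixes
  coordinates and needs a different argument.\<close>

lemma emeasure_lborel_Rd_affine:
  assumes "finite I" "r \<noteq> 0" and A: "A \<in> sets (lborel_Rd I)"
  shows "ennreal (\<bar>r\<bar> ^ card I) * emeasure (lborel_Rd I) ((\<lambda>x. \<lambda>i\<in>I. a i + r * x i) -` A \<inter> space (lborel_Rd I))
    = emeasure (lborel_Rd I) A"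
proof -
  define T where "T x = (\<lambda>i\<in>I. a i + r * x i)" for x
  have T: "T \<in> lborel_Rd I \<rightarrow>\<^sub>M lborel_Rd I"
    unfolding T_def by (rule affine_measurable_lborel_Rd)
  define P where "P = scale_measure (ennreal (\<bar>r\<bar> ^ card I)) (distr (lborel_Rd I) (lborel_Rd I) T)"
  have "P = lborel_Rd I"
  proof (rule lborel_prod.PiM_eqI[OF assms(1)])
    fix S assume S: "\<And>i. i \<in> I \<Longrightarrow> S i \<in> sets (lborel :: real measure)"
    have sets: "Pi\<^sub>E I S \<in> sets (lborel_Rd I)" using S assms(1) by (intro sets_PiM_I_finite) auto
    have "T -` (Pi\<^sub>E I S) \<inter> space (lborel_Rd I) = Pi\<^sub>E I (\<lambda>i. (\<lambda>x. a i + r * x) -` S i)"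
      by (fastforce simp: T_def space_PiM PiE_def Pi_def extensional_def)
    then have "emeasure P (Pi\<^sub>E I S) = ennreal (\<bar>r\<bar> ^ card I) * emeasure (lborel_Rd I) (Pi\<^sub>E I (\<lambda>i. (\<lambda>x. a i + r * x) -` S i))"
      unfolding P_def using sets T by (simp add: emeasure_distr)
    also have "emeasure (lborel_Rd I) (Pi\<^sub>E I (\<lambda>i. (\<lambda>x. a i + r * x) -` S i)) = (\<Prod>i\<in>I. emeasure lborel ((\<lambda>x. a i + r * x) -` S i))"
    proof (rule lborel_prod.emeasure_PiM[OF assms(1)])
      fix i assume "i \<in> I"
      then have "S i \<in> sets borel" using S by simp
      then show "(\<lambda>x. a i + r * x) -` S i \<in> sets lborel"
        using measurable_sets[of "\<lambda>x. a i + r * x" borel borel "S i"] by simp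
    qed
    also have "ennreal (\<bar>r\<bar> ^ card I) * \<dots> = (\<Prod>i\<in>I. ennreal \<bar>r\<bar> * emeasure lborel ((\<lambda>x. a i + r * x) -` S i))"
      by (simp add: prod.distrib ennreal_power)
    also have "\<dots> = (\<Prod>i\<in>I. emeasure lborel (S i))"
      using S assms(2) by (intro prod.cong refl emeasure_lborel_affine) auto
    finally show "emeasure P (Pi\<^sub>E I S) = (\<Prod>i\<in>I. emeasure lborel (S i))" .
  qed (simp add: P_def)
  then have "emeasure (lborel_Rd I) A = emeasure P A" by simp
  also have "\<dots> = ennreal (\<bar>r\<bar> ^ card I) * emeasure (lborel_Rd I) (T -` A \<inter> space (lborel_Rd I))"
    unfolding P_def using A T by (simp add: emeasure_distr)
  finally show ?thesis by (simp add: T_def[abs_def])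
qed

lemma nn_integral_lborel_Rd_translate:
  assumes "finite I" and f: "f \<in> borel_measurable (lborel_Rd I)"
  shows "(\<integral>\<^sup>+x. f (\<lambda>i\<in>I. a i + x i) \<partial>lborel_Rd I) = (\<integral>\<^sup>+x. f x \<partial>lborel_Rd I)"
proof -
  define T where "T x = (\<lambda>i\<in>I. a i + 1 * x i)" for x :: "nat \<Rightarrow> real"
  have T: "T \<in> lborel_Rd I \<rightarrow>\<^sub>M lborel_Rd I"
    unfolding T_def by (rule affine_measurable_lborel_Rd)
  have "distr (lborel_Rd I) (lborel_Rd I) T = lborel_Rd I"
  proof (rule measure_eqI)
    fix A assume "A \<in> sets (distr (lborel_Rd I) (lborel_Rd I) T)"
    then show "emeasure (distr (lborel_Rd I) (lborel_Rd I) T) A = emeasure (lborel_Rd I) A"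
      using emeasure_lborel_Rd_affine[OF assms(1), of 1 A a] T by (simp add: emeasure_distr T_def[abs_def])
  qed simp
  then have "(\<integral>\<^sup>+x. f x \<partial>lborel_Rd I) = (\<integral>\<^sup>+x. f (T x) \<partial>lborel_Rd I)"
    using nn_integral_distr[OF T, of f] f by simp
  then show ?thesis by (simp add: T_def)
qed

text \<open>For a unit vector \<open>w\<close> this is the Householder reflection that fixes the
  hyperplane orthogonal to \<open>w\<close>.\<close>

definition reflect :: "nat \<Rightarrow> (nat \<Rightarrow> real) \<Rightarrow> (nat \<Rightarrow> real) \<Rightarrow> (nat \<Rightarrow> real)" where
  "reflect d w x = (\<lambda>i\<in>{..<d}. x i - 2 * dotp d x w * w i)"

lemma dotp_add_scale:
  "dotp d (\<lambda>i. x i + r * y i) w = dotp d x w + r * dotp d y w"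
  "dotp d w (\<lambda>i. x i + r * y i) = dotp d w x + r * dotp d w y"
  by (simp_all add: dotp_def algebra_simps sum.distrib sum_distrib_left)

lemma dotp_commute: "dotp d x y = dotp d y x"
  by (simp add: dotp_def mult.commute)

lemma dotp_self: "dotp d x x = (norm2 d x)\<^sup>2"
  unfolding dotp_def norm2_sq by (simp add: power2_eq_square)

lemma dotp_cong: "(\<And>i. i < d \<Longrightarrow> x i = x' i) \<Longrightarrow> (\<And>i. i < d \<Longrightarrow> y i = y' i) \<Longrightarrow> dotp d x y = dotp d x' y'"
  by (simp add: dotp_def)

lemma dotp_reflect: "dotp d (reflect d w x) y = dotp d x y - 2 * dotp d x w * dotp d w y"
proof -
  have "dotp d (reflect d w x) y = dotp d (\<lambda>i. x i + (- 2 * dotp d x w) * w i) y"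
    by (rule dotp_cong) (auto simp: reflect_def)
  then show ?thesis by (simp only: dotp_add_scale)
qed

lemma norm2_reflect:
  assumes "norm2 d w = 1"
  shows "norm2 d (reflect d w x) = norm2 d x"
proof -
  have "(norm2 d (reflect d w x))\<^sup>2 = dotp d (reflect d w x) (reflect d w x)" by (simp add: dotp_self)
  also have "\<dots> = dotp d x (reflect d w x) - 2 * dotp d x w * dotp d w (reflect d w x)" by (rule dotp_reflect)
  also have "dotp d x (reflect d w x) = dotp d x x - 2 * dotp d x w * dotp d w x"
    by (subst dotp_commute) (rule dotp_reflect)
  also have "dotp d w (reflect d w x) = dotp d x w - 2 * dotp d x w * dotp d w w"
    by (subst dotp_commute) (rule dotp_reflect)
  finally have "(norm2 d (reflect d w x))\<^sup>2 = (norm2 d x)\<^sup>2"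
    by (simp add: assms dotp_self dotp_commute[of d w x])
  then show ?thesis by (simp add: norm2_def L2_set_nonneg)
qed

lemma measurable_dotp: "(\<lambda>x. dotp d x w) \<in> borel_measurable (Pi\<^sub>M {..<d} (\<lambda>_. borel))"
  unfolding dotp_def by measurable

lemma measurable_norm2: "norm2 d \<in> borel_measurable (Pi\<^sub>M {..<d} (\<lambda>_. borel))"
  unfolding norm2_def[abs_def] L2_set_def by measurable

lemma measurable_reflect: "reflect d w \<in> borel_Rd d \<rightarrow>\<^sub>M borel_Rd d"
  unfolding reflect_def[abs_def] using measurable_dotp[of d w, measurable]
  by (intro measurable_restrict) measurable

text \<open>Shearing the coordinates along \<open>w\<close> turns the reflection into a reflection of one coordinate.\<close>

lemma nn_integral_lborel_Rd_reflect:
  assumes w: "norm2 d w = 1" and f: "f \<in> borel_measurable (borel_Rd d)"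
  shows "(\<integral>\<^sup>+x. f (reflect d w x) \<partial>lborel_Rd {..<d}) = (\<integral>\<^sup>+x. f x \<partial>lborel_Rd {..<d})"
proof -
  obtain k where k: "k < d" "w k \<noteq> 0"
  proof -
    have "(\<Sum>i<d. (w i)\<^sup>2) \<noteq> 0" using w by (simp flip: norm2_sq)
    then have "\<exists>i\<in>{..<d}. (w i)\<^sup>2 \<noteq> 0" by (metis sum.neutral)
    then show ?thesis using that by auto
  qed
  define I where "I = {..<d} - {k}"
  have I: "finite I" "k \<notin> I" "insert k I = {..<d}" using k by (auto simp: I_def)
  \<comment> \<open>\<open>sh z\<close> is \<open>z\<close> with coordinate \<open>k\<close> set to
    zero, plus the multiple \<open>z k / w k\<close> of \<open>w\<close>. Varying \<open>z k\<close>
    alone therefore moves the point parallel to \<open>w\<close>.\<close>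
  define sh where "sh z = (\<lambda>i\<in>{..<d}. if i = k then z k else w i / w k * z k + z i)" for z :: "nat \<Rightarrow> real"
  have kmem: "(\<lambda>z. z k) \<in> borel_measurable (borel_Rd d)" using k by (intro measurable_component_singleton) auto
  have sh: "sh \<in> borel_Rd d \<rightarrow>\<^sub>M borel_Rd d"
    unfolding sh_def[abs_def] using kmem[measurable] by (intro measurable_restrict) auto
  have meq: "borel_measurable (lborel_Rd {..<d}) = borel_measurable (borel_Rd d)"
    by (intro measurable_cong_sets sets_lborel_Rd refl)
  \<comment> \<open>The shear preserves Lebesgue measure: with \<open>t\<close> in the outer
    integral it is a translation of the other coordinates. A second use of Fubini then brings
    \<open>t\<close> inside.\<close>
  have key: "(\<integral>\<^sup>+x. g x \<partial>lborel_Rd {..<d}) = (\<integral>\<^sup>+y. (\<integral>\<^sup>+t. g (sh (y(k := t))) \<partial>lborel) \<partial>lborel_Rd I)"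
    if g: "g \<in> borel_measurable (borel_Rd d)" for g :: "(nat \<Rightarrow> real) \<Rightarrow> ennreal"
  proof -
    have g': "g \<in> borel_measurable (lborel_Rd (insert k I))" using g I(3) meq by simp
    have gs: "(\<lambda>z. g (sh z)) \<in> borel_measurable (lborel_Rd (insert k I))"
      using measurable_compose[OF sh g] I(3) meq by simp
    have "(\<integral>\<^sup>+x. g x \<partial>lborel_Rd {..<d}) = (\<integral>\<^sup>+t. (\<integral>\<^sup>+x. g (x(k := t)) \<partial>lborel_Rd I) \<partial>lborel)"
      using lborel_prod.product_nn_integral_insert_rev[OF I(1,2) g'] by (simp add: I(3))
    also have "\<dots> = (\<integral>\<^sup>+t. (\<integral>\<^sup>+x. g (sh (x(k := t))) \<partial>lborel_Rd I) \<partial>lborel)"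
    proof (rule nn_integral_cong)
      fix t :: real
      have m: "(\<lambda>x. g (x(k := t))) \<in> borel_measurable (lborel_Rd I)"
        using measurable_compose[OF measurable_add_dim[of k I "\<lambda>_. lborel"], of g borel]
          g' by (intro measurable_compose[OF _ g']) (rule measurable_PiM_single', auto simp: space_PiM PiE_iff extensional_def)
      have "(\<integral>\<^sup>+x. g (x(k := t)) \<partial>lborel_Rd I) = (\<integral>\<^sup>+x. g ((\<lambda>i\<in>I. w i / w k * t + x i)(k := t)) \<partial>lborel_Rd I)"
        using nn_integral_lborel_Rd_translate[OF I(1) m, of "\<lambda>i. w i / w k * t"] by simp
      also have "\<dots> = (\<integral>\<^sup>+x. g (sh (x(k := t))) \<partial>lborel_Rd I)"
      proof (rule nn_integral_cong)
        fix x :: "nat \<Rightarrow> real"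
        have "(\<lambda>i\<in>I. w i / w k * t + x i)(k := t) = sh (x(k := t))"
          using k by (auto simp: sh_def I_def fun_eq_iff)
        then show "g ((\<lambda>i\<in>I. w i / w k * t + x i)(k := t)) = g (sh (x(k := t)))" by simp
      qed
      finally show "(\<integral>\<^sup>+x. g (x(k := t)) \<partial>lborel_Rd I) = (\<integral>\<^sup>+x. g (sh (x(k := t))) \<partial>lborel_Rd I)" .
    qed
    also have "\<dots> = (\<integral>\<^sup>+z. g (sh z) \<partial>lborel_Rd (insert k I))"
      by (rule lborel_prod.product_nn_integral_insert_rev[OF I(1,2) gs, symmetric])
    also have "\<dots> = (\<integral>\<^sup>+y. (\<integral>\<^sup>+t. g (sh (y(k := t))) \<partial>lborel) \<partial>lborel_Rd I)"
      by (rule lborel_prod.product_nn_integral_insert[OF I(1,2) gs])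
    finally show ?thesis .
  qed
  \<comment> \<open>The reflection changes a point by a multiple of \<open>w\<close>, so it keeps
    each fibre and acts on its parameter as a constant minus \<open>t\<close>.\<close>
  have line: "reflect d w (sh (y(k := t))) = sh (y(k := - 2 * w k * (\<Sum>i\<in>I. y i * w i) + (- 1) * t))" for y t
  proof -
    have ww: "(\<Sum>i\<in>I. w i * w i) = 1 - w k * w k"
    proof -
      have "(\<Sum>i\<in>insert k I. w i * w i) = 1" unfolding I(3) using w dotp_self[of d w] by (simp add: dotp_def)
      then show ?thesis using sum.insert[OF I(1,2), of "\<lambda>i. w i * w i"] by linarith
    qed
    have "dotp d (sh (y(k := t))) w = (\<Sum>i\<in>insert k I. sh (y(k := t)) i * w i)" by (simp add: dotp_def I(3))
    also have "\<dots> = t * w k + (\<Sum>i\<in>I. (w i / w k * t + y i) * w i)"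
      unfolding sum.insert[OF I(1,2)] using k
      by (intro arg_cong2[where f = "(+)"] sum.cong) (auto simp: sh_def I_def)
    also have "\<dots> = t * w k + (t / w k) * (\<Sum>i\<in>I. w i * w i) + (\<Sum>i\<in>I. y i * w i)"
      by (simp add: algebra_simps sum.distrib sum_distrib_left)
    also have "\<dots> = t / w k + (\<Sum>i\<in>I. y i * w i)"
      unfolding ww using k by (simp add: field_simps)
    finally have D: "dotp d (sh (y(k := t))) w = t / w k + (\<Sum>i\<in>I. y i * w i)" .
    show ?thesis
      unfolding reflect_def D using k by (auto simp: sh_def fun_eq_iff field_simps)
  qed
  have fr: "(\<lambda>x. f (reflect d w x)) \<in> borel_measurable (borel_Rd d)"
    by (rule measurable_compose[OF measurable_reflect f])
  have "(\<integral>\<^sup>+x. f (reflect d w x) \<partial>lborel_Rd {..<d}) = (\<integral>\<^sup>+y. (\<integral>\<^sup>+t. f (reflect d w (sh (y(k := t)))) \<partial>lborel) \<partial>lborel_Rd I)"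
    by (rule key[OF fr])
  also have "\<dots> = (\<integral>\<^sup>+y. (\<integral>\<^sup>+t. f (sh (y(k := t))) \<partial>lborel) \<partial>lborel_Rd I)"
  proof (rule nn_integral_cong)
    fix y assume y: "y \<in> space (lborel_Rd I)"
    have fm: "(\<lambda>t. f (sh (y(k := t)))) \<in> borel_measurable borel"
    proof -
      have "(\<lambda>t. y(k := t)) \<in> borel \<rightarrow>\<^sub>M borel_Rd d"
        using y k by (intro measurable_PiM_single') (auto simp: space_PiM PiE_iff extensional_def I_def)
      then show ?thesis using measurable_compose[OF measurable_compose[OF _ sh] f] by blast
    qed
    show "(\<integral>\<^sup>+t. f (reflect d w (sh (y(k := t)))) \<partial>lborel) = (\<integral>\<^sup>+t. f (sh (y(k := t))) \<partial>lborel)"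
      unfolding line using nn_integral_real_affine[OF fm, of "- 1" "- 2 * w k * (\<Sum>i\<in>I. y i * w i)"] by simp
  qed
  also have "\<dots> = (\<integral>\<^sup>+x. f x \<partial>lborel_Rd {..<d})" by (rule key[OF f, symmetric])
  finally show ?thesis .
qed

section \<open>Volumes of balls and spherical caps\<close>

abbreviation ball_Rd :: "nat \<Rightarrow> (nat \<Rightarrow> real) set" where
  "ball_Rd d \<equiv> {x \<in> Rd d. norm2 d x \<le> 1}"

abbreviation pball_Rd :: "nat \<Rightarrow> (nat \<Rightarrow> real) set" where
  "pball_Rd d \<equiv> {v \<in> Rd d. 0 < norm2 d v \<and> norm2 d v \<le> 1}"

lemma space_lborel_Rd: "space (lborel_Rd {..<d}) = Rd d" "space (borel_Rd d) = Rd d"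
  by (simp_all add: space_PiM Rd_def)

lemma meas_lborel_Rd: "measurable (lborel_Rd {..<d}) N = measurable (borel_Rd d) N"
  by (intro measurable_cong_sets sets_lborel_Rd refl)

lemma meas_uniform_lborel_Rd:
  "measurable (uniform_measure (lborel_Rd {..<d}) A) N = measurable (borel_Rd d) N"
  by (rule measurable_cong_sets) (simp_all add: sets_lborel_Rd)

lemma norm2_nonneg: "0 \<le> norm2 d x"
  by (simp add: norm2_def L2_set_nonneg)

lemma norm2_scale: "norm2 d (\<lambda>i. r * x i) = \<bar>r\<bar> * norm2 d x"
proof -
  have "(norm2 d (\<lambda>i. r * x i))\<^sup>2 = (\<bar>r\<bar> * norm2 d x)\<^sup>2"
    by (simp add: norm2_sq power_mult_distrib sum_distrib_left)
  then show ?thesis using norm2_nonneg[of d] by (metis abs_ge_zero mult_nonneg_nonneg power2_eq_imp_eq)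
qed

lemma norm2_cong: "(\<And>i. i < d \<Longrightarrow> x i = y i) \<Longrightarrow> norm2 d x = norm2 d y"
  by (simp add: norm2_def L2_set_def)

lemma dotp_le_norm2: "\<bar>dotp d x y\<bar> \<le> norm2 d x * norm2 d y"
proof -
  have "\<bar>dotp d x y\<bar> \<le> (\<Sum>i<d. \<bar>x i\<bar> * \<bar>y i\<bar>)"
    unfolding dotp_def by (rule order_trans[OF sum_abs]) (simp add: abs_mult)
  also have "\<dots> \<le> norm2 d x * norm2 d y" unfolding norm2_def by (rule L2_set_mult_ineq)
  finally show ?thesis .
qed

lemma ball_sets: "ball_Rd d \<in> sets (lborel_Rd {..<d})" "pball_Rd d \<in> sets (lborel_Rd {..<d})"
proof -
  note [measurable] = measurable_norm2[of d]
  have "{x \<in> space (borel_Rd d). norm2 d x \<le> 1} \<in> sets (borel_Rd d)"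
    "{x \<in> space (borel_Rd d). 0 < norm2 d x \<and> norm2 d x \<le> 1} \<in> sets (borel_Rd d)" by measurable
  then show "ball_Rd d \<in> sets (lborel_Rd {..<d})" "pball_Rd d \<in> sets (lborel_Rd {..<d})"
    by (simp_all add: sets_lborel_Rd space_lborel_Rd)
qed

text \<open>The cone over a cap of height \<open>r\<close> is contained in the ball with centre
  \<open>r * v\<close> and radius \<open>sqrt (1 - r\<^sup>2)\<close>, so its share of the unit ball
  is at most the \<open>d\<close>-th power of this radius. For \<open>r\<^sup>2 > 1 / 2\<close> the
  apex of the cone would lie outside that ball.\<close>

lemma emeasure_cap_le:
  assumes v: "norm2 d v = 1" and r: "0 \<le> r" "r\<^sup>2 \<le> 1 / 2"
  shows "emeasure (lborel_Rd {..<d}) {x \<in> Rd d. norm2 d x \<le> 1 \<and> r * norm2 d x \<le> dotp d x v}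
    \<le> ennreal (exp (- (real d * r\<^sup>2 / 2))) * emeasure (lborel_Rd {..<d}) (ball_Rd d)"
proof -
  define \<rho> where "\<rho> = sqrt (1 - r\<^sup>2)"
  have \<rho>: "\<rho> > 0" "\<rho>\<^sup>2 = 1 - r\<^sup>2" using r by (auto simp: \<rho>_def)
  define A where "A = {x \<in> Rd d. norm2 d (\<lambda>i. x i + (- r) * v i) \<le> \<rho>}"
  have A_sets: "A \<in> sets (lborel_Rd {..<d})"
  proof -
    have "(\<lambda>x. norm2 d (\<lambda>i. x i + (- r) * v i)) \<in> borel_measurable (borel_Rd d)"
      unfolding norm2_def L2_set_def by measurable
    then have "{x \<in> space (borel_Rd d). norm2 d (\<lambda>i. x i + (- r) * v i) \<le> \<rho>} \<in> sets (borel_Rd d)"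
      by measurable
    then show ?thesis by (simp add: A_def sets_lborel_Rd space_lborel_Rd)
  qed
  have "{x \<in> Rd d. norm2 d x \<le> 1 \<and> r * norm2 d x \<le> dotp d x v} \<subseteq> A"
  proof
    fix x assume x: "x \<in> {x \<in> Rd d. norm2 d x \<le> 1 \<and> r * norm2 d x \<le> dotp d x v}"
    define n where "n = norm2 d x"
    have n: "0 \<le> n" "n \<le> 1" using x norm2_nonneg by (auto simp: n_def)
    have "(norm2 d (\<lambda>i. x i + (- r) * v i))\<^sup>2 = dotp d (\<lambda>i. x i + (- r) * v i) (\<lambda>i. x i + (- r) * v i)" by (simp only: dotp_self)
    also have "\<dots> = n\<^sup>2 - 2 * r * dotp d x v + r\<^sup>2"
      unfolding dotp_add_scale dotp_commute[of d v x]
      by (simp add: dotp_self v n_def algebra_simps power2_eq_square)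
    also have "\<dots> \<le> n\<^sup>2 - 2 * r * (r * n) + r\<^sup>2"
      using x r mult_left_mono[of "r * n" "dotp d x v" "2 * r"] by (simp add: n_def)
    \<comment> \<open>Here \<open>2 * r\<^sup>2 \<le> 1\<close> makes the second factor nonpositive,
      while \<open>1 - n\<close> is nonnegative.\<close>
    also have "\<dots> = 1 - r\<^sup>2 + (1 - n) * (2 * r\<^sup>2 - 1 - n)" by (simp add: power2_eq_square algebra_simps)
    also have "\<dots> \<le> \<rho>\<^sup>2" unfolding \<rho>(2) using n r mult_nonneg_nonpos[of "1 - n" "2 * r\<^sup>2 - 1 - n"] by simp
    finally have "norm2 d (\<lambda>i. x i + (- r) * v i) \<le> \<rho>"
      by (rule power2_le_imp_le) (use \<rho>(1) in simp)
    then show "x \<in> A" using x by (simp add: A_def)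
  qed
  then have "emeasure (lborel_Rd {..<d}) {x \<in> Rd d. norm2 d x \<le> 1 \<and> r * norm2 d x \<le> dotp d x v} \<le> emeasure (lborel_Rd {..<d}) A"
    using A_sets by (intro emeasure_mono) auto
  also have "\<dots> = ennreal (\<bar>\<rho>\<bar> ^ card {..<d}) * emeasure (lborel_Rd {..<d})
      ((\<lambda>x. \<lambda>i\<in>{..<d}. r * v i + \<rho> * x i) -` A \<inter> space (lborel_Rd {..<d}))"
    using \<rho>(1) by (intro emeasure_lborel_Rd_affine[symmetric] A_sets) auto
  also have "(\<lambda>x. \<lambda>i\<in>{..<d}. r * v i + \<rho> * x i) -` A \<inter> space (lborel_Rd {..<d}) = ball_Rd d"
  proof -
    have "norm2 d (\<lambda>i. (\<lambda>i\<in>{..<d}. r * v i + \<rho> * x i) i + (- r) * v i) = \<rho> * norm2 d x" for x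
      using norm2_scale[of d \<rho> x] \<rho>(1) by (subst norm2_cong[where y = "\<lambda>i. \<rho> * x i"]) auto
    then have e: "(norm2 d (\<lambda>i. (\<lambda>i\<in>{..<d}. r * v i + \<rho> * x i) i + (- r) * v i) \<le> \<rho>) \<longleftrightarrow> norm2 d x \<le> 1" for x
      using \<rho>(1) by simp
    have "(\<lambda>i\<in>{..<d}. r * v i + \<rho> * x i) \<in> Rd d" for x by (simp add: Rd_def)
    then show ?thesis unfolding A_def vimage_def mem_Collect_eq e space_lborel_Rd by auto
  qed
  also have "ennreal (\<bar>\<rho>\<bar> ^ card {..<d}) * emeasure (lborel_Rd {..<d}) (ball_Rd d)
      \<le> ennreal (exp (- (real d * r\<^sup>2 / 2))) * emeasure (lborel_Rd {..<d}) (ball_Rd d)"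
  proof (intro mult_right_mono ennreal_leI)
    have "(exp (- (r\<^sup>2 / 2)))\<^sup>2 = exp (- r\<^sup>2)"
      unfolding power2_eq_square[of "exp _"] mult_exp_exp by simp
    then have "\<rho>\<^sup>2 \<le> (exp (- (r\<^sup>2 / 2)))\<^sup>2" using exp_ge_add_one_self[of "- r\<^sup>2"] \<rho>(2) by linarith
    then have "\<rho> \<le> exp (- (r\<^sup>2 / 2))" by (rule power2_le_imp_le) simp
    then have "\<rho> ^ d \<le> exp (- (r\<^sup>2 / 2)) ^ d" using \<rho>(1) by (intro power_mono) auto
    also have "\<dots> = exp (- (real d * r\<^sup>2 / 2))" by (simp flip: exp_of_nat_mult)
    finally show "\<bar>\<rho>\<bar> ^ card {..<d} \<le> exp (- (real d * r\<^sup>2 / 2))" using \<rho>(1) by simp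
  qed simp
  finally show ?thesis .
qed

text \<open>A box inside and a box outside show that conditioning on the punctured ball gives a
  probability measure. Removing the origin changes nothing because a single point is a null box in
  positive dimension.\<close>

lemma emeasure_ball:
  assumes "d > 0"
  shows "emeasure (lborel_Rd {..<d}) (pball_Rd d) \<noteq> 0"
    and "emeasure (lborel_Rd {..<d}) (pball_Rd d) \<noteq> \<infinity>"
    and "emeasure (lborel_Rd {..<d}) (ball_Rd d) = emeasure (lborel_Rd {..<d}) (pball_Rd d)"
proof -
  let ?L = "lborel_Rd {..<d}"
  have box: "emeasure ?L (Pi\<^sub>E {..<d} (\<lambda>_. {a..b})) = ennreal (b - a) ^ d" if "a \<le> b" for a b
    using that by (subst lborel_prod.emeasure_PiM) auto
  have box_sets: "Pi\<^sub>E {..<d} (\<lambda>_. {a..b}) \<in> sets ?L" for a b :: real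
    by (intro sets_PiM_I_finite) auto
  \<comment> \<open>Coordinates of at most \<open>1 / d\<close> keep the norm below 1, and the
    positive lower end keeps the origin out of the box.\<close>
  have 1: "Pi\<^sub>E {..<d} (\<lambda>_. {1 / (2 * real d)..1 / d}) \<subseteq> pball_Rd d"
  proof
    fix x assume x: "x \<in> Pi\<^sub>E {..<d} (\<lambda>_. {1 / (2 * real d)..1 / d})"
    then have xi: "1 / (2 * real d) \<le> x i" "x i \<le> 1 / d" if "i < d" for i using that by (auto simp: PiE_iff)
    have x0: "0 < x i" if "i < d" for i using xi(1)[OF that] assms by (intro less_le_trans[OF _ xi(1)[OF that]]) simp
    have "(norm2 d x)\<^sup>2 \<le> (\<Sum>i<d. 1 / real d)" unfolding norm2_sq
    proof (rule sum_mono)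
      fix i assume i: "i \<in> {..<d}"
      have "(x i)\<^sup>2 \<le> 1 / d * (1 / d)" unfolding power2_eq_square
        using xi(2)[of i] x0[of i] i by (intro mult_mono) auto
      also have "\<dots> \<le> 1 / d * 1" using assms by (intro mult_left_mono) auto
      finally show "(x i)\<^sup>2 \<le> 1 / real d" by simp
    qed
    also have "\<dots> = 1\<^sup>2" using assms by simp
    finally have "norm2 d x \<le> 1" by (rule power2_le_imp_le) simp
    moreover have "0 < (norm2 d x)\<^sup>2" unfolding norm2_sq
    proof (rule sum_pos)
      show "0 < (x i)\<^sup>2" if "i \<in> {..<d}" for i using x0[of i] that by simp
    qed (use assms in auto)
    then have "0 < norm2 d x" using norm2_nonneg[of d x] by (simp add: less_le)
    moreover have "x \<in> Rd d" using x by (auto simp: Rd_def PiE_iff)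
    ultimately show "x \<in> pball_Rd d" by simp
  qed
  have "0 < ennreal (1 / d - 1 / (2 * real d)) ^ d"
    using assms by (subst ennreal_power) (auto simp: field_simps)
  also have "\<dots> = emeasure ?L (Pi\<^sub>E {..<d} (\<lambda>_. {1 / (2 * real d)..1 / d}))"
    using assms by (intro box[symmetric]) (simp add: field_simps)
  also have "\<dots> \<le> emeasure ?L (pball_Rd d)" by (intro emeasure_mono 1 ball_sets)
  finally show "emeasure ?L (pball_Rd d) \<noteq> 0" by simp
  have "pball_Rd d \<subseteq> Pi\<^sub>E {..<d} (\<lambda>_. {-1..1})"
  proof
    fix x assume x: "x \<in> pball_Rd d"
    have "\<bar>x i\<bar> \<le> 1" if "i < d" for i
    proof -
      have "(x i)\<^sup>2 \<le> (norm2 d x)\<^sup>2" unfolding norm2_sq using that by (intro member_le_sum) auto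
      then have "\<bar>x i\<bar> \<le> norm2 d x" using norm2_nonneg[of d x] by (simp flip: abs_le_square_iff)
      then show ?thesis using x by simp
    qed
    then show "x \<in> Pi\<^sub>E {..<d} (\<lambda>_. {-1..1})" using x by (auto simp: Rd_def PiE_iff abs_le_iff minus_le_iff)
  qed
  then have "emeasure ?L (pball_Rd d) \<le> ennreal (1 - (-1)) ^ d"
    by (subst box[symmetric]) (auto intro!: emeasure_mono box_sets)
  also have "\<dots> < \<infinity>" by (simp add: power_less_top_ennreal)
  finally show "emeasure ?L (pball_Rd d) \<noteq> \<infinity>" by simp
  have "ball_Rd d \<subseteq> pball_Rd d \<union> Pi\<^sub>E {..<d} (\<lambda>_. {0..0})"
  proof
    fix x assume x: "x \<in> ball_Rd d"
    show "x \<in> pball_Rd d \<union> Pi\<^sub>E {..<d} (\<lambda>_. {0..0})"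
    proof (cases "norm2 d x = 0")
      case True
      then have "(\<Sum>i<d. (x i)\<^sup>2) = 0" by (simp flip: norm2_sq)
      then have "\<And>i. i < d \<Longrightarrow> x i = 0" by (simp add: sum_nonneg_eq_0_iff)
      then show ?thesis using x by (auto simp: Rd_def PiE_iff fun_eq_iff extensional_def)
    next
      case False
      then have "0 < norm2 d x" using norm2_nonneg[of d x] by simp
      then show ?thesis using x by auto
    qed
  qed
  then have "emeasure ?L (ball_Rd d) \<le> emeasure ?L (pball_Rd d \<union> Pi\<^sub>E {..<d} (\<lambda>_. {0..0}))"
    by (intro emeasure_mono sets.Un ball_sets box_sets)
  also have "\<dots> \<le> emeasure ?L (pball_Rd d) + emeasure ?L (Pi\<^sub>E {..<d} (\<lambda>_. {0..0}))"
    by (intro emeasure_subadditive ball_sets box_sets)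
  also have "emeasure ?L (Pi\<^sub>E {..<d} (\<lambda>_. {0..0})) = 0" using assms by (subst box) auto
  finally show "emeasure ?L (ball_Rd d) = emeasure ?L (pball_Rd d)"
    by (intro antisym) (auto intro!: emeasure_mono ball_sets)
qed

lemma normalize_measurable: "(\<lambda>v. \<lambda>i\<in>{..<d}. v i / norm2 d v) \<in> borel_Rd d \<rightarrow>\<^sub>M borel_Rd d"
  using measurable_norm2[of d, measurable] by (intro measurable_restrict) measurable

lemma prob_space_sphere_uniform:
  assumes "d > 0"
  shows "prob_space (sphere_uniform d)"
  unfolding sphere_uniform_def
proof (rule prob_space.prob_space_distr)
  show "prob_space (uniform_measure (lborel_Rd {..<d}) (pball_Rd d))"
    using emeasure_ball[OF assms] by (intro prob_space_uniform_measure) auto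
  show "(\<lambda>v. \<lambda>i\<in>{..<d}. v i / norm2 d v) \<in> uniform_measure (lborel_Rd {..<d}) (pball_Rd d) \<rightarrow>\<^sub>M borel_Rd d"
    unfolding meas_uniform_lborel_Rd by (rule normalize_measurable)
qed

lemma sets_sphere_uniform: "sets (sphere_uniform d) = sets (borel_Rd d)"
  by (simp add: sphere_uniform_def)

lemma nn_integral_sphere_uniform:
  assumes f: "f \<in> borel_measurable (borel_Rd d)"
  shows "(\<integral>\<^sup>+u. f u \<partial>sphere_uniform d) = (\<integral>\<^sup>+x. f (\<lambda>i\<in>{..<d}. x i / norm2 d x) * indicator (pball_Rd d) x \<partial>lborel_Rd {..<d})
    / emeasure (lborel_Rd {..<d}) (pball_Rd d)"
proof -
  have "(\<integral>\<^sup>+u. f u \<partial>sphere_uniform d) = (\<integral>\<^sup>+x. f (\<lambda>i\<in>{..<d}. x i / norm2 d x) \<partial>uniform_measure (lborel_Rd {..<d}) (pball_Rd d))"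
    unfolding sphere_uniform_def
    using normalize_measurable f by (intro nn_integral_distr) (simp_all add: meas_uniform_lborel_Rd)
  also have "\<dots> = (\<integral>\<^sup>+x. f (\<lambda>i\<in>{..<d}. x i / norm2 d x) * indicator (pball_Rd d) x \<partial>lborel_Rd {..<d})
    / emeasure (lborel_Rd {..<d}) (pball_Rd d)"
    using measurable_compose[OF normalize_measurable f] by (intro nn_integral_uniform_measure ball_sets) (simp add: meas_lborel_Rd)
  finally show ?thesis .
qed

text \<open>A reflection preserves norms, so it commutes with the normalisation and maps the
  punctured ball onto itself. Invariance of Lebesgue measure therefore passes to the sphere.\<close>

lemma nn_integral_sphere_reflect:
  assumes w: "norm2 d w = 1" and f: "f \<in> borel_measurable (borel_Rd d)"
  shows "(\<integral>\<^sup>+u. f (reflect d w u) \<partial>sphere_uniform d) = (\<integral>\<^sup>+u. f u \<partial>sphere_uniform d)"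
proof -
  define g where "g x = f (\<lambda>i\<in>{..<d}. x i / norm2 d x) * indicator (pball_Rd d) x" for x
  have g: "g \<in> borel_measurable (borel_Rd d)"
    unfolding g_def using measurable_compose[OF normalize_measurable f] ball_sets(2)[of d]
    by (intro borel_measurable_times_ennreal borel_measurable_indicator) (auto simp: sets_lborel_Rd)
  have "f (reflect d w (\<lambda>i\<in>{..<d}. x i / norm2 d x)) * indicator (pball_Rd d) x = g (reflect d w x)"
    if "x \<in> Rd d" for x
  proof -
    have "dotp d (\<lambda>i\<in>{..<d}. x i / norm2 d x) w = dotp d x w / norm2 d x"
      by (simp add: dotp_def sum_divide_distrib)
    then have "reflect d w (\<lambda>i\<in>{..<d}. x i / norm2 d x) = (\<lambda>i\<in>{..<d}. reflect d w x i / norm2 d (reflect d w x))"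
      unfolding norm2_reflect[OF w] by (auto simp: reflect_def fun_eq_iff diff_divide_distrib)
    moreover have "reflect d w x \<in> pball_Rd d \<longleftrightarrow> x \<in> pball_Rd d"
      using that by (auto simp: norm2_reflect[OF w]) (auto simp: reflect_def Rd_def)
    ultimately show ?thesis by (simp add: g_def indicator_def)
  qed
  then have "(\<integral>\<^sup>+x. f (reflect d w (\<lambda>i\<in>{..<d}. x i / norm2 d x)) * indicator (pball_Rd d) x \<partial>lborel_Rd {..<d})
     = (\<integral>\<^sup>+x. g (reflect d w x) \<partial>lborel_Rd {..<d})"
    by (intro nn_integral_cong) (simp add: space_lborel_Rd)
  also have "\<dots> = (\<integral>\<^sup>+x. g x \<partial>lborel_Rd {..<d})" by (rule nn_integral_lborel_Rd_reflect[OF w g])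
  finally show ?thesis
    unfolding nn_integral_sphere_uniform[OF measurable_compose[OF measurable_reflect f]] nn_integral_sphere_uniform[OF f]
    by (simp add: g_def)
qed

text \<open>The sum over all \<open>k\<close> of
  \<open>2 * exp (- k / 4) * exp ((k + 1) / 8)\<close>, the geometric series that arises in
  \<open>sphere_subgaussian\<close>.\<close>

definition sphere_const :: real where
  "sphere_const = 2 * exp (1 / 8) / (1 - exp (- 1 / 8))"

lemma sphere_const_pos: "sphere_const > 0"
  by (simp add: sphere_const_def)

text \<open>The ball is sliced according to the integer part \<open>k\<close> of the rescaled
  squared projection. The set where it is at least \<open>k\<close> is covered by two opposite caps
  of relative volume \<open>exp (- k / 4)\<close> each, and rate \<open>1 / 8\<close> is half of
  that decay, so the weighted series converges.\<close>

lemma sphere_subgaussian: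
  assumes v: "norm2 d v = 1"
  shows "(\<integral>\<^sup>+u. ennreal (exp (1 / 8 * (d * (dotp d u v)\<^sup>2))) \<partial>sphere_uniform d) \<le> ennreal sphere_const"
proof -
  have d: "d > 0" using v by (cases d) (auto simp: norm2_def)
  define q where "q = exp (- 1 / 8 :: real)"
  have q: "0 < q" "q < 1" by (auto simp: q_def)
  let ?L = "lborel_Rd {..<d}"
  define g where "g u = real d * (dotp d u v)\<^sup>2" for u
  define pr where "pr x = (\<lambda>i\<in>{..<d}. x i / norm2 d x)" for x
  have g_meas: "g \<in> borel_measurable (borel_Rd d)" unfolding g_def using measurable_dotp[of d v, measurable] by measurable
  have gp_meas: "(\<lambda>x. g (pr x)) \<in> borel_measurable ?L"
    unfolding pr_def meas_lborel_Rd by (rule measurable_compose[OF normalize_measurable g_meas])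
  define E where "E k = {x \<in> pball_Rd d. real k \<le> g (pr x)}" for k
  have E_sets: "E k \<in> sets ?L" for k
  proof -
    have "E k = pball_Rd d \<inter> {x \<in> space ?L. real k \<le> g (pr x)}" by (auto simp: E_def space_lborel_Rd)
    moreover have "{x \<in> space ?L. real k \<le> g (pr x)} \<in> sets ?L" using gp_meas by measurable
    ultimately show ?thesis using sets.Int[OF ball_sets(2)[of d]] by simp
  qed
  have gpr: "g (pr x) = d * (dotp d x v)\<^sup>2 / (norm2 d x)\<^sup>2" for x
    by (simp add: g_def pr_def dotp_def power_divide flip: sum_divide_distrib)
  have E_le: "emeasure ?L (E k) \<le> ennreal (2 * exp (- (k / 4))) * emeasure ?L (ball_Rd d)" if "k \<le> d" for k
  proof -
    \<comment> \<open>The cap bound requires \<open>r\<^sup>2 \<le> 1 / 2\<close>. For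
      \<open>k \<le> d\<close> the minimum is still at least \<open>k / (2 * d)\<close>, which turns
      the exponent \<open>d * r\<^sup>2 / 2\<close> into \<open>k / 4\<close>.\<close>
    define r where "r = sqrt (min (k / d) (1 / 2))"
    have r: "0 \<le> r" "r\<^sup>2 \<le> 1 / 2" "r\<^sup>2 \<le> k / d" "k / (2 * d) \<le> r\<^sup>2"
    proof -
      have r2: "r\<^sup>2 = min (k / d) (1 / 2)" by (simp add: r_def)
      have "real k / (2 * real d) \<le> k / d" using d by (intro divide_left_mono) auto
      moreover have "real k / (2 * real d) \<le> 1 / 2" using d that by simp
      ultimately show "k / (2 * d) \<le> r\<^sup>2" unfolding r2 by simp
      show "0 \<le> r" by (simp add: r_def)
      show "r\<^sup>2 \<le> 1 / 2" unfolding r2 by (rule min.cobounded2)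
      show "r\<^sup>2 \<le> k / d" unfolding r2 by (rule min.cobounded1)
    qed
    define cap where "cap v = {x \<in> Rd d. norm2 d x \<le> 1 \<and> r * norm2 d x \<le> dotp d x v}" for v
    have v': "norm2 d (\<lambda>i. - v i) = 1" using v norm2_scale[of d "- 1" v] by simp
    have cap_sets: "cap v \<in> sets ?L" for v
    proof -
      have "(\<lambda>x. dotp d x v - r * norm2 d x) \<in> borel_measurable (borel_Rd d)"
        using measurable_dotp[of d v] measurable_norm2[of d] by (intro borel_measurable_diff borel_measurable_times) auto
      then have "{x \<in> space (borel_Rd d). norm2 d x \<le> 1 \<and> 0 \<le> dotp d x v - r * norm2 d x} \<in> sets (borel_Rd d)"
        using measurable_norm2[of d, measurable] by measurable
      then show ?thesis by (simp add: cap_def sets_lborel_Rd space_lborel_Rd)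
    qed
    have cap_le: "emeasure ?L (cap v) \<le> ennreal (exp (- (k / 4))) * emeasure ?L (ball_Rd d)" if "norm2 d v = 1" for v
    proof -
      have "emeasure ?L (cap v) \<le> ennreal (exp (- (real d * r\<^sup>2 / 2))) * emeasure ?L (ball_Rd d)"
        unfolding cap_def by (rule emeasure_cap_le[OF that r(1,2)])
      also have "\<dots> \<le> ennreal (exp (- (k / 4))) * emeasure ?L (ball_Rd d)"
        using r(4) d by (intro mult_right_mono ennreal_leI) (auto simp: field_simps)
      finally show ?thesis .
    qed
    have "E k \<subseteq> cap v \<union> cap (\<lambda>i. - v i)"
    proof
      fix x assume x: "x \<in> E k"
      then have n: "norm2 d x > 0" and "real k \<le> d * (dotp d x v)\<^sup>2 / (norm2 d x)\<^sup>2" by (auto simp: E_def gpr)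
      then have "k / d * (norm2 d x)\<^sup>2 \<le> (dotp d x v)\<^sup>2" using d by (simp add: field_simps)
      moreover have "r\<^sup>2 * (norm2 d x)\<^sup>2 \<le> k / d * (norm2 d x)\<^sup>2" using r(3) by (intro mult_right_mono) auto
      ultimately have "(r * norm2 d x)\<^sup>2 \<le> (dotp d x v)\<^sup>2" by (simp add: power_mult_distrib)
      then have "\<bar>r * norm2 d x\<bar> \<le> \<bar>dotp d x v\<bar>" by (simp only: abs_le_square_iff)
      then have "r * norm2 d x \<le> dotp d x v \<or> r * norm2 d x \<le> dotp d x (\<lambda>i. - v i)"
        by (auto simp: dotp_def sum_negf abs_if split: if_splits)
      then show "x \<in> cap v \<union> cap (\<lambda>i. - v i)" using x by (auto simp: cap_def E_def)
    qed
    then have "emeasure ?L (E k) \<le> emeasure ?L (cap v \<union> cap (\<lambda>i. - v i))"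
      using cap_sets by (intro emeasure_mono) auto
    also have "\<dots> \<le> emeasure ?L (cap v) + emeasure ?L (cap (\<lambda>i. - v i))"
      using cap_sets by (intro emeasure_subadditive) auto
    also have "\<dots> \<le> ennreal (exp (- (k / 4))) * emeasure ?L (ball_Rd d) + ennreal (exp (- (k / 4))) * emeasure ?L (ball_Rd d)"
      by (intro add_mono cap_le v v')
    also have "\<dots> = ennreal (2 * exp (- (k / 4))) * emeasure ?L (ball_Rd d)"
      by (simp flip: distrib_right ennreal_plus)
    finally show ?thesis .
  qed
  have pw: "ennreal (exp (1 / 8 * g (pr x))) * indicator (pball_Rd d) x
     \<le> (\<Sum>k\<le>d. ennreal (exp ((real k + 1) / 8)) * indicator (E k) x)" for x
  proof (cases "x \<in> pball_Rd d")
    case True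
    then have n: "norm2 d x > 0" by simp
    have g0: "g (pr x) \<ge> 0" by (simp add: g_def)
    have "(dotp d x v)\<^sup>2 \<le> (norm2 d x)\<^sup>2"
      using dotp_le_norm2[of d x v] v norm2_nonneg[of d x] by (simp flip: abs_le_square_iff)
    then have gd: "g (pr x) \<le> d" unfolding gpr using n d by (simp add: field_simps)
    define k where "k = nat \<lfloor>g (pr x)\<rfloor>"
    have k: "real k \<le> g (pr x)" "g (pr x) \<le> real k + 1" using g0 by (auto simp: k_def)
    have "k \<le> d" using k(1) gd by simp
    have "ennreal (exp (1 / 8 * g (pr x))) * indicator (pball_Rd d) x \<le> ennreal (exp ((real k + 1) / 8)) * indicator (E k) x"
      using True k by (simp add: E_def ennreal_leI)
    also have "\<dots> \<le> (\<Sum>k\<le>d. ennreal (exp ((real k + 1) / 8)) * indicator (E k) x)"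
      by (rule member_le_sum[where f = "\<lambda>k. ennreal (exp ((real k + 1) / 8)) * indicator (E k) x"]) (use \<open>k \<le> d\<close> in auto)
    finally show ?thesis .
  qed simp
  have "(\<integral>\<^sup>+x. ennreal (exp (1 / 8 * g (pr x))) * indicator (pball_Rd d) x \<partial>?L)
     \<le> (\<integral>\<^sup>+x. (\<Sum>k\<le>d. ennreal (exp ((real k + 1) / 8)) * indicator (E k) x) \<partial>?L)"
    by (intro nn_integral_mono pw)
  also have "\<dots> = (\<Sum>k\<le>d. ennreal (exp ((real k + 1) / 8)) * emeasure ?L (E k))"
    using E_sets by (subst nn_integral_sum) (auto simp: nn_integral_cmult)
  also have "\<dots> \<le> (\<Sum>k\<le>d. ennreal (exp ((real k + 1) / 8)) * (ennreal (2 * exp (- (k / 4))) * emeasure ?L (ball_Rd d)))"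
    by (intro sum_mono mult_left_mono E_le) auto
  also have "\<dots> = (\<Sum>k\<le>d. ennreal (2 * exp (1 / 8) * q ^ k) * emeasure ?L (ball_Rd d))"
  proof (intro sum.cong refl)
    fix k
    have "exp ((real k + 1) / 8) * exp (- (k / 4)) = exp (1 / 8 + k * (- 1 / 8))"
      by (simp add: mult_exp_exp add_divide_distrib)
    also have "\<dots> = exp (1 / 8) * q ^ k" by (simp only: q_def exp_add exp_of_nat_mult)
    finally have e: "exp ((real k + 1) / 8) * (2 * exp (- (k / 4))) = 2 * exp (1 / 8) * q ^ k"
      by (metis mult.assoc mult.left_commute)
    have "ennreal (exp ((real k + 1) / 8)) * ennreal (2 * exp (- (k / 4))) = ennreal (2 * exp (1 / 8) * q ^ k)"
      unfolding e[symmetric] by (rule ennreal_mult[symmetric]) auto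
    then show "ennreal (exp ((real k + 1) / 8)) * (ennreal (2 * exp (- (k / 4))) * emeasure ?L (ball_Rd d))
        = ennreal (2 * exp (1 / 8) * q ^ k) * emeasure ?L (ball_Rd d)"
      by (simp only: mult.assoc[symmetric])
  qed
  also have "\<dots> = ennreal (\<Sum>k\<le>d. 2 * exp (1 / 8) * q ^ k) * emeasure ?L (ball_Rd d)"
    using q by (simp only: sum_distrib_right[symmetric]) (subst sum_ennreal, auto)
  also have "ennreal (\<Sum>k\<le>d. 2 * exp (1 / 8) * q ^ k) * emeasure ?L (ball_Rd d) \<le> ennreal sphere_const * emeasure ?L (ball_Rd d)"
  proof (intro mult_right_mono ennreal_leI)
    have "(\<Sum>k\<le>d. q ^ k) = (1 - q ^ Suc d) / (1 - q)" using q by (subst sum_gp0) simp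
    also have "\<dots> \<le> 1 / (1 - q)" using q by (intro divide_right_mono) auto
    finally have "2 * exp (1 / 8) * (\<Sum>k\<le>d. q ^ k) \<le> 2 * exp (1 / 8) * (1 / (1 - q))"
      by (intro mult_left_mono) auto
    then show "(\<Sum>k\<le>d. 2 * exp (1 / 8) * q ^ k) \<le> sphere_const"
      by (simp add: sphere_const_def q_def sum_distrib_left)
  qed simp
  finally have *: "(\<integral>\<^sup>+x. ennreal (exp (1 / 8 * g (pr x))) * indicator (pball_Rd d) x \<partial>?L)
     \<le> ennreal sphere_const * emeasure ?L (pball_Rd d)"
    unfolding emeasure_ball(3)[OF d] .
  have "(\<integral>\<^sup>+u. ennreal (exp (1 / 8 * g u)) \<partial>sphere_uniform d)
     = (\<integral>\<^sup>+x. ennreal (exp (1 / 8 * g (pr x))) * indicator (pball_Rd d) x \<partial>?L) / emeasure ?L (pball_Rd d)"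
    unfolding pr_def using g_meas by (intro nn_integral_sphere_uniform) measurable
  also have "\<dots> \<le> ennreal sphere_const * emeasure ?L (pball_Rd d) / emeasure ?L (pball_Rd d)"
    by (intro divide_right_mono_ennreal *)
  also have "\<dots> = ennreal sphere_const"
    using emeasure_ball(1,2)[OF d] by (simp add: ennreal_mult_divide_eq)
  finally show ?thesis by (simp add: g_def)
qed

section \<open>Matrices\<close>

lemma index_mat_mult_vec:
  assumes "v \<in> carrier_vec d" "i < d"
  shows "(Matrix.mat d d (\<lambda>(i, j). S i j) *\<^sub>v v) $ i = (\<Sum>j<d. S i j * v $ j)"
  using assms by (simp add: scalar_prod_def lessThan_atLeast0)

text \<open>Stated over a commutative semiring because it is applied to real quadratic forms and
  also to a Hermitian form with complex entries.\<close>

lemma gram_form: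
  fixes B :: "nat \<Rightarrow> nat \<Rightarrow> 'a :: comm_semiring_1" and d :: nat
  assumes "\<And>i j. i < d \<Longrightarrow> j < d \<Longrightarrow> (\<Sum>k<d. B i k * B j k) = S i j"
  shows "(\<Sum>i<d. a i * (\<Sum>j<d. S i j * b j)) = (\<Sum>k<d. (\<Sum>i<d. B i k * a i) * (\<Sum>j<d. B j k * b j))"
proof -
  have "(\<Sum>i<d. a i * (\<Sum>j<d. S i j * b j)) = (\<Sum>i<d. \<Sum>j<d. \<Sum>k<d. (B i k * a i) * (B j k * b j))"
    using assms by (simp add: sum_distrib_left sum_distrib_right mult_ac flip: assms)
  also have "\<dots> = (\<Sum>i<d. \<Sum>k<d. \<Sum>j<d. (B i k * a i) * (B j k * b j))"
    by (intro sum.cong refl sum.swap)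
  also have "\<dots> = (\<Sum>k<d. \<Sum>i<d. \<Sum>j<d. (B i k * a i) * (B j k * b j))" by (rule sum.swap)
  also have "\<dots> = (\<Sum>k<d. (\<Sum>i<d. B i k * a i) * (\<Sum>j<d. B j k * b j))" by (simp add: sum_product)
  finally show ?thesis .
qed

text \<open>\<open>Max\<close> says nothing about an empty set, so a real eigenvalue has to be
  exhibited. A complex one exists, and its Rayleigh quotient is a sum of squares divided by a sum of
  squares, hence real.\<close>

lemma lambda_max_nonneg:
  assumes "d > 0" and S: "\<And>i j. i < d \<Longrightarrow> j < d \<Longrightarrow> (\<Sum>k<d. B i k * B j k) = S i j"
  shows "0 \<le> lambda_max d S"
proof -
  define A where "A = Matrix.mat d d (\<lambda>(i, j). S i j)"
  have A: "A \<in> carrier_mat d d" by (simp add: A_def)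
  have fin: "finite {k. eigenvalue A k}"
  proof -
    have "char_poly A \<noteq> 0" using degree_monic_char_poly[OF A] by auto
    then have "finite {k. poly (char_poly A) k = 0}" by (rule poly_roots_finite)
    then show ?thesis by (simp add: eigenvalue_root_char_poly[OF A])
  qed
  have nonneg: "k \<ge> 0" if k: "eigenvalue A k" for k
  proof -
    obtain v where v: "v \<in> carrier_vec d" "v \<noteq> 0\<^sub>v d" "A *\<^sub>v v = k \<cdot>\<^sub>v v"
      using k A unfolding eigenvalue_def eigenvector_def by auto
    have "(\<Sum>j<d. S i j * v $ j) = k * v $ i" if "i < d" for i
      unfolding index_mat_mult_vec[OF v(1) that, of S, symmetric] v(3)[unfolded A_def] using v(1) that by simp
    then have "k * (\<Sum>i<d. v $ i * v $ i) = (\<Sum>i<d. v $ i * (\<Sum>j<d. S i j * v $ j))"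
      by (simp add: sum_distrib_left mult_ac)
    also have "\<dots> = (\<Sum>k<d. (\<Sum>i<d. B i k * v $ i) * (\<Sum>j<d. B j k * v $ j))"
      by (rule gram_form[OF S])
    also have "\<dots> \<ge> 0" by (intro sum_nonneg) auto
    finally have 1: "k * (\<Sum>i<d. v $ i * v $ i) \<ge> 0" .
    have "\<exists>i<d. v $ i \<noteq> 0" using v(1,2) by (auto simp: vec_eq_iff)
    then have "(\<Sum>i<d. v $ i * v $ i) > 0" by (auto intro!: sum_pos2 simp: zero_less_mult_iff linorder_neq_iff)
    then show ?thesis using 1 by (simp add: zero_le_mult_iff)
  qed
  have ne: "{k. eigenvalue A k} \<noteq> {}"
  proof -
    define Ac where "Ac = map_mat complex_of_real A"
    have Ac: "Ac \<in> carrier_mat d d" using A by (simp add: Ac_def)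
    have Ac_mat: "Ac = Matrix.mat d d (\<lambda>(i, j). complex_of_real (S i j))"
      by (rule eq_matI) (auto simp: Ac_def A_def)
    obtain z where z: "eigenvalue Ac z" using spectrum_non_empty[OF Ac assms(1)] by (auto simp: spectrum_def)
    obtain v where v: "v \<in> carrier_vec d" "v \<noteq> 0\<^sub>v d" "Ac *\<^sub>v v = z \<cdot>\<^sub>v v"
      using z Ac unfolding eigenvalue_def eigenvector_def by auto
    have e: "(\<Sum>j<d. of_real (S i j) * v $ j) = z * v $ i" if "i < d" for i
      unfolding index_mat_mult_vec[OF v(1) that, of "\<lambda>i j. complex_of_real (S i j)", symmetric] v(3)[unfolded Ac_mat]
      using v(1) that by simp
    define n where "n = (\<Sum>i<d. (cmod (v $ i))\<^sup>2)"
    define r0 where "r0 = (\<Sum>k<d. (cmod (\<Sum>j<d. of_real (B j k) * v $ j))\<^sup>2)"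
    have "\<exists>i<d. v $ i \<noteq> 0" using v(1,2) by (auto simp: vec_eq_iff)
    then have n: "n > 0" unfolding n_def by (auto intro!: sum_pos2)
    have Sc: "(\<Sum>k<d. complex_of_real (B i k) * complex_of_real (B j k)) = complex_of_real (S i j)" if "i < d" "j < d" for i j
      by (simp flip: S[OF that])
    have "z * of_real n = (\<Sum>i<d. cnj (v $ i) * (\<Sum>j<d. of_real (S i j) * v $ j))"
    proof -
      have "cnj (v $ i) * (\<Sum>j<d. of_real (S i j) * v $ j) = z * of_real ((cmod (v $ i))\<^sup>2)" if "i < d" for i
        unfolding e[OF that] complex_norm_square by (simp add: mult_ac)
      then show ?thesis by (simp add: n_def sum_distrib_left)
    qed
    also have "\<dots> = (\<Sum>k<d. (\<Sum>i<d. of_real (B i k) * cnj (v $ i)) * (\<Sum>j<d. of_real (B j k) * v $ j))"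
      by (rule gram_form[OF Sc])
    also have "\<dots> = (\<Sum>k<d. of_real ((cmod (\<Sum>j<d. of_real (B j k) * v $ j))\<^sup>2))"
      by (intro sum.cong refl) (simp only: complex_norm_square, simp add: mult.commute)
    also have "\<dots> = of_real (\<Sum>k<d. (cmod (\<Sum>j<d. of_real (B j k) * v $ j))\<^sup>2)" by (rule of_real_sum[symmetric])
    finally have "z * of_real n = of_real r0" unfolding r0_def .
    then have zr: "z = complex_of_real (r0 / n)" using n by (simp add: field_simps)
    \<comment> \<open>The characteristic polynomial of the complexified matrix is the image of the
      real one, so the real number \<open>r0 / n\<close> is a root of the real polynomial.\<close>
    have "poly (char_poly Ac) z = 0" using z by (simp add: eigenvalue_root_char_poly[OF Ac])
    then have "poly (map_poly complex_of_real (char_poly A)) (complex_of_real (r0 / n)) = 0"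
      unfolding Ac_def of_real_hom.char_poly_hom[OF A] zr .
    then have "complex_of_real (poly (char_poly A) (r0 / n)) = 0" by (simp only: of_real_hom.poly_map_poly)
    then have "eigenvalue A (r0 / n)" by (simp add: eigenvalue_root_char_poly[OF A])
    then show ?thesis by blast
  qed
  show ?thesis unfolding lambda_max_def A_def[symmetric]
    using fin ne nonneg by (subst Max_ge_iff) auto
qed

text \<open>Injectivity makes the determinant nonzero, and the preimage is written down with the
  adjugate matrix.\<close>

lemma transpose_surj:
  fixes B :: "nat \<Rightarrow> nat \<Rightarrow> real"
  assumes "\<And>w. (\<And>k. k < d \<Longrightarrow> (\<Sum>i<d. B i k * w i) = 0) \<Longrightarrow> (\<And>i. i < d \<Longrightarrow> w i = 0)"
  shows "\<exists>w. \<forall>k<d. (\<Sum>i<d. B i k * w i) = u k"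
proof -
  define M where "M = Matrix.mat d d (\<lambda>(k, i). B i k)"
  have M: "M \<in> carrier_mat d d" by (simp add: M_def)
  have "det M \<noteq> 0"
  proof
    assume "det M = 0"
    then obtain v where v: "v \<in> carrier_vec d" "v \<noteq> 0\<^sub>v d" "M *\<^sub>v v = 0\<^sub>v d"
      using det_0_iff_vec_prod_zero[OF M] by auto
    have "(\<Sum>i<d. B i k * v $ i) = 0" if "k < d" for k
      unfolding index_mat_mult_vec[OF v(1) that, of "\<lambda>k i. B i k", symmetric] v(3)[unfolded M_def] using that by simp
    then have "\<And>i. i < d \<Longrightarrow> v $ i = 0" by (rule assms)
    then show False using v(1,2) by (auto simp: vec_eq_iff)
  qed
  define x where "x = vec d u"
  define v where "v = (1 / det M) \<cdot>\<^sub>v (adj_mat M *\<^sub>v x)"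
  have x: "x \<in> carrier_vec d" by (simp add: x_def)
  have v: "v \<in> carrier_vec d" 
    using mult_mat_vec_carrier[OF adj_mat(1)[OF M] x] by (simp only: v_def smult_carrier_vec)
  have "M *\<^sub>v v = (1 / det M) \<cdot>\<^sub>v (M *\<^sub>v (adj_mat M *\<^sub>v x))"
    unfolding v_def using M adj_mat(1)[OF M] x by (intro mult_mat_vec) auto
  also have "M *\<^sub>v (adj_mat M *\<^sub>v x) = (M * adj_mat M) *\<^sub>v x"
    using M adj_mat(1)[OF M] x by (intro assoc_mult_mat_vec[symmetric]) auto
  also have "\<dots> = det M \<cdot>\<^sub>v x" unfolding adj_mat(2)[OF M] using x
    by (intro eq_vecI) auto
  finally have Mv: "M *\<^sub>v v = x" using \<open>det M \<noteq> 0\<close> by (simp add: smult_smult_assoc)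
  have "(\<Sum>i<d. B i k * v $ i) = u k" if "k < d" for k
    unfolding index_mat_mult_vec[OF v that, of "\<lambda>k i. B i k", symmetric] Mv[unfolded M_def] using that by (simp add: x_def)
  then show ?thesis by blast
qed

text \<open>A lower bound for the transpose passes to \<open>B\<close> by duality. With
  \<open>u\<close> the image of \<open>w\<close> under the transpose, the squared norm of
  \<open>u\<close> is the inner product of \<open>w\<close> with \<open>B u\<close>, and the norm of
  \<open>w\<close> is at most that of \<open>u\<close> over \<open>sqrt \<kappa>\<close>.\<close>

lemma matvec_lower_bound:
  fixes B :: "nat \<Rightarrow> nat \<Rightarrow> real"
  assumes "\<kappa> > 0" and low: "\<And>w. \<kappa> * (norm2 d w)\<^sup>2 \<le> (norm2 d (\<lambda>k. \<Sum>i<d. B i k * w i))\<^sup>2"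
  shows "sqrt \<kappa> * norm2 d u \<le> norm2 d (matvec d B u)"
proof -
  have "\<exists>w. \<forall>k<d. (\<Sum>i<d. B i k * w i) = u k"
  proof (rule transpose_surj)
    fix w :: "nat \<Rightarrow> real" and i
    assume "\<And>k. k < d \<Longrightarrow> (\<Sum>i<d. B i k * w i) = 0" and i: "i < d"
    then have "(norm2 d (\<lambda>k. \<Sum>i<d. B i k * w i))\<^sup>2 = 0" by (simp add: norm2_sq)
    then have "\<kappa> * (norm2 d w)\<^sup>2 \<le> 0" using low[of w] by simp
    then have "(\<Sum>i<d. (w i)\<^sup>2) \<le> 0" using assms(1) by (simp add: mult_le_0_iff norm2_sq)
    then have "(\<Sum>i<d. (w i)\<^sup>2) = 0" by (simp add: antisym sum_nonneg)
    then show "w i = 0" using i by (simp add: sum_nonneg_eq_0_iff)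
  qed
  then obtain w where w: "\<And>k. k < d \<Longrightarrow> (\<Sum>i<d. B i k * w i) = u k" by blast
  have nw: "norm2 d (\<lambda>k. \<Sum>i<d. B i k * w i) = norm2 d u" by (rule norm2_cong) (rule w)
  have "sqrt \<kappa> * norm2 d w \<le> norm2 d u"
  proof (rule power2_le_imp_le)
    show "(sqrt \<kappa> * norm2 d w)\<^sup>2 \<le> (norm2 d u)\<^sup>2"
      using low[of w] assms(1) by (simp add: nw power_mult_distrib)
  qed (rule norm2_nonneg)
  have "(norm2 d u)\<^sup>2 = (\<Sum>k<d. u k * (\<Sum>i<d. B i k * w i))"
    unfolding norm2_sq using w by (simp add: power2_eq_square)
  also have "\<dots> = (\<Sum>i<d. w i * (\<Sum>k<d. B i k * u k))"
    by (simp add: sum_distrib_left mult_ac) (rule sum.swap)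
  also have "\<dots> = dotp d w (matvec d B u)" by (simp add: dotp_def matvec_def)
  also have "\<dots> \<le> norm2 d w * norm2 d (matvec d B u)" using dotp_le_norm2[of d w "matvec d B u"] by simp
  finally have "sqrt \<kappa> * (norm2 d u)\<^sup>2 \<le> (sqrt \<kappa> * norm2 d w) * norm2 d (matvec d B u)"
    using assms(1) by (simp add: mult.assoc)
  also have "\<dots> \<le> norm2 d u * norm2 d (matvec d B u)"
    using \<open>sqrt \<kappa> * norm2 d w \<le> norm2 d u\<close> by (intro mult_right_mono norm2_nonneg)
  finally have *: "norm2 d u * (sqrt \<kappa> * norm2 d u) \<le> norm2 d u * norm2 d (matvec d B u)"
    by (simp add: power2_eq_square mult_ac)
  show ?thesis
  proof (cases "norm2 d u = 0")
    case False
    then have "norm2 d u > 0" using norm2_nonneg[of d u] by simp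
    then show ?thesis using * by simp
  qed (simp add: norm2_nonneg)
qed

section \<open>The elliptical model\<close>

lemma AE_sphere_norm2: "AE u in sphere_uniform d. norm2 d u = 1"
  unfolding sphere_uniform_def
proof (rule AE_distr_iff[THEN iffD2])
  show "(\<lambda>v. \<lambda>i\<in>{..<d}. v i / norm2 d v) \<in> uniform_measure (lborel_Rd {..<d}) (pball_Rd d) \<rightarrow>\<^sub>M borel_Rd d"
    unfolding meas_uniform_lborel_Rd by (rule normalize_measurable)
  show "{x \<in> space (borel_Rd d). norm2 d x = 1} \<in> sets (borel_Rd d)"
    using measurable_norm2[of d, measurable] by measurable
  have "norm2 d (\<lambda>i\<in>{..<d}. v i / norm2 d v) = 1" if "norm2 d v > 0" for v
    using that norm2_scale[of d "1 / norm2 d v" v] by (subst norm2_cong[where y = "\<lambda>i. 1 / norm2 d v * v i"]) auto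
  then show "AE v in uniform_measure (lborel_Rd {..<d}) (pball_Rd d). norm2 d (\<lambda>i\<in>{..<d}. v i / norm2 d v) = 1"
    by (intro AE_uniform_measureI ball_sets AE_I2) auto
qed

text \<open>The normalisation of \<open>\<theta>\<close> is expressed through the transpose of
  \<open>B\<close> instead of the square root of the covariance, since linear forms of the design
  are inner products of \<open>U\<close> with images under this transpose;
  \<open>psd_sqrt_norm\<close> links the two.\<close>

locale elliptical_model =
  fixes d :: nat and P :: "(nat \<Rightarrow> real) measure" and R :: "real measure" and f :: "real \<times> real \<Rightarrow> real"
    and \<theta> :: "nat \<Rightarrow> real" and Mu :: "real measure" and B :: "nat \<Rightarrow> nat \<Rightarrow> real" and q \<nu> \<nu>q \<kappa> :: real
  assumes d_pos: "d > 0"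
    and model: "single_index_model d P R f \<theta>" and ell: "elliptical d P Mu B"
    and mom: "moment_assumptions d P R f \<theta> q \<nu> \<nu>q \<kappa>"
    and \<nu>_pos: "\<nu> > 0" and \<nu>q_pos: "\<nu>q > 0" and \<kappa>_pos: "\<kappa> > 0" and q_gt: "q > 4"
    and Bt_\<theta>: "norm2 d (\<lambda>k. \<Sum>i<d. B i k * \<theta> i) = 1"
begin

definition Bt :: "(nat \<Rightarrow> real) \<Rightarrow> nat \<Rightarrow> real" where
  "Bt v k = (\<Sum>i<d. B i k * v i)"

definition ellip :: "real \<times> (nat \<Rightarrow> real) \<Rightarrow> nat \<Rightarrow> real" where
  "ellip = (\<lambda>(m, u). \<lambda>i\<in>{..<d}. m * matvec d B u i)"

definition Y :: "(nat \<Rightarrow> real) \<times> real \<Rightarrow> real" where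
  "Y = response d f \<theta>"

sublocale P: prob_space P using model by (simp add: single_index_model_def)
sublocale R: prob_space R using model by (simp add: single_index_model_def)
sublocale Mu: prob_space Mu using ell by (simp add: elliptical_def)
sublocale S: prob_space "sphere_uniform d" by (rule prob_space_sphere_uniform[OF d_pos])
sublocale PR: pair_prob_space P R by standard

lemma sets_P: "sets P = sets (borel_Rd d)"
  using model by (simp add: single_index_model_def)

lemma sets_Mu: "sets Mu = sets borel"
  using ell by (simp add: elliptical_def)

lemma meas_P: "measurable P N = measurable (borel_Rd d) N"
  by (intro measurable_cong_sets sets_P refl)

lemma Y_meas [measurable]: "Y \<in> borel_measurable (P \<Otimes>\<^sub>M R)"
  using model by (simp add: single_index_model_def Y_def)

lemma dotp_meas [measurable]: "(\<lambda>x. dotp d x v) \<in> borel_measurable P"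
  unfolding meas_P by (rule measurable_dotp)

lemma coord_meas: "j < d \<Longrightarrow> (\<lambda>x. x j) \<in> borel_measurable P"
  unfolding meas_P by measurable

lemma norm2_meas [measurable]: "norm2 d \<in> borel_measurable P"
  unfolding meas_P by (rule measurable_norm2)

lemma ellip_meas: "ellip \<in> Mu \<Otimes>\<^sub>M sphere_uniform d \<rightarrow>\<^sub>M borel_Rd d"
proof -
  have "sets (Mu \<Otimes>\<^sub>M sphere_uniform d) = sets (borel \<Otimes>\<^sub>M borel_Rd d)"
    by (intro sets_pair_measure_cong sets_Mu sets_sphere_uniform)
  then have "measurable (Mu \<Otimes>\<^sub>M sphere_uniform d) (borel_Rd d) = measurable (borel \<Otimes>\<^sub>M borel_Rd d) (borel_Rd d)"
    by (intro measurable_cong_sets) auto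
  moreover have "ellip \<in> borel \<Otimes>\<^sub>M borel_Rd d \<rightarrow>\<^sub>M borel_Rd d"
    unfolding ellip_def matvec_def split_beta' by (intro measurable_restrict) auto
  ultimately show ?thesis by simp
qed

lemma P_eq: "P = distr (Mu \<Otimes>\<^sub>M sphere_uniform d) (borel_Rd d) ellip"
  using ell by (simp add: elliptical_def ellip_def)

lemma nn_integral_P:
  assumes g: "g \<in> borel_measurable (borel_Rd d)"
  shows "(\<integral>\<^sup>+x. g x \<partial>P) = (\<integral>\<^sup>+m. (\<integral>\<^sup>+u. g (ellip (m, u)) \<partial>sphere_uniform d) \<partial>Mu)"
proof -
  have "(\<integral>\<^sup>+x. g x \<partial>P) = (\<integral>\<^sup>+z. g (ellip z) \<partial>(Mu \<Otimes>\<^sub>M sphere_uniform d))"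
    unfolding P_eq using ellip_meas g by (intro nn_integral_distr) auto
  also have "\<dots> = (\<integral>\<^sup>+m. (\<integral>\<^sup>+u. g (ellip (m, u)) \<partial>sphere_uniform d) \<partial>Mu)"
    using measurable_compose[OF ellip_meas g] by (intro S.nn_integral_fst[symmetric])
  finally show ?thesis .
qed

lemma BBt: "i < d \<Longrightarrow> j < d \<Longrightarrow> (\<Sum>k<d. B i k * B j k) = second_moment P i j"
  using ell by (simp add: elliptical_def)

lemma Bt_add_scale: "Bt (\<lambda>i. v i + r * w i) = (\<lambda>k. Bt v k + r * Bt w k)"
  by (simp add: Bt_def fun_eq_iff algebra_simps sum.distrib sum_distrib_left)

lemma Bt_scale: "Bt (\<lambda>i. r * w i) = (\<lambda>k. r * Bt w k)"
  by (simp add: Bt_def fun_eq_iff algebra_simps sum_distrib_left)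

lemma dotp_Bt: "dotp d u (Bt w) = dotp d (matvec d B u) w"
proof -
  have "dotp d u (Bt w) = (\<Sum>k<d. \<Sum>i<d. B i k * u k * w i)"
    by (simp add: dotp_def Bt_def sum_distrib_left mult_ac)
  also have "\<dots> = (\<Sum>i<d. \<Sum>k<d. B i k * u k * w i)" by (rule sum.swap)
  also have "\<dots> = dotp d (matvec d B u) w"
    by (simp add: dotp_def matvec_def sum_distrib_right)
  finally show ?thesis .
qed

lemma dotp_ellip: "dotp d (ellip (m, u)) w = m * dotp d u (Bt w)"
  unfolding dotp_Bt by (simp add: dotp_def ellip_def sum_distrib_left mult_ac)

section \<open>Moments of linear forms\<close>

lemma fourth_moment_unit:
  assumes "v \<in> unit_sphere d"
  shows "(\<integral>\<^sup>+x. ennreal (\<bar>dotp d x v\<bar> ^ 4) \<partial>P) \<le> ennreal \<nu>"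
proof -
  have "(\<integral>\<^sup>+x. ennreal (\<bar>dotp d x v\<bar> ^ 4) \<partial>P) \<le> (SUP v\<in>unit_sphere d. \<integral>\<^sup>+x. ennreal (\<bar>dotp d x v\<bar> ^ 4) \<partial>P)"
    by (rule SUP_upper[OF assms])
  also have "\<dots> \<le> ennreal \<nu>" using mom by (simp add: moment_assumptions_def)
  finally show ?thesis .
qed

lemma second_moment_unit:
  assumes "v \<in> unit_sphere d"
  shows "ennreal \<kappa> \<le> (\<integral>\<^sup>+x. ennreal (\<bar>dotp d x v\<bar> ^ 2) \<partial>P)"
proof -
  have "ennreal \<kappa> \<le> (INF v\<in>unit_sphere d. \<integral>\<^sup>+x. ennreal (\<bar>dotp d x v\<bar> ^ 2) \<partial>P)"
    using mom by (simp add: moment_assumptions_def)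
  also have "\<dots> \<le> (\<integral>\<^sup>+x. ennreal (\<bar>dotp d x v\<bar> ^ 2) \<partial>P)" by (rule INF_lower[OF assms])
  finally show ?thesis .
qed

lemma normalize_unit_sphere:
  assumes "norm2 d u > 0"
  obtains v where "v \<in> unit_sphere d" "\<And>x. dotp d x u = norm2 d u * dotp d x v"
proof
  define v where "v = (\<lambda>i\<in>{..<d}. 1 / norm2 d u * u i)"
  have "norm2 d v = norm2 d (\<lambda>i. 1 / norm2 d u * u i)" by (rule norm2_cong) (simp add: v_def)
  also have "\<dots> = 1" using assms by (simp only: norm2_scale) simp
  finally show "v \<in> unit_sphere d" by (simp add: unit_sphere_def v_def Rd_def)
  show "dotp d x u = norm2 d u * dotp d x v" for x
    using assms by (simp add: dotp_def v_def sum_distrib_left)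
qed

lemma dotp_zero:
  assumes "norm2 d u = 0"
  shows "dotp d x u = 0"
  using dotp_le_norm2[of d x u] assms by simp

lemma fourth_moment:
  shows "integrable P (\<lambda>x. (dotp d x u) ^ 4)" and "(LINT x|P. (dotp d x u) ^ 4) \<le> \<nu> * (norm2 d u) ^ 4"
proof -
  have "integrable P (\<lambda>x. (dotp d x u) ^ 4) \<and> (LINT x|P. (dotp d x u) ^ 4) \<le> \<nu> * (norm2 d u) ^ 4"
  proof (cases "norm2 d u = 0")
    case True
    then show ?thesis by (simp add: dotp_zero)
  next
    case False
    then have n: "norm2 d u > 0" using norm2_nonneg[of d u] by simp
    obtain v where v: "v \<in> unit_sphere d" "\<And>x. dotp d x u = norm2 d u * dotp d x v"
      using normalize_unit_sphere[OF n] by blast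
    have b: "(\<integral>\<^sup>+x. ennreal ((dotp d x v) ^ 4) \<partial>P) \<le> ennreal \<nu>"
      using fourth_moment_unit[OF v(1)] by simp
    then have i: "integrable P (\<lambda>x. (dotp d x v) ^ 4)"
      by (intro integrableI_nonneg) (auto intro: le_less_trans)
    have "ennreal (LINT x|P. (dotp d x v) ^ 4) \<le> ennreal \<nu>"
      using b i by (subst nn_integral_eq_integral[symmetric]) auto
    then have "(LINT x|P. (dotp d x v) ^ 4) \<le> \<nu>" using \<nu>_pos by (simp add: ennreal_le_iff)
    then have "(LINT x|P. (dotp d x u) ^ 4) \<le> \<nu> * (norm2 d u) ^ 4"
      using n by (simp add: v(2) power_mult_distrib mult.commute)
    then show ?thesis using i by (simp add: v(2) power_mult_distrib)
  qed
  then show "integrable P (\<lambda>x. (dotp d x u) ^ 4)" "(LINT x|P. (dotp d x u) ^ 4) \<le> \<nu> * (norm2 d u) ^ 4" by auto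
qed

lemma sq_le_fourth: "a\<^sup>2 \<le> 1 + a ^ 4" for a :: real
proof -
  have "0 \<le> (a\<^sup>2 - 1)\<^sup>2 + a\<^sup>2" by simp
  then have "2 * a\<^sup>2 \<le> 1 + (a\<^sup>2)\<^sup>2 + a\<^sup>2" by (simp add: power2_diff)
  then show ?thesis by (simp flip: power_mult)
qed

lemma integrable_dotp_sq: "integrable P (\<lambda>x. (dotp d x u)\<^sup>2)"
  by (rule Bochner_Integration.integrable_bound[of P "\<lambda>x. 1 + (dotp d x u) ^ 4"])
    (use fourth_moment(1)[of u] sq_le_fourth in auto)

lemma second_moment_lower: "\<kappa> * (norm2 d u)\<^sup>2 \<le> (LINT x|P. (dotp d x u)\<^sup>2)"
proof (cases "norm2 d u = 0")
  case True
  then show ?thesis by (simp add: dotp_zero)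
next
  case False
  then have n: "norm2 d u > 0" using norm2_nonneg[of d u] by simp
  obtain v where v: "v \<in> unit_sphere d" "\<And>x. dotp d x u = norm2 d u * dotp d x v"
    using normalize_unit_sphere[OF n] by blast
  have "ennreal \<kappa> \<le> (\<integral>\<^sup>+x. ennreal ((dotp d x v)\<^sup>2) \<partial>P)" using second_moment_unit[OF v(1)] by simp
  also have "\<dots> = ennreal (LINT x|P. (dotp d x v)\<^sup>2)"
    by (intro nn_integral_eq_integral integrable_dotp_sq) auto
  finally have "\<kappa> \<le> (LINT x|P. (dotp d x v)\<^sup>2)" by (simp add: ennreal_le_iff)
  then have "\<kappa> * (norm2 d u)\<^sup>2 \<le> (LINT x|P. (dotp d x v)\<^sup>2) * (norm2 d u)\<^sup>2" by (intro mult_right_mono) auto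
  then show ?thesis by (simp add: v(2) power_mult_distrib mult.commute)
qed

lemma dotp_unit: "j < d \<Longrightarrow> dotp d x (coord_vec j) = x j"
  by (simp add: dotp_def sum_unit)

lemma norm2_unit: "j < d \<Longrightarrow> norm2 d (coord_vec j) = 1"
proof -
  assume "j < d"
  then have "(norm2 d (coord_vec j))\<^sup>2 = 1\<^sup>2" by (simp add: dotp_self[symmetric] dotp_unit) (simp add: coord_vec_def)
  then show ?thesis using norm2_nonneg by (simp only: power2_eq_iff_nonneg zero_le_one)
qed

lemma integrable_coord_mult:
  assumes "i < d" "j < d"
  shows "integrable P (\<lambda>x. x i * x j)"
proof (rule Bochner_Integration.integrable_bound[of P "\<lambda>x. (dotp d x (coord_vec i))\<^sup>2 + (dotp d x (coord_vec j))\<^sup>2"])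
  show "integrable P (\<lambda>x. (dotp d x (coord_vec i))\<^sup>2 + (dotp d x (coord_vec j))\<^sup>2)"
    by (intro Bochner_Integration.integrable_add integrable_dotp_sq)
  show "(\<lambda>x. x i * x j) \<in> borel_measurable P" using coord_meas assms by (intro borel_measurable_times) auto
  show "AE x in P. norm (x i * x j) \<le> norm ((dotp d x (coord_vec i))\<^sup>2 + (dotp d x (coord_vec j))\<^sup>2)"
  proof (intro AE_I2)
    fix x :: "nat \<Rightarrow> real"
    have "0 \<le> (\<bar>x i\<bar> - \<bar>x j\<bar>)\<^sup>2 + (x i)\<^sup>2 + (x j)\<^sup>2" by simp
    then have "\<bar>x i\<bar> * \<bar>x j\<bar> \<le> (x i)\<^sup>2 + (x j)\<^sup>2" by (simp add: power2_diff)
    then show "norm (x i * x j) \<le> norm ((dotp d x (coord_vec i))\<^sup>2 + (dotp d x (coord_vec j))\<^sup>2)"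
      using assms by (simp add: dotp_unit abs_mult)
  qed
qed

lemma expectation_dotp_mult: "(LINT x|P. dotp d x u * dotp d x w) = dotp d (Bt u) (Bt w)"
proof -
  have "(LINT x|P. dotp d x u * dotp d x w) = (LINT x|P. (\<Sum>i<d. \<Sum>j<d. u i * w j * (x i * x j)))"
    by (intro Bochner_Integration.integral_cong refl) (simp add: dotp_def sum_product mult_ac)
  also have "\<dots> = (\<Sum>i<d. \<Sum>j<d. u i * w j * second_moment P i j)"
  proof -
    have "(LINT x|P. (\<Sum>i<d. \<Sum>j<d. u i * w j * (x i * x j))) = (\<Sum>i<d. LINT x|P. (\<Sum>j<d. u i * w j * (x i * x j)))"
      by (intro Bochner_Integration.integral_sum Bochner_Integration.integrable_sum integrable_mult_right integrable_coord_mult) auto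
    also have "\<dots> = (\<Sum>i<d. \<Sum>j<d. LINT x|P. u i * w j * (x i * x j))"
      by (intro sum.cong refl Bochner_Integration.integral_sum integrable_mult_right integrable_coord_mult) auto
    finally show ?thesis by (simp add: second_moment_def)
  qed
  also have "\<dots> = (\<Sum>i<d. u i * (\<Sum>j<d. second_moment P i j * w j))"
    by (simp add: sum_distrib_left mult_ac)
  also have "\<dots> = dotp d (Bt u) (Bt w)"
    unfolding dotp_def Bt_def by (rule gram_form[OF BBt])
  finally show ?thesis .
qed

lemma Bt_norm_sq: "(norm2 d (Bt u))\<^sup>2 = (LINT x|P. (dotp d x u)\<^sup>2)"
  using expectation_dotp_mult[of u u] by (simp add: dotp_self power2_eq_square)

lemma Bt_lower: "\<kappa> * (norm2 d u)\<^sup>2 \<le> (norm2 d (Bt u))\<^sup>2"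
  unfolding Bt_norm_sq by (rule second_moment_lower)

lemma B_lower: "sqrt \<kappa> * norm2 d u \<le> norm2 d (matvec d B u)"
  using Bt_lower by (intro matvec_lower_bound \<kappa>_pos) (simp add: Bt_def[abs_def])

text \<open>Passing from the second moment to the fourth by \<open>sq_le_fourth\<close> keeps the
  bound free of \<open>d\<close>. It fixes the common sub-Gaussian rate of the coordinates.\<close>

lemma Bt_unit_le: "j < d \<Longrightarrow> (norm2 d (Bt (coord_vec j)))\<^sup>2 \<le> 1 + \<nu>"
proof -
  assume j: "j < d"
  have "(LINT x|P. (dotp d x (coord_vec j))\<^sup>2) \<le> (LINT x|P. 1 + (dotp d x (coord_vec j)) ^ 4)"
    using integrable_dotp_sq fourth_moment(1) sq_le_fourth by (intro integral_mono) auto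
  also have "\<dots> = 1 + (LINT x|P. (dotp d x (coord_vec j)) ^ 4)"
    using fourth_moment(1) by (simp add: P.prob_space)
  also have "\<dots> \<le> 1 + \<nu>" using fourth_moment(2)[of "coord_vec j"] by (simp add: norm2_unit[OF j])
  finally show ?thesis by (simp add: Bt_norm_sq)
qed

text \<open>The angular factor of a linear form: the scalar radius cancels up to its sign. At the
  origin division by zero gives 0, which is consistent with the factorisation
  \<open>dotp_eq_D_G\<close>.\<close>

definition G :: "(nat \<Rightarrow> real) \<Rightarrow> (nat \<Rightarrow> real) \<Rightarrow> real" where
  "G v x = sqrt d * dotp d x v / norm2 d x"

lemma G_meas [measurable]: "G v \<in> borel_measurable P"
  unfolding G_def[abs_def] by measurable

text \<open>After cancellation of \<open>m\<close>, the square of \<open>G v\<close> is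
  \<open>d\<close> times the squared projection of \<open>u\<close> on \<open>Bt v\<close>, divided
  by the squared norm of \<open>B u\<close>. By \<open>B_lower\<close> the denominator is at least
  \<kappa>, which leaves the uniform law on the sphere with rate \<open>1 / 8\<close>.\<close>

lemma subgaussian:
  assumes "c > 0" "c * (norm2 d (Bt v))\<^sup>2 \<le> \<kappa> / 8"
  shows "(\<integral>\<^sup>+x. ennreal (exp (c * (G v x)\<^sup>2)) \<partial>P) \<le> ennreal sphere_const"
proof -
  define b where "b = Bt v"
  \<comment> \<open>If \<open>Bt v\<close> vanishes then so does the projection on it, and any unit
    vector can stand for its direction.\<close>
  define b' where "b' = (if norm2 d b = 0 then coord_vec 0 else (\<lambda>i. 1 / norm2 d b * b i))"
  have b': "norm2 d b' = 1" 
  proof (cases "norm2 d b = 0")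
    case False
    then show ?thesis using norm2_scale[of d "1 / norm2 d b" b] norm2_nonneg[of d b] by (simp add: b'_def)
  qed (simp add: b'_def norm2_unit d_pos)
  have bb': "(dotp d u b)\<^sup>2 = (norm2 d b)\<^sup>2 * (dotp d u b')\<^sup>2" for u
  proof (cases "norm2 d b = 0")
    case True
    then show ?thesis by (simp add: dotp_zero)
  next
    case False
    then have "dotp d u b' = dotp d u b / norm2 d b" by (simp add: b'_def dotp_def sum_divide_distrib)
    then show ?thesis using False by (simp add: power_divide)
  qed
  have pw: "c * (G v (ellip (m, u)))\<^sup>2 \<le> 1 / 8 * (d * (dotp d u b')\<^sup>2)" if u: "norm2 d u = 1" for m u
  proof (cases "m = 0")
    case True
    then show ?thesis by (simp add: G_def dotp_ellip)
  next
    case False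
    have "norm2 d (ellip (m, u)) = norm2 d (\<lambda>i. m * matvec d B u i)"
      by (rule norm2_cong) (simp add: ellip_def)
    then have n: "norm2 d (ellip (m, u)) = \<bar>m\<bar> * norm2 d (matvec d B u)" by (simp only: norm2_scale)
    have "sqrt \<kappa> \<le> norm2 d (matvec d B u)" using B_lower[of u] u by simp
    then have "(sqrt \<kappa>)\<^sup>2 \<le> (norm2 d (matvec d B u))\<^sup>2" using \<kappa>_pos by (intro power_mono) auto
    then have low: "\<kappa> \<le> (norm2 d (matvec d B u))\<^sup>2" using \<kappa>_pos by simp
    have "(G v (ellip (m, u)))\<^sup>2 = d * (dotp d u b)\<^sup>2 / (norm2 d (matvec d B u))\<^sup>2"
      using False by (simp add: G_def dotp_ellip n b_def power_divide power_mult_distrib)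
    also have "\<dots> \<le> d * (dotp d u b)\<^sup>2 / \<kappa>"
      using low \<kappa>_pos by (intro divide_left_mono mult_pos_pos less_le_trans[OF \<kappa>_pos low]) auto
    finally have "c * (G v (ellip (m, u)))\<^sup>2 \<le> c * (d * (dotp d u b)\<^sup>2 / \<kappa>)" using assms by (intro mult_left_mono) auto
    also have "\<dots> = (c * (norm2 d b)\<^sup>2) * (d * (dotp d u b')\<^sup>2 / \<kappa>)" by (simp add: bb')
    also have "\<dots> \<le> \<kappa> / 8 * (d * (dotp d u b')\<^sup>2 / \<kappa>)"
      using assms \<kappa>_pos unfolding b_def by (intro mult_right_mono) auto
    also have "\<dots> = 1 / 8 * (d * (dotp d u b')\<^sup>2)" using \<kappa>_pos by simp
    finally show ?thesis .
  qed
  have "(\<integral>\<^sup>+x. ennreal (exp (c * (G v x)\<^sup>2)) \<partial>P)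
     = (\<integral>\<^sup>+m. (\<integral>\<^sup>+u. ennreal (exp (c * (G v (ellip (m, u)))\<^sup>2)) \<partial>sphere_uniform d) \<partial>Mu)"
  proof (rule nn_integral_P)
    have "G v \<in> borel_measurable (borel_Rd d)" using G_meas[of v] by (simp add: meas_P)
    then show "(\<lambda>x. ennreal (exp (c * (G v x)\<^sup>2))) \<in> borel_measurable (borel_Rd d)" by measurable
  qed
  also have "\<dots> \<le> (\<integral>\<^sup>+m. (\<integral>\<^sup>+u. ennreal (exp (1 / 8 * (d * (dotp d u b')\<^sup>2))) \<partial>sphere_uniform d) \<partial>Mu)"
  proof (rule nn_integral_mono, rule nn_integral_mono_AE)
    fix m
    show "AE u in sphere_uniform d. ennreal (exp (c * (G v (ellip (m, u)))\<^sup>2)) \<le> ennreal (exp (1 / 8 * (d * (dotp d u b')\<^sup>2)))"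
      using AE_sphere_norm2[of d]
    proof eventually_elim
      case (elim u)
      show ?case by (intro ennreal_leI) (simp only: exp_le_cancel_iff pw[OF elim])
    qed
  qed
  also have "\<dots> \<le> (\<integral>\<^sup>+m. ennreal sphere_const \<partial>Mu)"
    by (intro nn_integral_mono sphere_subgaussian b')
  also have "\<dots> = ennreal sphere_const" by (simp add: Mu.emeasure_space_1)
  finally show ?thesis .
qed

section \<open>Reflection symmetry of the design\<close>

definition mirror :: "(nat \<Rightarrow> real) \<Rightarrow> (nat \<Rightarrow> real) \<Rightarrow> nat \<Rightarrow> real" where
  "mirror w x = (\<lambda>i\<in>{..<d}. x i - 2 * dotp d x w * matvec d B (Bt w) i)"

text \<open>\<open>mirror w\<close> is the reflection of \<open>u\<close> along \<open>Bt w\<close>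
  carried over by \<open>B\<close>. Since the inner product of \<open>u\<close> with
  \<open>Bt w\<close> is that of \<open>B u\<close> with \<open>w\<close>, it can be written in
  terms of the design vector without inverting \<open>B\<close>.\<close>

lemma mirror_ellip: "mirror w (ellip (m, u)) = ellip (m, reflect d (Bt w) u)"
proof -
  have "matvec d B (reflect d (Bt w) u) i = matvec d B u i - 2 * dotp d u (Bt w) * matvec d B (Bt w) i" if "i < d" for i
    using that by (simp add: matvec_def reflect_def right_diff_distrib sum_subtractf sum_distrib_left mult_ac)
  moreover have "ellip (m, u) i = m * matvec d B u i" if "i < d" for i m u using that by (simp add: ellip_def)
  ultimately show ?thesis
    unfolding mirror_def dotp_ellip by (simp add: ellip_def fun_eq_iff) (simp add: right_diff_distrib mult_ac)
qed

lemma mirror_meas: "mirror w \<in> borel_Rd d \<rightarrow>\<^sub>M borel_Rd d"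
  unfolding mirror_def[abs_def] using measurable_dotp[of d w, measurable]
  by (intro measurable_restrict) measurable

lemma distr_mirror:
  assumes "norm2 d (Bt w) = 1"
  shows "distr P P (mirror w) = P"
proof (rule measure_eqI)
  have T: "mirror w \<in> P \<rightarrow>\<^sub>M P"
    using mirror_meas[of w] by (subst measurable_cong_sets[OF sets_P sets_P])
  fix A assume "A \<in> sets (distr P P (mirror w))"
  then have A: "A \<in> sets P" by simp
  then have ind: "indicator A \<in> borel_measurable (borel_Rd d)" by (simp add: sets_P)
  have "emeasure (distr P P (mirror w)) A = (\<integral>\<^sup>+x. indicator A x \<partial>distr P P (mirror w))"
    using A by simp
  also have "\<dots> = (\<integral>\<^sup>+x. indicator A (mirror w x) \<partial>P)"
    using T A by (intro nn_integral_distr) auto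
  also have "\<dots> = (\<integral>\<^sup>+m. (\<integral>\<^sup>+u. indicator A (ellip (m, reflect d (Bt w) u)) \<partial>sphere_uniform d) \<partial>Mu)"
    using measurable_compose[OF mirror_meas ind] by (subst nn_integral_P) (auto simp: mirror_ellip)
  also have "\<dots> = (\<integral>\<^sup>+m. (\<integral>\<^sup>+u. indicator A (ellip (m, u)) \<partial>sphere_uniform d) \<partial>Mu)"
  proof (rule nn_integral_cong)
    fix m
    have "(\<lambda>u. ellip (m, u)) \<in> borel_Rd d \<rightarrow>\<^sub>M borel_Rd d"
      unfolding ellip_def matvec_def split_beta' by (intro measurable_restrict) auto
    then show "(\<integral>\<^sup>+u. indicator A (ellip (m, reflect d (Bt w) u)) \<partial>sphere_uniform d)
        = (\<integral>\<^sup>+u. indicator A (ellip (m, u)) \<partial>sphere_uniform d)"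
      using measurable_compose[OF _ ind] by (intro nn_integral_sphere_reflect[OF assms]) blast
  qed
  also have "\<dots> = (\<integral>\<^sup>+x. indicator A x \<partial>P)" by (rule nn_integral_P[OF ind, symmetric])
  also have "\<dots> = emeasure P A" using A by simp
  finally show "emeasure (distr P P (mirror w)) A = emeasure P A" .
qed simp

lemma dotp_mirror: "dotp d (mirror w x) v = dotp d x v - 2 * dotp d x w * dotp d (Bt w) (Bt v)"
proof -
  have "dotp d (mirror w x) v = dotp d (\<lambda>i. x i + (- 2 * dotp d x w) * matvec d B (Bt w) i) v"
    by (rule dotp_cong) (auto simp: mirror_def)
  also have "\<dots> = dotp d x v - 2 * dotp d x w * dotp d (matvec d B (Bt w)) v"
    unfolding dotp_add_scale by simp
  finally show ?thesis by (simp only: dotp_Bt)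
qed

lemma dotp_fst_meas [measurable]: "(\<lambda>z. dotp d (fst z) w) \<in> borel_measurable (P \<Otimes>\<^sub>M R)"
  by (rule measurable_compose[OF measurable_fst dotp_meas])

text \<open>The map \<open>mirror w\<close> keeps the law of the design. By orthogonality it fixes
  the index and hence the response, while it changes the sign of the linear form in
  \<open>w\<close>. The expectation therefore equals its own negative.\<close>

lemma expectation_orthogonal_unit:
  assumes "norm2 d (Bt w) = 1" "dotp d (Bt w) (Bt \<theta>) = 0"
  shows "(LINT z|(P \<Otimes>\<^sub>M R). Y z * dotp d (fst z) w) = 0"
proof -
  define T where "T = (\<lambda>(x, \<xi>). (mirror w x, \<xi> :: real))"
  have T1: "mirror w \<in> P \<rightarrow>\<^sub>M P"
    using mirror_meas[of w] by (subst measurable_cong_sets[OF sets_P sets_P])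
  have "sigma_finite_measure (distr R R (\<lambda>x. x))"
    by (intro prob_space_imp_sigma_finite R.prob_space_distr) simp
  then have "distr P P (mirror w) \<Otimes>\<^sub>M distr R R (\<lambda>x. x) = distr (P \<Otimes>\<^sub>M R) (P \<Otimes>\<^sub>M R) T"
    unfolding T_def using T1 by (intro pair_measure_distr) auto
  then have D: "distr (P \<Otimes>\<^sub>M R) (P \<Otimes>\<^sub>M R) T = P \<Otimes>\<^sub>M R"
    by (simp add: distr_mirror[OF assms(1)] distr_id)
  have T: "T \<in> P \<Otimes>\<^sub>M R \<rightarrow>\<^sub>M P \<Otimes>\<^sub>M R" unfolding T_def using T1 by measurable
  have YT: "Y (T z) = Y z" for z
    by (simp add: T_def Y_def response_def split_beta' dotp_mirror assms(2))
  have wT: "dotp d (fst (T z)) w = - dotp d (fst z) w" for z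
    by (simp add: T_def split_beta' dotp_mirror dotp_self[of d "Bt w"] assms(1))
  have "(LINT z|(P \<Otimes>\<^sub>M R). Y z * dotp d (fst z) w) = (LINT z|distr (P \<Otimes>\<^sub>M R) (P \<Otimes>\<^sub>M R) T. Y z * dotp d (fst z) w)"
    by (simp add: D)
  also have "\<dots> = (LINT z|(P \<Otimes>\<^sub>M R). Y (T z) * dotp d (fst (T z)) w)"
    using T dotp_fst_meas by (intro integral_distr borel_measurable_times Y_meas)
  also have "\<dots> = - (LINT z|(P \<Otimes>\<^sub>M R). Y z * dotp d (fst z) w)" by (simp add: YT wT)
  finally show ?thesis by simp
qed

lemma expectation_orthogonal:
  assumes "dotp d (Bt w) (Bt \<theta>) = 0"
  shows "(LINT z|(P \<Otimes>\<^sub>M R). Y z * dotp d (fst z) w) = 0"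
proof (cases "norm2 d (Bt w) = 0")
  case True
  then have "\<kappa> * (norm2 d w)\<^sup>2 \<le> 0" using Bt_lower[of w] by simp
  then have "norm2 d w = 0" using \<kappa>_pos by (simp add: mult_le_0_iff)
  then show ?thesis by (simp add: dotp_zero)
next
  case False
  define r where "r = 1 / norm2 d (Bt w)"
  have r: "r > 0" using False norm2_nonneg[of d "Bt w"] by (simp add: r_def)
  have sc: "dotp d x (\<lambda>i. r * w i) = r * dotp d x w" for x by (simp add: dotp_def sum_distrib_left mult_ac)
  have "(LINT z|(P \<Otimes>\<^sub>M R). Y z * dotp d (fst z) (\<lambda>i. r * w i)) = 0"
  proof (rule expectation_orthogonal_unit)
    show "norm2 d (Bt (\<lambda>i. r * w i)) = 1" using False r by (simp add: Bt_scale norm2_scale) (simp add: r_def)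
    have "dotp d (Bt (\<lambda>i. r * w i)) (Bt \<theta>) = r * dotp d (Bt w) (Bt \<theta>)"
      by (simp add: Bt_scale dotp_def sum_distrib_left mult_ac)
    then show "dotp d (Bt (\<lambda>i. r * w i)) (Bt \<theta>) = 0" using assms by simp
  qed
  then have "r * (LINT z|(P \<Otimes>\<^sub>M R). Y z * dotp d (fst z) w) = 0"
    by (simp add: sc mult.left_commute)
  then show ?thesis using r by simp
qed

lemma Bt_\<theta>_unit: "norm2 d (Bt \<theta>) = 1"
  using Bt_\<theta> by (simp add: Bt_def[abs_def])

section \<open>Marginals and second moments of the response\<close>

lemma PR_fst_integrable: "integrable P g \<Longrightarrow> integrable (P \<Otimes>\<^sub>M R) (\<lambda>z. g (fst z))"
  and PR_fst_nn: "h \<in> borel_measurable P \<Longrightarrow> (\<integral>\<^sup>+z. h (fst z) \<partial>(P \<Otimes>\<^sub>M R)) = (\<integral>\<^sup>+x. h x \<partial>P)"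
  and PR_fst_integral: "g \<in> borel_measurable P \<Longrightarrow> (LINT z|(P \<Otimes>\<^sub>M R). g (fst z)) = (LINT x|P. g x)"
  for g :: "(nat \<Rightarrow> real) \<Rightarrow> real" and h :: "(nat \<Rightarrow> real) \<Rightarrow> ennreal"
proof -
  have D: "distr (P \<Otimes>\<^sub>M R) P fst = P"
    by (rule R.distr_pair_fst)
  show "integrable (P \<Otimes>\<^sub>M R) (\<lambda>z. g (fst z))" if "integrable P g"
    using that integrable_distr[of fst "P \<Otimes>\<^sub>M R" P g] D by simp
  show "(\<integral>\<^sup>+z. h (fst z) \<partial>(P \<Otimes>\<^sub>M R)) = (\<integral>\<^sup>+x. h x \<partial>P)" if "h \<in> borel_measurable P"
    using that nn_integral_distr[of fst "P \<Otimes>\<^sub>M R" P h] D by simp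
  show "(LINT z|(P \<Otimes>\<^sub>M R). g (fst z)) = (LINT x|P. g x)" if "g \<in> borel_measurable P"
    using that integral_distr[of fst "P \<Otimes>\<^sub>M R" P g] D by simp
qed

lemma Y_moment: "(\<integral>\<^sup>+z. ennreal (\<bar>Y z\<bar> powr q) \<partial>(P \<Otimes>\<^sub>M R)) \<le> ennreal (\<nu>q powr q)"
  and coord_moment: "j < d \<Longrightarrow> (\<integral>\<^sup>+x. ennreal (\<bar>x j\<bar> powr q) \<partial>P) \<le> ennreal (\<nu>q powr q)"
proof -
  have *: "(\<integral>\<^sup>+z. ennreal (\<bar>g z\<bar> powr q) \<partial>M) \<le> ennreal (\<nu>q powr q)" if "Lq_norm_le M q g \<nu>q" for M :: "'z measure" and g
  proof -
    have i: "integrable M (\<lambda>z. \<bar>g z\<bar> powr q)" "(LINT z|M. \<bar>g z\<bar> powr q) powr (1 / q) \<le> \<nu>q"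
      using that by (auto simp: Lq_norm_le_def)
    have "((LINT z|M. \<bar>g z\<bar> powr q) powr (1 / q)) powr q \<le> \<nu>q powr q"
      using i(2) q_gt by (intro powr_mono2) auto
    then have "(LINT z|M. \<bar>g z\<bar> powr q) \<le> \<nu>q powr q"
      using q_gt by (simp add: powr_powr integral_nonneg)
    then show ?thesis using i(1) by (subst nn_integral_eq_integral) (auto intro: ennreal_leI)
  qed
  show "(\<integral>\<^sup>+z. ennreal (\<bar>Y z\<bar> powr q) \<partial>(P \<Otimes>\<^sub>M R)) \<le> ennreal (\<nu>q powr q)"
    using mom by (intro *) (simp add: moment_assumptions_def Y_def)
  show "(\<integral>\<^sup>+x. ennreal (\<bar>x j\<bar> powr q) \<partial>P) \<le> ennreal (\<nu>q powr q)" if "j < d"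
    using mom that by (intro *) (simp add: moment_assumptions_def)
qed

lemma sq_le_powr_q: "a\<^sup>2 \<le> 1 + \<bar>a\<bar> powr q" for a :: real
proof (cases "\<bar>a\<bar> \<le> 1")
  case True
  then have "a\<^sup>2 \<le> 1" by (simp add: abs_square_le_1)
  then show ?thesis using powr_ge_zero[of "\<bar>a\<bar>" q] by linarith
next
  case False
  then have "\<bar>a\<bar> powr 2 \<le> \<bar>a\<bar> powr q" using q_gt by (intro powr_mono) auto
  then show ?thesis using False by simp
qed

lemma integrable_Y_sq: "integrable (P \<Otimes>\<^sub>M R) (\<lambda>z. (Y z)\<^sup>2)"
  and Y_sq_le: "(LINT z|(P \<Otimes>\<^sub>M R). (Y z)\<^sup>2) \<le> 1 + \<nu>q powr q"
proof -
  have i: "integrable (P \<Otimes>\<^sub>M R) (\<lambda>z. \<bar>Y z\<bar> powr q)"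
    using le_less_trans[OF Y_moment] by (intro integrableI_nonneg) auto
  show 2: "integrable (P \<Otimes>\<^sub>M R) (\<lambda>z. (Y z)\<^sup>2)"
    by (rule Bochner_Integration.integrable_bound[of _ "\<lambda>z. 1 + \<bar>Y z\<bar> powr q"]) (use i sq_le_powr_q in auto)
  have "ennreal (LINT z|(P \<Otimes>\<^sub>M R). \<bar>Y z\<bar> powr q) \<le> ennreal (\<nu>q powr q)"
    using Y_moment i by (subst nn_integral_eq_integral[symmetric]) auto
  then have "(LINT z|(P \<Otimes>\<^sub>M R). \<bar>Y z\<bar> powr q) \<le> \<nu>q powr q" by (simp add: ennreal_le_iff)
  moreover have "(LINT z|(P \<Otimes>\<^sub>M R). (Y z)\<^sup>2) \<le> (LINT z|(P \<Otimes>\<^sub>M R). 1 + \<bar>Y z\<bar> powr q)"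
    using i 2 sq_le_powr_q by (intro integral_mono) auto
  moreover have "(LINT z|(P \<Otimes>\<^sub>M R). 1 + \<bar>Y z\<bar> powr q) = 1 + (LINT z|(P \<Otimes>\<^sub>M R). \<bar>Y z\<bar> powr q)"
    using i by (simp add: PR.prob_space)
  ultimately show "(LINT z|(P \<Otimes>\<^sub>M R). (Y z)\<^sup>2) \<le> 1 + \<nu>q powr q" by linarith
qed

lemma abs_mult_le_squares: "\<bar>a * b\<bar> \<le> a\<^sup>2 + b\<^sup>2" for a b :: real
proof -
  have "0 \<le> (\<bar>a\<bar> - \<bar>b\<bar>)\<^sup>2 + a\<^sup>2 + b\<^sup>2" by simp
  then show ?thesis by (simp add: power2_diff abs_mult)
qed

lemma integrable_Y_dotp: "integrable (P \<Otimes>\<^sub>M R) (\<lambda>z. Y z * dotp d (fst z) w)"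
  by (rule Bochner_Integration.integrable_bound[of _ "\<lambda>z. (Y z)\<^sup>2 + (dotp d (fst z) w)\<^sup>2"])
    (use integrable_Y_sq PR_fst_integrable[OF integrable_dotp_sq[of w]] abs_mult_le_squares in auto)

definition eta0 :: real where "eta0 = eta d P R f \<theta>"

lemma eta0_eq: "eta0 = (LINT z|(P \<Otimes>\<^sub>M R). Y z * dotp d (fst z) \<theta>)"
  by (simp add: eta0_def eta_def Y_def)

text \<open>The constants of the theorem may not involve the model, so \<eta> has to be bounded by
  the given parameters. The normalisation gives the index second moment 1.\<close>

lemma abs_eta0_le: "\<bar>eta0\<bar> \<le> 2 + \<nu>q powr q"
proof -
  have "\<bar>eta0\<bar> \<le> (LINT z|(P \<Otimes>\<^sub>M R). \<bar>Y z * dotp d (fst z) \<theta>\<bar>)"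
    unfolding eta0_eq by (rule integral_abs_bound)
  also have "\<dots> \<le> (LINT z|(P \<Otimes>\<^sub>M R). (Y z)\<^sup>2 + (dotp d (fst z) \<theta>)\<^sup>2)"
    using integrable_Y_sq PR_fst_integrable[OF integrable_dotp_sq[of \<theta>]] integrable_Y_dotp[of \<theta>] abs_mult_le_squares
    by (intro integral_mono) auto
  also have "\<dots> = (LINT z|(P \<Otimes>\<^sub>M R). (Y z)\<^sup>2) + (LINT x|P. (dotp d x \<theta>)\<^sup>2)"
    using integrable_Y_sq PR_fst_integrable[OF integrable_dotp_sq[of \<theta>]] PR_fst_integral[of "\<lambda>x. (dotp d x \<theta>)\<^sup>2"] by simp
  also have "\<dots> \<le> 2 + \<nu>q powr q" using Y_sq_le Bt_norm_sq[of \<theta>] by (simp add: Bt_\<theta>_unit)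
  finally show ?thesis .
qed

text \<open>Reflecting \<open>U\<close> orthogonally to the direction of the index shows that the response is
  uncorrelated with every linear form that is uncorrelated with the index.\<close>

lemma population_gradient_zero:
  "(LINT z|(P \<Otimes>\<^sub>M R). (Y z - eta0 * dotp d (fst z) \<theta>) * dotp d (fst z) v) = 0"
proof -
  define a where "a = dotp d (Bt v) (Bt \<theta>)"
  \<comment> \<open>Subtracts the projection of \<open>Bt v\<close> on the unit vector
    \<open>Bt \<theta>\<close>, so that \<open>Bt w\<close> is orthogonal to
    \<open>Bt \<theta>\<close>.\<close>
  define w where "w = (\<lambda>i. v i + (- a) * \<theta> i)"
  have "dotp d (Bt w) (Bt \<theta>) = 0"
    unfolding w_def Bt_add_scale dotp_add_scale by (simp add: a_def dotp_self[of d "Bt \<theta>"] Bt_\<theta>_unit)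
  then have "0 = (LINT z|(P \<Otimes>\<^sub>M R). Y z * dotp d (fst z) w)" by (rule expectation_orthogonal[symmetric])
  also have "\<dots> = (LINT z|(P \<Otimes>\<^sub>M R). Y z * dotp d (fst z) v - a * (Y z * dotp d (fst z) \<theta>))"
  proof (intro Bochner_Integration.integral_cong refl)
    fix z :: "(nat \<Rightarrow> real) \<times> real"
    have e: "dotp d (fst z) w = dotp d (fst z) v + (- a) * dotp d (fst z) \<theta>"
      unfolding w_def by (rule dotp_add_scale(2))
    show "Y z * dotp d (fst z) w = Y z * dotp d (fst z) v - a * (Y z * dotp d (fst z) \<theta>)"
      unfolding e by (simp add: algebra_simps)
  qed
  also have "\<dots> = (LINT z|(P \<Otimes>\<^sub>M R). Y z * dotp d (fst z) v) - a * eta0"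
    using integrable_Y_dotp by (simp add: eta0_eq)
  finally have 1: "(LINT z|(P \<Otimes>\<^sub>M R). Y z * dotp d (fst z) v) = a * eta0" by simp
  have iP: "integrable P (\<lambda>x. dotp d x \<theta> * dotp d x v)"
    by (rule Bochner_Integration.integrable_bound[of _ "\<lambda>x. (dotp d x \<theta>)\<^sup>2 + (dotp d x v)\<^sup>2"])
      (use integrable_dotp_sq abs_mult_le_squares in auto)
  have 2: "(LINT z|(P \<Otimes>\<^sub>M R). dotp d (fst z) \<theta> * dotp d (fst z) v) = a"
    using PR_fst_integral[of "\<lambda>x. dotp d x \<theta> * dotp d x v"] expectation_dotp_mult[of \<theta> v]
    by (simp add: a_def dotp_commute[of d "Bt v"])
  have "(LINT z|(P \<Otimes>\<^sub>M R). (Y z - eta0 * dotp d (fst z) \<theta>) * dotp d (fst z) v)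
     = (LINT z|(P \<Otimes>\<^sub>M R). Y z * dotp d (fst z) v - eta0 * (dotp d (fst z) \<theta> * dotp d (fst z) v))"
    by (intro Bochner_Integration.integral_cong refl) (simp add: algebra_simps)
  also have "\<dots> = a * eta0 - eta0 * a"
    using integrable_Y_dotp[of v] PR_fst_integrable[OF iP] 1 2 by simp
  finally show ?thesis by simp
qed

end

section \<open>Truncated design\<close>

text \<open>\<open>1 + \<nu>\<close> bounds the squared norm of \<open>Bt\<close> at every
  coordinate vector and also at \<open>\<theta>\<close>, where it is 1. One rate therefore serves
  the coordinates and the index.\<close>

definition subg_rate :: "real \<Rightarrow> real \<Rightarrow> real" where
  "subg_rate \<nu> \<kappa> = \<kappa> / (8 * (1 + \<nu>))"

text \<open>A bound on the moment of order \<open>q\<close> of \<open>env\<close>. The powers of 2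
  come from splitting the power of a sum twice, for \<open>env\<close> and for the radius.\<close>

definition env_const :: "real \<Rightarrow> real \<Rightarrow> real" where
  "env_const q \<nu>q = 2 powr q * (\<nu>q powr q + 2 powr q * (1 + \<nu>q powr q))"

context elliptical_model
begin

definition D :: "(nat \<Rightarrow> real) \<Rightarrow> real" where
  "D x = norm2 d x / sqrt d"

text \<open>An envelope for both truncated quantities; when it is at most the truncation level,
  neither the response nor the radius is altered.\<close>

definition env :: "(nat \<Rightarrow> real) \<times> real \<Rightarrow> real" where
  "env z = \<bar>Y z\<bar> + D (fst z)"

abbreviation csub :: real where "csub \<equiv> subg_rate \<nu> \<kappa>"
abbreviation Cenv :: real where "Cenv \<equiv> env_const q \<nu>q"

lemma D_nonneg: "0 \<le> D x"
  by (simp add: D_def norm2_nonneg)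

lemma env_nonneg: "0 \<le> env z"
  by (simp add: env_def D_nonneg)

lemma D_meas [measurable]: "D \<in> borel_measurable P"
  unfolding D_def[abs_def] by measurable

lemma D_fst_meas [measurable]: "(\<lambda>z. D (fst z)) \<in> borel_measurable (P \<Otimes>\<^sub>M R)"
  by (rule measurable_compose[OF measurable_fst D_meas])

lemma G_fst_meas [measurable]: "(\<lambda>z. G v (fst z)) \<in> borel_measurable (P \<Otimes>\<^sub>M R)"
  by (rule measurable_compose[OF measurable_fst G_meas])

lemma env_meas [measurable]: "env \<in> borel_measurable (P \<Otimes>\<^sub>M R)"
  unfolding env_def[abs_def] by measurable

lemma dotp_eq_D_G: "dotp d x v = D x * G v x"
  using dotp_zero[of x v] dotp_commute[of d x v] d_pos by (cases "norm2 d x = 0") (auto simp: D_def G_def)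

lemma dotp_trunc_vec: "dotp d (trunc_vec d \<tau> x) v = min (D x) \<tau> * G v x"
proof -
  have "dotp d (trunc_vec d \<tau> x) v = (\<Sum>i<d. (sqrt d / norm2 d x * min (norm2 d x / sqrt d) \<tau>) * (x i * v i))"
    unfolding dotp_def trunc_vec_def by (intro sum.cong) auto
  also have "\<dots> = (sqrt d / norm2 d x * min (norm2 d x / sqrt d) \<tau>) * dotp d x v"
    by (simp add: dotp_def sum_distrib_left)
  finally show ?thesis by (simp add: D_def G_def)
qed

lemma csub_pos: "csub > 0"
  using \<kappa>_pos \<nu>_pos by (simp add: subg_rate_def)

lemma csub_mult: "csub * (1 + \<nu>) = \<kappa> / 8"
proof -
  have "a / b * b = a" if "b \<noteq> 0" for a b :: real using that by simp
  moreover have "1 + \<nu> \<noteq> 0" using \<nu>_pos by simp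
  ultimately show ?thesis unfolding subg_rate_def divide_divide_eq_left[symmetric] by blast
qed

lemma subgaussian_coord:
  assumes "j < d"
  shows "(\<integral>\<^sup>+x. ennreal (exp (csub * (G (coord_vec j) x)\<^sup>2)) \<partial>P) \<le> ennreal sphere_const"
proof (rule subgaussian[OF csub_pos])
  have "csub * (norm2 d (Bt (coord_vec j)))\<^sup>2 \<le> csub * (1 + \<nu>)"
    using Bt_unit_le[OF assms] csub_pos by (intro mult_left_mono) auto
  also have "\<dots> = \<kappa> / 8" by (rule csub_mult)
  finally show "csub * (norm2 d (Bt (coord_vec j)))\<^sup>2 \<le> \<kappa> / 8" .
qed

lemma subgaussian_index: "(\<integral>\<^sup>+x. ennreal (exp (csub * (G \<theta> x)\<^sup>2)) \<partial>P) \<le> ennreal sphere_const"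
proof (rule subgaussian[OF csub_pos])
  have "csub * 1 \<le> csub * (1 + \<nu>)" using csub_pos \<nu>_pos by (intro mult_left_mono) auto
  also have "\<dots> = \<kappa> / 8" by (rule csub_mult)
  finally show "csub * (norm2 d (Bt \<theta>))\<^sup>2 \<le> \<kappa> / 8" by (simp add: Bt_\<theta>_unit)
qed

lemma powr_add_le: "(a + b) powr q \<le> 2 powr q * (a powr q + b powr q)" if "0 \<le> a" "0 \<le> b" for a b :: real
proof -
  have "(a + b) powr q \<le> (2 * max a b) powr q" using that q_gt by (intro powr_mono2) auto
  also have "\<dots> = 2 powr q * max a b powr q" using that by (simp add: powr_mult)
  also have "max a b powr q \<le> a powr q + b powr q" by (simp add: max_def)
  finally show ?thesis by simp
qed

text \<open>Jensen's inequality for the power \<open>q / 2\<close> applied to the average of the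
  squared coordinates. Adding 1 to each square keeps the points inside the open half-line on which
  convexity is available.\<close>

lemma D_powr_le: "D x powr q \<le> 1 / d * (\<Sum>j<d. 2 powr q * (1 + \<bar>x j\<bar> powr q))"
proof -
  have conv: "convex_on {0<..} (\<lambda>x. x powr (q / 2))" using q_gt by (intro powr_convex) simp
  have "D x powr q = (D x powr 2) powr (q / 2)" by (simp add: powr_powr)
  also have "D x powr 2 = (\<Sum>j<d. 1 / d * (x j)\<^sup>2)"
    using d_pos D_nonneg[of x] by (simp add: D_def power_divide norm2_sq norm2_nonneg flip: sum_divide_distrib)
  also have "(\<Sum>j<d. 1 / d * (x j)\<^sup>2) powr (q / 2) \<le> (\<Sum>j<d. (1 / d) *\<^sub>R (1 + (x j)\<^sup>2)) powr (q / 2)"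
    using q_gt by (intro powr_mono2 sum_mono) (auto intro!: sum_nonneg divide_right_mono)
  also have "\<dots> \<le> (\<Sum>j<d. 1 / d * (1 + (x j)\<^sup>2) powr (q / 2))"
    using d_pos by (intro convex_on_sum[OF _ _ conv]) (auto intro: add_pos_nonneg)
  also have "\<dots> \<le> (\<Sum>j<d. 1 / d * (2 powr q * (1 + \<bar>x j\<bar> powr q)))"
  proof (intro sum_mono mult_left_mono)
    fix j
    have "1 + (x j)\<^sup>2 \<le> (1 + \<bar>x j\<bar>)\<^sup>2" by (simp add: power2_sum)
    then have "(1 + (x j)\<^sup>2) powr (q / 2) \<le> ((1 + \<bar>x j\<bar>)\<^sup>2) powr (q / 2)"
      using q_gt by (intro powr_mono2) auto
    also have "\<dots> = (1 + \<bar>x j\<bar>) powr q" using powr_powr[of "1 + \<bar>x j\<bar>" 2 "q / 2"] by simp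
    also have "\<dots> \<le> 2 powr q * (1 + \<bar>x j\<bar> powr q)" using powr_add_le[of 1 "\<bar>x j\<bar>"] by simp
    finally show "(1 + (x j)\<^sup>2) powr (q / 2) \<le> 2 powr q * (1 + \<bar>x j\<bar> powr q)" .
  qed auto
  also have "\<dots> = 1 / d * (\<Sum>j<d. 2 powr q * (1 + \<bar>x j\<bar> powr q))" by (simp add: sum_distrib_left)
  finally show ?thesis .
qed

lemma D_moment: "(\<integral>\<^sup>+x. ennreal (D x powr q) \<partial>P) \<le> ennreal (2 powr q * (1 + \<nu>q powr q))"
proof -
  have cm: "(\<lambda>x. ennreal (\<bar>x j\<bar> powr q)) \<in> borel_measurable P" if "j < d" for j
    using coord_meas[OF that] by measurable
  have e: "ennreal (1 / d * 2 powr q * (1 + b)) = ennreal (1 / d * 2 powr q) * (1 + ennreal b)" if "b \<ge> 0" for b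
  proof -
    have "ennreal (1 / d * 2 powr q * (1 + b)) = ennreal (1 / d * 2 powr q) * ennreal (1 + b)"
      using that by (intro ennreal_mult) auto
    then show ?thesis using that by (simp only: ennreal_plus zero_le_one ennreal_1)
  qed
  have "(\<integral>\<^sup>+x. ennreal (D x powr q) \<partial>P) \<le> (\<integral>\<^sup>+x. (\<Sum>j<d. ennreal (1 / d * 2 powr q) * (1 + ennreal (\<bar>x j\<bar> powr q))) \<partial>P)"
  proof (intro nn_integral_mono)
    fix x
    have "ennreal (D x powr q) \<le> ennreal (\<Sum>j<d. 1 / d * 2 powr q * (1 + \<bar>x j\<bar> powr q))"
      using D_powr_le[of x] by (intro ennreal_leI) (simp add: sum_distrib_left mult.assoc)
    also have "\<dots> = (\<Sum>j<d. ennreal (1 / d * 2 powr q * (1 + \<bar>x j\<bar> powr q)))"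
      by (rule sum_ennreal[symmetric]) auto
    also have "\<dots> = (\<Sum>j<d. ennreal (1 / d * 2 powr q) * (1 + ennreal (\<bar>x j\<bar> powr q)))"
      by (intro sum.cong refl e) auto
    finally show "ennreal (D x powr q) \<le> (\<Sum>j<d. ennreal (1 / d * 2 powr q) * (1 + ennreal (\<bar>x j\<bar> powr q)))" .
  qed
  also have "\<dots> = (\<Sum>j<d. ennreal (1 / d * 2 powr q) * (1 + (\<integral>\<^sup>+x. ennreal (\<bar>x j\<bar> powr q) \<partial>P)))"
    using cm by (subst nn_integral_sum) (auto simp: nn_integral_cmult nn_integral_add P.emeasure_space_1 intro!: sum.cong)
  also have "\<dots> \<le> (\<Sum>j<d. ennreal (1 / d * 2 powr q) * (1 + ennreal (\<nu>q powr q)))"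
    by (intro sum_mono mult_left_mono add_left_mono coord_moment) auto
  also have "\<dots> = (\<Sum>j<d. ennreal (1 / d * 2 powr q * (1 + \<nu>q powr q)))"
    by (intro sum.cong refl e[symmetric]) auto
  also have "\<dots> = ennreal (\<Sum>j<d. 1 / d * 2 powr q * (1 + \<nu>q powr q))"
    by (rule sum_ennreal) auto
  also have "(\<Sum>j<d. 1 / d * 2 powr q * (1 + \<nu>q powr q)) = 2 powr q * (1 + \<nu>q powr q)" using d_pos by simp
  finally show ?thesis .
qed

lemma env_moment: "(\<integral>\<^sup>+z. ennreal (env z powr q) \<partial>(P \<Otimes>\<^sub>M R)) \<le> ennreal Cenv"
proof -
  have "(\<integral>\<^sup>+z. ennreal (env z powr q) \<partial>(P \<Otimes>\<^sub>M R))
     \<le> (\<integral>\<^sup>+z. ennreal (2 powr q) * (ennreal (\<bar>Y z\<bar> powr q) + ennreal (D (fst z) powr q)) \<partial>(P \<Otimes>\<^sub>M R))"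
  proof (intro nn_integral_mono)
    fix z
    have "ennreal (env z powr q) \<le> ennreal (2 powr q * (\<bar>Y z\<bar> powr q + D (fst z) powr q))"
      unfolding env_def using D_nonneg by (intro ennreal_leI powr_add_le) auto
    then show "ennreal (env z powr q) \<le> ennreal (2 powr q) * (ennreal (\<bar>Y z\<bar> powr q) + ennreal (D (fst z) powr q))"
      by (simp add: ennreal_mult)
  qed
  also have "\<dots> = ennreal (2 powr q) * ((\<integral>\<^sup>+z. ennreal (\<bar>Y z\<bar> powr q) \<partial>(P \<Otimes>\<^sub>M R)) + (\<integral>\<^sup>+z. ennreal (D (fst z) powr q) \<partial>(P \<Otimes>\<^sub>M R)))"
    by (subst nn_integral_cmult) (auto simp: nn_integral_add)
  also have "(\<integral>\<^sup>+z. ennreal (D (fst z) powr q) \<partial>(P \<Otimes>\<^sub>M R)) = (\<integral>\<^sup>+x. ennreal (D x powr q) \<partial>P)"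
    by (rule PR_fst_nn) measurable
  also have "ennreal (2 powr q) * ((\<integral>\<^sup>+z. ennreal (\<bar>Y z\<bar> powr q) \<partial>(P \<Otimes>\<^sub>M R)) + (\<integral>\<^sup>+x. ennreal (D x powr q) \<partial>P))
     \<le> ennreal (2 powr q) * (ennreal (\<nu>q powr q) + ennreal (2 powr q * (1 + \<nu>q powr q)))"
    by (intro mult_left_mono add_mono Y_moment D_moment) auto
  also have "\<dots> = ennreal Cenv" unfolding env_const_def
    by (subst ennreal_mult) (auto intro!: add_nonneg_nonneg mult_nonneg_nonneg simp flip: ennreal_plus)
  finally show ?thesis .
qed

text \<open>Young's inequality separates the envelope from the Gaussian weight without independence,
  raising the weight to the power \<open>q / (q - p)\<close>. AM-GM then separates the index from
  the coordinate, which accounts for the further factor 2 in the condition on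
  \<open>c\<close>.\<close>

lemma weighted_env_moment:
  assumes "j < d" "0 \<le> p" "p < q" "0 \<le> K" "2 * (q / (q - p)) * c \<le> csub"
  shows "(\<integral>\<^sup>+z. ennreal (env z powr p * (K * exp (c * ((G \<theta> (fst z))\<^sup>2 + (G (coord_vec j) (fst z))\<^sup>2)))) \<partial>(P \<Otimes>\<^sub>M R))
    \<le> ennreal (Cenv + K powr (q / (q - p)) * sphere_const)"
proof -
  define a where "a = q / (q - p)"
  have a: "a > 0" using assms q_gt by (simp add: a_def)
  have ac: "2 * a * c \<le> csub" using assms(5) by (simp only: a_def)
  define E where "E v z = ennreal (exp (csub * (G v (fst z))\<^sup>2))" for v and z :: "(nat \<Rightarrow> real) \<times> real"
  have E_meas: "E v \<in> borel_measurable (P \<Otimes>\<^sub>M R)" for v unfolding E_def by measurable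
  have pw: "ennreal (env z powr p * (K * exp (c * ((G \<theta> (fst z))\<^sup>2 + (G (coord_vec j) (fst z))\<^sup>2))))
     \<le> ennreal (env z powr q) + ennreal (K powr a / 2) * (E \<theta> z + E (coord_vec j) z)" for z
  proof -
    define g where "g = (G \<theta> (fst z))\<^sup>2"
    define h where "h = (G (coord_vec j) (fst z))\<^sup>2"
    have gh: "g \<ge> 0" "h \<ge> 0" by (simp_all add: g_def h_def)
    have "env z powr p * (K * exp (c * (g + h))) \<le> env z powr q + (K * exp (c * (g + h))) powr a"
      unfolding a_def using assms env_nonneg by (intro powr_mult_le_add) auto
    also have "(K * exp (c * (g + h))) powr a = K powr a * exp (a * c * (g + h))"
    proof -
      have "exp (c * (g + h)) powr a = exp (a * c * (g + h))" by (simp add: powr_def)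
      then show ?thesis using assms by (simp add: powr_mult)
    qed
    also have "exp (a * c * (g + h)) \<le> (exp (csub * g) + exp (csub * h)) / 2"
    proof -
      have "2 * a * c * g \<le> csub * g" "2 * a * c * h \<le> csub * h"
        using mult_right_mono[OF ac gh(1)] mult_right_mono[OF ac gh(2)] by auto
      then have "exp (2 * a * c * g) + exp (2 * a * c * h) \<le> exp (csub * g) + exp (csub * h)"
        by (intro add_mono) auto
      moreover have "2 * exp (a * c * (g + h)) \<le> exp (2 * a * c * g) + exp (2 * a * c * h)"
      proof -
        have "0 \<le> (exp (a * c * g) - exp (a * c * h))\<^sup>2" by simp
        also have "\<dots> = exp (a * c * g) * exp (a * c * g) + exp (a * c * h) * exp (a * c * h) - 2 * (exp (a * c * g) * exp (a * c * h))"
          by (simp add: power2_eq_square algebra_simps)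
        finally show ?thesis by (simp add: mult_exp_exp distrib_left mult.assoc)
      qed
      ultimately show ?thesis by simp
    qed
    finally have "env z powr p * (K * exp (c * (g + h))) \<le> env z powr q + K powr a / 2 * (exp (csub * g) + exp (csub * h))"
      by (simp add: mult_left_mono)
    then have "ennreal (env z powr p * (K * exp (c * (g + h)))) \<le> ennreal (env z powr q + K powr a / 2 * (exp (csub * g) + exp (csub * h)))"
      by (rule ennreal_leI)
    also have "\<dots> = ennreal (env z powr q) + ennreal (K powr a / 2 * (exp (csub * g) + exp (csub * h)))"
      by (rule ennreal_plus) auto
    also have "ennreal (K powr a / 2 * (exp (csub * g) + exp (csub * h))) = ennreal (K powr a / 2) * (ennreal (exp (csub * g)) + ennreal (exp (csub * h)))"
      by (subst ennreal_mult) (auto simp flip: ennreal_plus)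
    finally show ?thesis by (simp add: E_def g_def h_def)
  qed
  have EE: "(\<integral>\<^sup>+z. E v z \<partial>(P \<Otimes>\<^sub>M R)) = (\<integral>\<^sup>+x. ennreal (exp (csub * (G v x)\<^sup>2)) \<partial>P)" for v
    unfolding E_def by (rule PR_fst_nn) measurable
  have "(\<integral>\<^sup>+z. ennreal (env z powr p * (K * exp (c * ((G \<theta> (fst z))\<^sup>2 + (G (coord_vec j) (fst z))\<^sup>2)))) \<partial>(P \<Otimes>\<^sub>M R))
     \<le> (\<integral>\<^sup>+z. ennreal (env z powr q) + ennreal (K powr a / 2) * (E \<theta> z + E (coord_vec j) z) \<partial>(P \<Otimes>\<^sub>M R))"
    by (intro nn_integral_mono pw)
  also have "\<dots> = (\<integral>\<^sup>+z. ennreal (env z powr q) \<partial>(P \<Otimes>\<^sub>M R)) + ennreal (K powr a / 2) * ((\<integral>\<^sup>+z. E \<theta> z \<partial>(P \<Otimes>\<^sub>M R)) + (\<integral>\<^sup>+z. E (coord_vec j) z \<partial>(P \<Otimes>\<^sub>M R)))"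
    using E_meas by (simp add: nn_integral_add nn_integral_cmult)
  also have "\<dots> \<le> ennreal Cenv + ennreal (K powr a / 2) * (ennreal sphere_const + ennreal sphere_const)"
    unfolding EE by (intro add_mono mult_left_mono env_moment subgaussian_coord assms subgaussian_index) auto
  also have "\<dots> = ennreal (Cenv + K powr a * sphere_const)"
  proof -
    have "ennreal (K powr a / 2) * (ennreal sphere_const + ennreal sphere_const) = ennreal (K powr a * sphere_const)"
      using sphere_const_pos by (simp flip: ennreal_plus ennreal_mult)
    moreover have "0 \<le> Cenv" by (auto simp: env_const_def intro!: mult_nonneg_nonneg add_nonneg_nonneg)
    ultimately show ?thesis using sphere_const_pos by (simp flip: ennreal_plus)
  qed
  finally show ?thesis by (simp add: a_def)
qed

end

definition eta_bound :: "real \<Rightarrow> real \<Rightarrow> real" where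
  "eta_bound q \<nu>q = 2 + \<nu>q powr q"

text \<open>The 64 is \<open>2 * 32\<close>: in \<open>mlt_exp_m2\<close> the Gaussian weight has
  rate 32 times this one times the square of \<open>eta_bound\<close>, and
  \<open>weighted_env_moment\<close> doubles it. The other estimates need less.\<close>

definition mult_rate :: "real \<Rightarrow> real \<Rightarrow> real \<Rightarrow> real \<Rightarrow> real" where
  "mult_rate q \<nu> \<nu>q \<kappa> = subg_rate \<nu> \<kappa> / (64 * (q / (q - 4)) * (eta_bound q \<nu>q)\<^sup>2)"

text \<open>The three summands are the bounds reached in \<open>mlt_m2_exp\<close>,
  \<open>mlt_exp_m2\<close> and \<open>mlt_bias\<close>, in this order.\<close>

definition mult_const :: "real \<Rightarrow> real \<Rightarrow> real \<Rightarrow> real \<Rightarrow> real" where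
  "mult_const q \<nu> \<nu>q \<kappa> = (let c = mult_rate q \<nu> \<nu>q \<kappa>; E = eta_bound q \<nu>q in
     (env_const q \<nu>q + (2 * (1 + E\<^sup>2 / c)) powr (q / (q - 4)) * sphere_const)
     + (env_const q \<nu>q + (exp (32 * c) / 16) powr (q / (q - 4)) * sphere_const)
     + 2 * (env_const q \<nu>q + (2 + 2 * E\<^sup>2 / c + 1 / c) powr (q / (q - (q / 4 + 3))) * sphere_const))"

lemma mult_rate_pos:
  assumes "\<nu> > 0" "\<kappa> > 0" "q > 4"
  shows "mult_rate q \<nu> \<nu>q \<kappa> > 0"
proof -
  have "eta_bound q \<nu>q > 0" unfolding eta_bound_def by (intro add_pos_nonneg) auto
  then have "0 < 64 * (q / (q - 4)) * (eta_bound q \<nu>q)\<^sup>2" using assms(3) by (intro mult_pos_pos) auto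
  moreover have "0 < subg_rate \<nu> \<kappa>" using assms by (simp add: subg_rate_def)
  ultimately show ?thesis unfolding mult_rate_def by (rule divide_pos_pos[rotated])
qed

lemma mult_const_pos: "mult_const q \<nu> \<nu>q \<kappa> > 0"
proof -
  have e: "0 \<le> env_const q \<nu>q" by (auto simp: env_const_def intro!: mult_nonneg_nonneg add_nonneg_nonneg)
  show ?thesis unfolding mult_const_def Let_def
    using e sphere_const_pos
    by (intro add_pos_nonneg add_nonneg_pos) (auto intro!: add_nonneg_nonneg mult_nonneg_nonneg mult_pos_pos)
qed

lemma integrable_LINT_le_of_nn:
  fixes \<Phi> :: "'a \<Rightarrow> real"
  assumes "\<Phi> \<in> borel_measurable M" "\<And>z. 0 \<le> \<Phi> z" "(\<integral>\<^sup>+z. ennreal (\<Phi> z) \<partial>M) \<le> ennreal b" "0 \<le> b"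
  shows "integrable M \<Phi>" "(LINT z|M. \<Phi> z) \<le> b"
proof -
  show i: "integrable M \<Phi>" using assms by (intro integrableI_nonneg) (auto intro: le_less_trans)
  have "ennreal (LINT z|M. \<Phi> z) \<le> ennreal b"
    using assms(3) by (subst nn_integral_eq_integral[symmetric]) (use i assms in auto)
  then show "(LINT z|M. \<Phi> z) \<le> b" using assms(4) by (simp add: ennreal_le_iff)
qed

context elliptical_model
begin

section \<open>The multiplier of the truncated gradient\<close>

abbreviation Eb :: real where "Eb \<equiv> eta_bound q \<nu>q"
abbreviation cm :: real where "cm \<equiv> mult_rate q \<nu> \<nu>q \<kappa>"
abbreviation Cm :: real where "Cm \<equiv> mult_const q \<nu> \<nu>q \<kappa>"

text \<open>The truncated residual at \<eta> times \<open>\<theta>\<close>, multiplied by the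
  truncated radius. Its product with \<open>G v\<close> is, up to a constant factor, the derivative
  of the truncated loss in direction \<open>v\<close>.\<close>

definition mlt :: "real \<Rightarrow> (nat \<Rightarrow> real) \<times> real \<Rightarrow> real" where
  "mlt \<tau> z = (trunc_real \<tau> (Y z) - eta0 * (min (D (fst z)) \<tau> * G \<theta> (fst z))) * min (D (fst z)) \<tau>"

definition H :: "(nat \<Rightarrow> real) \<times> real \<Rightarrow> real" where
  "H z = 1 + \<bar>eta0\<bar> * \<bar>G \<theta> (fst z)\<bar>"

lemma Eb_ge: "Eb \<ge> 2" "\<bar>eta0\<bar> \<le> Eb"
  using abs_eta0_le by (auto simp: eta_bound_def)

lemma cm_pos: "cm > 0"
  using \<nu>_pos \<kappa>_pos q_gt by (rule mult_rate_pos)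

lemma cm_csub: "64 * (q / (q - 4)) * Eb\<^sup>2 * cm = csub"
proof -
  have "0 < 64 * (q / (q - 4)) * Eb\<^sup>2" using q_gt Eb_ge(1) by (intro mult_pos_pos) auto
  moreover have "a * (b / a) = b" if "0 < a" for a b :: real using that by simp
  ultimately show ?thesis unfolding mult_rate_def by blast
qed

lemma ratio_cm: "r * (q / (q - 4)) * cm \<le> csub" if "0 \<le> r" "r \<le> 64"
proof -
  have "r * (q / (q - 4)) * cm \<le> (64 * Eb\<^sup>2) * ((q / (q - 4)) * cm)"
  proof -
    have "1 * 1 \<le> Eb\<^sup>2" unfolding power2_eq_square using Eb_ge(1) by (intro mult_mono) auto
    then have "r * 1 \<le> 64 * Eb\<^sup>2" using that by (intro mult_mono) auto
    moreover have "0 \<le> (q / (q - 4)) * cm" using q_gt cm_pos by simp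
    ultimately have "(r * 1) * ((q / (q - 4)) * cm) \<le> (64 * Eb\<^sup>2) * ((q / (q - 4)) * cm)" by (rule mult_right_mono)
    then show ?thesis by (simp only: mult.assoc mult_1_left)
  qed
  also have "\<dots> = csub" unfolding cm_csub[symmetric] by (simp only: mult_ac)
  finally show ?thesis .
qed

lemma env_const_nonneg: "0 \<le> Cenv"
  by (auto simp: env_const_def intro!: mult_nonneg_nonneg add_nonneg_nonneg)

lemma Cm_ge:
  "Cenv + (2 * (1 + Eb\<^sup>2 / cm)) powr (q / (q - 4)) * sphere_const \<le> Cm"
  "Cenv + (exp (32 * cm) / 16) powr (q / (q - 4)) * sphere_const \<le> Cm"
  "2 * (Cenv + (2 + 2 * Eb\<^sup>2 / cm + 1 / cm) powr (q / (q - (q / 4 + 3))) * sphere_const) \<le> Cm"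
proof -
  define a1 where "a1 = Cenv + (2 * (1 + Eb\<^sup>2 / cm)) powr (q / (q - 4)) * sphere_const"
  define a2 where "a2 = Cenv + (exp (32 * cm) / 16) powr (q / (q - 4)) * sphere_const"
  define a3 where "a3 = Cenv + (2 + 2 * Eb\<^sup>2 / cm + 1 / cm) powr (q / (q - (q / 4 + 3))) * sphere_const"
  have "Cm = a1 + a2 + 2 * a3" by (simp add: mult_const_def Let_def a1_def a2_def a3_def)
  moreover have "0 \<le> a1" "0 < a2" "0 \<le> a3"
    using env_const_nonneg sphere_const_pos
    by (auto simp: a1_def a2_def a3_def intro!: add_nonneg_nonneg add_nonneg_pos mult_nonneg_nonneg mult_pos_pos)
  ultimately show "a1 \<le> Cm" "a2 \<le> Cm" "2 * a3 \<le> Cm" by auto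
qed

lemma H_meas [measurable]: "H \<in> borel_measurable (P \<Otimes>\<^sub>M R)"
  unfolding H_def[abs_def] by measurable

lemma mlt_meas [measurable]: "mlt \<tau> \<in> borel_measurable (P \<Otimes>\<^sub>M R)"
  unfolding mlt_def[abs_def] trunc_real_def by measurable

lemma H_sq_le: "(H z)\<^sup>2 \<le> 2 + 2 * Eb\<^sup>2 * (G \<theta> (fst z))\<^sup>2"
proof -
  define a where "a = \<bar>eta0\<bar> * \<bar>G \<theta> (fst z)\<bar>"
  have "0 \<le> (1 - a)\<^sup>2" by simp
  then have "(1 + a)\<^sup>2 \<le> 2 + 2 * a\<^sup>2" by (simp add: power2_eq_square algebra_simps)
  also have "a\<^sup>2 \<le> Eb\<^sup>2 * (G \<theta> (fst z))\<^sup>2"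
  proof -
    have "\<bar>eta0\<bar>\<^sup>2 \<le> Eb\<^sup>2" using Eb_ge(2) by (intro power_mono) auto
    then have "eta0\<^sup>2 * (G \<theta> (fst z))\<^sup>2 \<le> Eb\<^sup>2 * (G \<theta> (fst z))\<^sup>2" by (intro mult_right_mono) auto
    then show ?thesis by (simp add: a_def power_mult_distrib)
  qed
  finally show ?thesis by (simp add: H_def a_def)
qed

text \<open>The residual is at most \<open>T * H z\<close> and the remaining radius at most
  \<open>T\<close>. Bounding \<open>T\<close> by the envelope serves the moment estimates, while the
  cap \<open>2 * \<tau>\<close> is what exponential integrability requires.\<close>

lemma mlt_le:
  assumes "\<tau> \<ge> 0"
  shows "\<bar>mlt \<tau> z\<bar> \<le> (env z)\<^sup>2 * H z" "\<bar>mlt \<tau> z\<bar> \<le> (min (env z) (2 * \<tau>))\<^sup>2 * H z"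
proof -
  define T where "T = min \<bar>Y z\<bar> \<tau> + min (D (fst z)) \<tau>"
  have T: "0 \<le> T" "T \<le> env z" "T \<le> 2 * \<tau>" "min (D (fst z)) \<tau> \<le> T" "0 \<le> min (D (fst z)) \<tau>"
    using assms D_nonneg[of "fst z"] by (auto simp: T_def env_def)
  have H1: "H z \<ge> 1" by (simp add: H_def)
  have t: "\<bar>trunc_real \<tau> (Y z)\<bar> \<le> min \<bar>Y z\<bar> \<tau>" using assms by (auto simp: trunc_real_def abs_mult sgn_if)
  have "\<bar>trunc_real \<tau> (Y z) - eta0 * (min (D (fst z)) \<tau> * G \<theta> (fst z))\<bar>
      \<le> min \<bar>Y z\<bar> \<tau> + \<bar>eta0\<bar> * (min (D (fst z)) \<tau> * \<bar>G \<theta> (fst z)\<bar>)"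
    using t T(5) by (intro order_trans[OF abs_triangle_ineq4] add_mono) (auto simp: abs_mult)
  also have "\<dots> \<le> T + \<bar>eta0\<bar> * (T * \<bar>G \<theta> (fst z)\<bar>)"
    using T by (intro add_mono mult_left_mono mult_right_mono) (auto simp: T_def)
  also have "\<dots> = T * H z" by (simp add: H_def algebra_simps)
  finally have "\<bar>mlt \<tau> z\<bar> \<le> (T * H z) * T"
    unfolding mlt_def abs_mult using T H1 by (intro mult_mono) auto
  also have "\<dots> = T\<^sup>2 * H z" by (simp add: power2_eq_square)
  finally have *: "\<bar>mlt \<tau> z\<bar> \<le> T\<^sup>2 * H z" .
  have **: "\<bar>mlt \<tau> z\<bar> \<le> S\<^sup>2 * H z" if "T \<le> S" for S
  proof -
    have "T\<^sup>2 * H z \<le> S\<^sup>2 * H z" using T(1) that H1 by (intro mult_right_mono power_mono) auto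
    then show ?thesis using * by linarith
  qed
  show "\<bar>mlt \<tau> z\<bar> \<le> (env z)\<^sup>2 * H z" by (rule **[OF T(2)])
  show "\<bar>mlt \<tau> z\<bar> \<le> (min (env z) (2 * \<tau>))\<^sup>2 * H z" using T by (intro **) simp
qed

lemma gauss_absorb: "1 + a * g \<le> (1 + a / cm) * exp (cm * g)" if "a \<ge> 0" "g \<ge> 0" for a g :: real
proof -
  have "cm * g \<le> exp (cm * g)" using exp_ge_add_one_self[of "cm * g"] by linarith
  then have "g \<le> exp (cm * g) / cm" using cm_pos by (simp add: field_simps)
  then have "a * g \<le> a * (exp (cm * g) / cm)" using that by (intro mult_left_mono) auto
  moreover have "1 \<le> exp (cm * g)" using cm_pos that by simp
  moreover have "(1 + a / cm) * exp (cm * g) = exp (cm * g) + a * (exp (cm * g) / cm)" by (simp add: algebra_simps)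
  ultimately show ?thesis by linarith
qed

lemma mlt_m2_exp:
  assumes j: "j < d" and "\<tau> \<ge> 0"
  shows "(\<integral>\<^sup>+z. ennreal ((mlt \<tau> z)\<^sup>2 * exp (cm * (G (coord_vec j) (fst z))\<^sup>2)) \<partial>(P \<Otimes>\<^sub>M R)) \<le> ennreal Cm"
proof -
  have "(mlt \<tau> z)\<^sup>2 * exp (cm * (G (coord_vec j) (fst z))\<^sup>2)
     \<le> env z powr 4 * (2 * (1 + Eb\<^sup>2 / cm) * exp (cm * ((G \<theta> (fst z))\<^sup>2 + (G (coord_vec j) (fst z))\<^sup>2)))" for z
  proof -
    define g where "g = (G \<theta> (fst z))\<^sup>2"
    define h where "h = (G (coord_vec j) (fst z))\<^sup>2"
    have "(mlt \<tau> z)\<^sup>2 \<le> ((env z)\<^sup>2 * H z)\<^sup>2"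
      using power_mono[OF mlt_le(1)[OF assms(2), of z], of 2] by simp
    also have "\<dots> = env z ^ 4 * (H z)\<^sup>2" by (simp add: power_mult_distrib flip: power_mult)
    also have "\<dots> \<le> env z ^ 4 * (2 + 2 * Eb\<^sup>2 * g)" unfolding g_def by (intro mult_left_mono H_sq_le) auto
    also have "\<dots> \<le> env z ^ 4 * (2 * ((1 + Eb\<^sup>2 / cm) * exp (cm * g)))"
      using gauss_absorb[of "Eb\<^sup>2" g] by (intro mult_left_mono) (auto simp: g_def)
    finally have "(mlt \<tau> z)\<^sup>2 * exp (cm * h) \<le> (env z ^ 4 * (2 * ((1 + Eb\<^sup>2 / cm) * exp (cm * g)))) * exp (cm * h)"
      by (intro mult_right_mono) auto
    also have "\<dots> = env z powr 4 * (2 * (1 + Eb\<^sup>2 / cm) * exp (cm * (g + h)))"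
      using env_nonneg[of z] by (simp add: distrib_left exp_add)
    finally show ?thesis by (simp add: g_def h_def)
  qed
  then have "(\<integral>\<^sup>+z. ennreal ((mlt \<tau> z)\<^sup>2 * exp (cm * (G (coord_vec j) (fst z))\<^sup>2)) \<partial>(P \<Otimes>\<^sub>M R))
     \<le> (\<integral>\<^sup>+z. ennreal (env z powr 4 * (2 * (1 + Eb\<^sup>2 / cm) * exp (cm * ((G \<theta> (fst z))\<^sup>2 + (G (coord_vec j) (fst z))\<^sup>2)))) \<partial>(P \<Otimes>\<^sub>M R))"
    by (intro nn_integral_mono ennreal_leI)
  also have "\<dots> \<le> ennreal (Cenv + (2 * (1 + Eb\<^sup>2 / cm)) powr (q / (q - 4)) * sphere_const)"
    using q_gt cm_pos ratio_cm[of 2] by (intro weighted_env_moment j) auto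
  also have "\<dots> \<le> ennreal Cm" by (intro ennreal_leI Cm_ge)
  finally show ?thesis .
qed

text \<open>Because \<open>\<tau> ^ 4 \<le> N\<close>, the fourth power of the capped envelope
  divided by \<open>16 * N\<close> lies between 0 and 1. The chord inequality pulls this factor out
  of the exponent, which then contains only the Gaussian quantity \<open>H\<close>.\<close>

lemma mlt_exp_m2:
  assumes N: "N > 0" and \<tau>: "\<tau> \<ge> 0" "\<tau> ^ 4 \<le> real N"
  shows "(\<integral>\<^sup>+z. ennreal (exp (cm * (mlt \<tau> z)\<^sup>2 / N)) \<partial>(P \<Otimes>\<^sub>M R)) \<le> ennreal (exp (Cm / N))"
proof -
  \<comment> \<open>The term with \<open>coord_vec 0\<close> only enlarges the bound; it brings the
    weight into the form treated by \<open>weighted_env_moment\<close>.\<close>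
  define \<Phi> where "\<Phi> z = env z powr 4 * (exp (32 * cm) / 16 * exp ((32 * cm * Eb\<^sup>2) * ((G \<theta> (fst z))\<^sup>2 + (G (coord_vec 0) (fst z))\<^sup>2)))" for z
  have \<Phi>0: "\<Phi> z \<ge> 0" for z by (simp add: \<Phi>_def)
  have \<Phi>_meas: "\<Phi> \<in> borel_measurable (P \<Otimes>\<^sub>M R)" unfolding \<Phi>_def[abs_def] by measurable
  have pw: "exp (cm * (mlt \<tau> z)\<^sup>2 / N) \<le> 1 + 1 / N * \<Phi> z" for z
  proof -
    define T where "T = min (env z) (2 * \<tau>)"
    have T: "0 \<le> T" "T \<le> 2 * \<tau>" "T \<le> env z" using \<tau> env_nonneg[of z] by (auto simp: T_def)
    define x where "x = T ^ 4 / (16 * N)"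
    have "T ^ 4 \<le> (2 * \<tau>) ^ 4" using T by (intro power_mono) auto
    also have "\<dots> \<le> 16 * N" using \<tau>(2) by (simp add: power_mult_distrib)
    finally have x: "0 \<le> x" "x \<le> 1" using T N by (auto simp: x_def)
    have "(mlt \<tau> z)\<^sup>2 \<le> (T\<^sup>2 * H z)\<^sup>2"
      unfolding T_def using power_mono[OF mlt_le(2)[OF \<tau>(1), of z], of 2] by simp
    also have "\<dots> = 16 * N * x * (H z)\<^sup>2" using N by (simp add: x_def power_mult_distrib flip: power_mult)
    finally have "cm * (mlt \<tau> z)\<^sup>2 / N \<le> cm * (16 * N * x * (H z)\<^sup>2) / N"
      using cm_pos by (intro divide_right_mono mult_left_mono) auto
    also have "\<dots> = x * (16 * cm * (H z)\<^sup>2)" using N by simp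
    finally have "exp (cm * (mlt \<tau> z)\<^sup>2 / N) \<le> exp (x * (16 * cm * (H z)\<^sup>2))" by simp
    also have "\<dots> \<le> 1 + x * (exp (16 * cm * (H z)\<^sup>2) - 1)" by (rule exp_mult_le_chord[OF x])
    also have "\<dots> \<le> 1 + x * exp (16 * cm * (H z)\<^sup>2)" using x by (simp add: algebra_simps)
    also have "\<dots> \<le> 1 + (env z ^ 4 / (16 * N)) * (exp (32 * cm) * exp ((32 * cm * Eb\<^sup>2) * ((G \<theta> (fst z))\<^sup>2 + (G (coord_vec 0) (fst z))\<^sup>2)))"
    proof (intro add_left_mono mult_mono)
      show "x \<le> env z ^ 4 / (16 * N)" unfolding x_def using T N by (intro divide_right_mono power_mono) auto
      have "16 * cm * (H z)\<^sup>2 \<le> 16 * cm * (2 + 2 * Eb\<^sup>2 * (G \<theta> (fst z))\<^sup>2)"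
        using cm_pos by (intro mult_left_mono H_sq_le) auto
      also have "\<dots> = 32 * cm + (32 * cm * Eb\<^sup>2) * ((G \<theta> (fst z))\<^sup>2 + 0)" by (simp add: algebra_simps)
      also have "\<dots> \<le> 32 * cm + (32 * cm * Eb\<^sup>2) * ((G \<theta> (fst z))\<^sup>2 + (G (coord_vec 0) (fst z))\<^sup>2)"
        using cm_pos by (intro add_left_mono mult_left_mono) auto
      finally show "exp (16 * cm * (H z)\<^sup>2) \<le> exp (32 * cm) * exp ((32 * cm * Eb\<^sup>2) * ((G \<theta> (fst z))\<^sup>2 + (G (coord_vec 0) (fst z))\<^sup>2))"
        by (simp add: mult_exp_exp)
    qed (use x in auto)
    also have "\<dots> = 1 + 1 / N * \<Phi> z" using env_nonneg[of z] by (simp add: \<Phi>_def)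
    finally show ?thesis .
  qed
  have "(\<integral>\<^sup>+z. ennreal (exp (cm * (mlt \<tau> z)\<^sup>2 / N)) \<partial>(P \<Otimes>\<^sub>M R)) \<le> (\<integral>\<^sup>+z. 1 + ennreal (1 / N) * ennreal (\<Phi> z) \<partial>(P \<Otimes>\<^sub>M R))"
  proof (intro nn_integral_mono)
    fix z
    have "ennreal (exp (cm * (mlt \<tau> z)\<^sup>2 / N)) \<le> ennreal (1 + 1 / N * \<Phi> z)" by (intro ennreal_leI pw)
    also have "\<dots> = ennreal 1 + ennreal (1 / N * \<Phi> z)" using \<Phi>0[of z] by (intro ennreal_plus) auto
    also have "ennreal (1 / N * \<Phi> z) = ennreal (1 / N) * ennreal (\<Phi> z)" using \<Phi>0[of z] by (intro ennreal_mult) auto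
    finally show "ennreal (exp (cm * (mlt \<tau> z)\<^sup>2 / N)) \<le> 1 + ennreal (1 / N) * ennreal (\<Phi> z)" by simp
  qed
  also have "\<dots> = 1 + ennreal (1 / N) * (\<integral>\<^sup>+z. ennreal (\<Phi> z) \<partial>(P \<Otimes>\<^sub>M R))"
    using \<Phi>_meas by (simp add: nn_integral_add nn_integral_cmult PR.emeasure_space_1)
  also have "\<dots> \<le> 1 + ennreal (1 / N) * ennreal (Cenv + (exp (32 * cm) / 16) powr (q / (q - 4)) * sphere_const)"
    unfolding \<Phi>_def
  proof (intro add_left_mono mult_left_mono weighted_env_moment d_pos)
    have "2 * (q / (q - 4)) * (32 * cm * Eb\<^sup>2) = 64 * (q / (q - 4)) * Eb\<^sup>2 * cm" by simp
    then show "2 * (q / (q - 4)) * (32 * cm * Eb\<^sup>2) \<le> csub" by (simp only: cm_csub order_refl)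
  qed (use q_gt in auto)
  also have "\<dots> \<le> 1 + ennreal (1 / N) * ennreal Cm"
    by (intro add_left_mono mult_left_mono ennreal_leI Cm_ge) auto
  also have "\<dots> = ennreal (1 + Cm / N)"
    using mult_const_pos[of q \<nu> \<nu>q \<kappa>] by (simp flip: ennreal_mult ennreal_1 ennreal_plus)
  also have "\<dots> \<le> ennreal (exp (Cm / N))" by (intro ennreal_leI exp_ge_add_one_self)
  finally show ?thesis .
qed

text \<open>The untruncated product has mean zero by \<open>population_gradient_zero\<close>, and
  truncation acts only where the envelope exceeds \<tau>. There the squared envelope is at most its
  power \<open>p\<close> divided by \<open>\<tau> powr (p - 2)\<close>, and this divisor is exactly
  \<open>sqrt N\<close>.\<close>

lemma mlt_bias:
  assumes j: "j < d" and N: "N > 0" and \<tau>: "\<tau> = trunc_level N q"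
  shows "\<bar>LINT z|(P \<Otimes>\<^sub>M R). mlt \<tau> z * G (coord_vec j) (fst z)\<bar> \<le> Cm / sqrt N"
proof -
  \<comment> \<open>Solves \<open>2 / (q + 4) * (p - 2) = 1 / 2\<close>; that \<open>p\<close> stays
    below \<open>q\<close> is equivalent to \<open>q > 4\<close>.\<close>
  define p where "p = q / 4 + 3"
  have p: "0 \<le> p" "p < q" "p - 2 > 0" using q_gt by (auto simp: p_def)
  have \<tau>0: "\<tau> > 0" using N by (simp add: \<tau> trunc_level_def)
  have \<tau>p: "\<tau> powr (p - 2) = sqrt N"
  proof -
    have e: "2 / (q + 4) * (p - 2) = 1 / 2" using q_gt by (simp add: p_def field_simps)
    show ?thesis unfolding \<tau> trunc_level_def powr_powr e by (simp add: powr_half_sqrt)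
  qed
  define K where "K = 2 + 2 * Eb\<^sup>2 / cm + 1 / cm"
  have K: "K \<ge> 0" using cm_pos by (simp add: K_def)
  define \<Phi> where "\<Phi> z = env z powr p * (K * exp (cm * ((G \<theta> (fst z))\<^sup>2 + (G (coord_vec j) (fst z))\<^sup>2)))" for z
  have \<Phi>_meas: "\<Phi> \<in> borel_measurable (P \<Otimes>\<^sub>M R)" unfolding \<Phi>_def[abs_def] by measurable
  have \<Phi>0: "\<Phi> z \<ge> 0" for z using K by (simp add: \<Phi>_def)
  define b where "b = Cenv + K powr (q / (q - p)) * sphere_const"
  have b: "0 \<le> b" using env_const_nonneg sphere_const_pos by (auto simp: b_def)
  have \<Phi>_nn: "(\<integral>\<^sup>+z. ennreal (\<Phi> z) \<partial>(P \<Otimes>\<^sub>M R)) \<le> ennreal b"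
    unfolding \<Phi>_def b_def
  proof (intro weighted_env_moment j p K)
    \<comment> \<open>The resulting factor \<open>8 / 3\<close> is well below the 64 that
      \<open>ratio_cm\<close> allows.\<close>
    have "q / (q - p) = 4 / 3 * (q / (q - 4))" using q_gt by (simp add: p_def field_simps)
    then have "2 * (q / (q - p)) * cm = 8 / 3 * (q / (q - 4)) * cm" by simp
    also have "\<dots> \<le> csub" by (rule ratio_cm) auto
    finally show "2 * (q / (q - p)) * cm \<le> csub" .
  qed
  note \<Phi>_int = integrable_LINT_le_of_nn[OF \<Phi>_meas \<Phi>0 \<Phi>_nn b]
  define X where "X z = (Y z - eta0 * dotp d (fst z) \<theta>) * dotp d (fst z) (coord_vec j)" for z
  have X_eq: "X z = (Y z - eta0 * (D (fst z) * G \<theta> (fst z))) * (D (fst z) * G (coord_vec j) (fst z))" for z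
    by (simp only: X_def dotp_eq_D_G)
  have X_int: "integrable (P \<Otimes>\<^sub>M R) X"
  proof -
    have "integrable P (\<lambda>x. dotp d x \<theta> * dotp d x (coord_vec j))"
      by (rule Bochner_Integration.integrable_bound[of _ "\<lambda>x. (dotp d x \<theta>)\<^sup>2 + (dotp d x (coord_vec j))\<^sup>2"])
        (use integrable_dotp_sq abs_mult_le_squares in auto)
    then have "integrable (P \<Otimes>\<^sub>M R) (\<lambda>z. Y z * dotp d (fst z) (coord_vec j) - eta0 * (dotp d (fst z) \<theta> * dotp d (fst z) (coord_vec j)))"
      using integrable_Y_dotp PR_fst_integrable by (intro Bochner_Integration.integrable_diff integrable_mult_right) auto
    then show ?thesis by (simp add: X_def[abs_def] algebra_simps)
  qed
  have pw: "\<bar>mlt \<tau> z * G (coord_vec j) (fst z) - X z\<bar> \<le> 2 / sqrt N * \<Phi> z" for z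
  proof (cases "env z \<le> \<tau>")
    case True
    then have "\<bar>Y z\<bar> \<le> \<tau>" "D (fst z) \<le> \<tau>" using D_nonneg[of "fst z"] by (auto simp: env_def)
    then have "trunc_real \<tau> (Y z) = Y z" "min (D (fst z)) \<tau> = D (fst z)"
      by (auto simp: trunc_real_def min_def sgn_mult_abs)
    then have "mlt \<tau> z * G (coord_vec j) (fst z) = X z" by (simp add: mlt_def X_eq)
    then show ?thesis using \<Phi>0[of z] by simp
  next
    case False
    define V where "V = env z"
    define g where "g = (G \<theta> (fst z))\<^sup>2"
    define h where "h = (G (coord_vec j) (fst z))\<^sup>2"
    have V: "V > \<tau>" "V > 0" using False \<tau>0 by (auto simp: V_def)
    have H1: "H z \<ge> 1" by (simp add: H_def)
    have "\<bar>Y z - eta0 * (D (fst z) * G \<theta> (fst z))\<bar> \<le> \<bar>Y z\<bar> + \<bar>eta0\<bar> * (D (fst z) * \<bar>G \<theta> (fst z)\<bar>)"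
      using D_nonneg[of "fst z"] by (intro order_trans[OF abs_triangle_ineq4]) (simp add: abs_mult)
    also have "\<dots> \<le> V + \<bar>eta0\<bar> * (V * \<bar>G \<theta> (fst z)\<bar>)"
      using D_nonneg[of "fst z"] by (intro add_mono mult_left_mono mult_right_mono) (auto simp: V_def env_def)
    also have "\<dots> = V * H z" by (simp add: H_def algebra_simps)
    finally have "\<bar>X z\<bar> \<le> (V * H z) * (V * \<bar>G (coord_vec j) (fst z)\<bar>)"
      unfolding X_eq abs_mult[of _ "D (fst z) * _"] abs_mult[of "D (fst z)"]
      using D_nonneg[of "fst z"] H1 V by (intro mult_mono) (auto simp: V_def env_def)
    moreover have "\<bar>mlt \<tau> z * G (coord_vec j) (fst z)\<bar> \<le> (V\<^sup>2 * H z) * \<bar>G (coord_vec j) (fst z)\<bar>"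
      unfolding abs_mult V_def using mlt_le(1)[of \<tau> z] \<tau>0 by (intro mult_right_mono) auto
    ultimately have "\<bar>mlt \<tau> z * G (coord_vec j) (fst z) - X z\<bar> \<le> 2 * (V\<^sup>2 * (H z * \<bar>G (coord_vec j) (fst z)\<bar>))"
      using abs_triangle_ineq4[of "mlt \<tau> z * G (coord_vec j) (fst z)" "X z"]
      by (simp add: power2_eq_square algebra_simps)
    also have "\<dots> \<le> 2 * (V powr p / sqrt N * (K * exp (cm * (g + h))))"
    proof (rule mult_left_mono, rule mult_mono)
      have "V\<^sup>2 * sqrt N \<le> V powr 2 * V powr (p - 2)"
        unfolding \<tau>p[symmetric] using V \<tau>0 p by (intro mult_mono powr_mono2) auto
      also have "\<dots> = V powr p" by (simp flip: powr_add)
      finally show "V\<^sup>2 \<le> V powr p / sqrt N" using N by (simp add: field_simps)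
      have "H z * \<bar>G (coord_vec j) (fst z)\<bar> \<le> (H z)\<^sup>2 + h"
        using abs_mult_le_squares[of "H z" "G (coord_vec j) (fst z)"] H1 by (simp add: abs_mult h_def)
      also have "\<dots> \<le> 2 + 2 * Eb\<^sup>2 * g + h" using H_sq_le[of z] by (simp add: g_def)
      also have "\<dots> \<le> K * exp (cm * (g + h))"
      proof -
        have gh: "g \<ge> 0" "h \<ge> 0" by (auto simp: g_def h_def)
        have s: "cm * (g + h) \<le> exp (cm * (g + h))" "1 \<le> exp (cm * (g + h))"
          using exp_ge_add_one_self[of "cm * (g + h)"] cm_pos gh by (linarith, simp)
        have gle: "g \<le> exp (cm * (g + h)) / cm" "h \<le> exp (cm * (g + h)) / cm"
        proof -
          have "cm * g \<le> cm * (g + h)" "cm * h \<le> cm * (g + h)" using cm_pos gh by (auto intro!: mult_left_mono)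
          then have "cm * g \<le> exp (cm * (g + h))" "cm * h \<le> exp (cm * (g + h))" using s(1) by linarith+
          then show "g \<le> exp (cm * (g + h)) / cm" "h \<le> exp (cm * (g + h)) / cm"
            using cm_pos by (simp_all add: pos_le_divide_eq mult.commute)
        qed
        have "2 * Eb\<^sup>2 * g \<le> 2 * Eb\<^sup>2 * (exp (cm * (g + h)) / cm)" using gle by (intro mult_left_mono) auto
        then have "2 + 2 * Eb\<^sup>2 * g + h \<le> 2 * exp (cm * (g + h)) + 2 * Eb\<^sup>2 * (exp (cm * (g + h)) / cm) + exp (cm * (g + h)) / cm"
          using gle s by linarith
        also have "\<dots> = K * exp (cm * (g + h))" by (simp add: K_def distrib_right)
        finally show ?thesis .
      qed
      finally show "H z * \<bar>G (coord_vec j) (fst z)\<bar> \<le> K * exp (cm * (g + h))" .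
    qed (use H1 V in auto)
    also have "\<dots> = 2 / sqrt N * \<Phi> z" by (simp add: \<Phi>_def V_def g_def h_def)
    finally show ?thesis .
  qed
  have mG_meas: "(\<lambda>z. mlt \<tau> z * G (coord_vec j) (fst z)) \<in> borel_measurable (P \<Otimes>\<^sub>M R)" by measurable
  have diff_int: "integrable (P \<Otimes>\<^sub>M R) (\<lambda>z. mlt \<tau> z * G (coord_vec j) (fst z) - X z)"
  proof (rule Bochner_Integration.integrable_bound)
    show "integrable (P \<Otimes>\<^sub>M R) (\<lambda>z. 2 / sqrt N * \<Phi> z)" using \<Phi>_int(1) by (rule integrable_mult_right)
    show "AE z in P \<Otimes>\<^sub>M R. norm (mlt \<tau> z * G (coord_vec j) (fst z) - X z) \<le> norm (2 / sqrt N * \<Phi> z)"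
      unfolding real_norm_def by (intro AE_I2 order_trans[OF pw abs_ge_self])
  qed (use mG_meas X_int in auto)
  have mG_int: "integrable (P \<Otimes>\<^sub>M R) (\<lambda>z. mlt \<tau> z * G (coord_vec j) (fst z))"
    using Bochner_Integration.integrable_add[OF diff_int X_int] by simp
  have "(LINT z|(P \<Otimes>\<^sub>M R). X z) = 0" unfolding X_def by (rule population_gradient_zero)
  then have "\<bar>LINT z|(P \<Otimes>\<^sub>M R). mlt \<tau> z * G (coord_vec j) (fst z)\<bar> = \<bar>LINT z|(P \<Otimes>\<^sub>M R). mlt \<tau> z * G (coord_vec j) (fst z) - X z\<bar>"
    using mG_int X_int by simp
  also have "\<dots> \<le> (LINT z|(P \<Otimes>\<^sub>M R). \<bar>mlt \<tau> z * G (coord_vec j) (fst z) - X z\<bar>)" by (rule integral_abs_bound)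
  also have "\<dots> \<le> (LINT z|(P \<Otimes>\<^sub>M R). 2 / sqrt N * \<Phi> z)"
    using diff_int \<Phi>_int(1) pw by (intro integral_mono) auto
  also have "\<dots> = 2 / sqrt N * (LINT z|(P \<Otimes>\<^sub>M R). \<Phi> z)" by simp
  also have "\<dots> \<le> 2 / sqrt N * b" using \<Phi>_int(2) by (intro mult_left_mono) auto
  also have "\<dots> = (2 * b) / sqrt N" by simp
  also have "\<dots> \<le> Cm / sqrt N"
    using Cm_ge(3) by (intro divide_right_mono) (simp_all add: b_def K_def p_def)
  finally show ?thesis .
qed

end

text \<open>\<open>1 + 2 * \<nu> / \<kappa>\<close> is the scale \<open>T\<close> of
  \<open>truncated_second_moment\<close>. Half of \<kappa> survives the fourth-moment correction,
  and rescaling divides it by \<open>T\<close>.\<close>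

definition curv :: "real \<Rightarrow> real \<Rightarrow> real" where
  "curv \<nu> \<kappa> = \<kappa> / (2 * (1 + 2 * \<nu> / \<kappa>))"

lemma sphere_const_ge_1: "sphere_const \<ge> 1"
proof -
  have "1 - exp (- 1 / 8) \<le> (1 :: real)" "0 < 1 - exp (- 1 / 8 :: real)" by auto
  moreover have "1 \<le> 2 * exp (1 / 8 :: real)" using exp_ge_add_one_self[of "1 / 8"] by simp
  ultimately show ?thesis unfolding sphere_const_def by (subst le_divide_eq_1_pos) linarith+
qed

context elliptical_model
begin

section \<open>Curvature and noise of the truncated sample\<close>

lemma G_eq_sum: "G v x = (\<Sum>j<d. G (coord_vec j) x * v j)"
proof -
  have "(\<Sum>j<d. G (coord_vec j) x * v j) = (\<Sum>j<d. sqrt d / norm2 d x * (x j * v j))"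
    by (intro sum.cong refl) (simp add: G_def dotp_unit)
  also have "\<dots> = G v x" by (simp add: G_def dotp_def sum_distrib_left sum_divide_distrib)
  finally show ?thesis by simp
qed

lemma D_pow4_le: "D x ^ 4 \<le> 1 / d * (\<Sum>j<d. (dotp d x (coord_vec j)) ^ 4)"
proof -
  have "D x ^ 4 = (D x ^ 2)\<^sup>2" by simp
  also have "D x ^ 2 = 1 / d * (\<Sum>j<d. (x j)\<^sup>2)" using d_pos by (simp add: D_def power_divide norm2_sq)
  also have "(1 / d * (\<Sum>j<d. (x j)\<^sup>2))\<^sup>2 = 1 / d * (1 / d * (\<Sum>j<d. (x j)\<^sup>2)\<^sup>2)" by (simp add: power2_eq_square)
  also have "\<dots> \<le> 1 / d * (1 / d * (d * (\<Sum>j<d. ((x j)\<^sup>2)\<^sup>2)))"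
    using sum_squared_le_sum_of_squares[of "\<lambda>j. (x j)\<^sup>2" "{..<d}"] by (intro mult_left_mono) (auto simp: mult.commute)
  also have "\<dots> = 1 / d * (\<Sum>j<d. (dotp d x (coord_vec j)) ^ 4)" using d_pos by (simp add: dotp_unit flip: power_mult)
  finally show ?thesis .
qed

lemma D_pow4: "integrable P (\<lambda>x. D x ^ 4)" "(LINT x|P. D x ^ 4) \<le> \<nu>"
proof -
  define S where "S x = 1 / d * (\<Sum>j<d. (dotp d x (coord_vec j)) ^ 4)" for x
  have S: "integrable P S" unfolding S_def[abs_def]
    by (intro integrable_mult_right Bochner_Integration.integrable_sum fourth_moment)
  show i: "integrable P (\<lambda>x. D x ^ 4)"
  proof (rule Bochner_Integration.integrable_bound[OF S])
    show "AE x in P. norm (D x ^ 4) \<le> norm (S x)"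
    proof (intro AE_I2)
      fix x
      have "D x ^ 4 \<le> \<bar>S x\<bar>" unfolding S_def by (rule order_trans[OF D_pow4_le abs_ge_self])
      then show "norm (D x ^ 4) \<le> norm (S x)" by simp
    qed
  qed measurable
  have "(LINT x|P. D x ^ 4) \<le> (LINT x|P. S x)"
    by (intro integral_mono i S) (use D_pow4_le in \<open>simp add: S_def\<close>)
  also have "\<dots> = 1 / d * (\<Sum>j<d. LINT x|P. (dotp d x (coord_vec j)) ^ 4)"
    unfolding S_def using fourth_moment by (simp add: Bochner_Integration.integral_sum)
  also have "\<dots> \<le> 1 / d * (\<Sum>j<d. \<nu>)"
  proof (intro mult_left_mono sum_mono)
    show "(LINT x|P. (dotp d x (coord_vec j)) ^ 4) \<le> \<nu>" if "j \<in> {..<d}" for j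
      using fourth_moment(2)[of "coord_vec j"] norm2_unit[of j] that by simp
  qed auto
  finally show "(LINT x|P. D x ^ 4) \<le> \<nu>" using d_pos by simp
qed

text \<open>With \<open>y\<close> the squared radius, the truncated square dominates
  \<open>y / T * (1 - y / T)\<close>. This polynomial turns the expectation into second and fourth
  moments. The correction is of relative size \<open>\<nu> / T\<close>, and \<open>T\<close> is
  large enough to make it at most \<open>\<kappa> / 2\<close>.\<close>

lemma truncated_second_moment:
  "curv \<nu> \<kappa> * (norm2 d u)\<^sup>2 \<le> (LINT x|P. (min (D x) 1 * G u x)\<^sup>2)"
proof (cases "norm2 d u = 0")
  case True
  then show ?thesis by simp
next
  case False
  define n where "n = norm2 d u"
  have n: "n > 0" using False norm2_nonneg[of d u] by (simp add: n_def)
  define T where "T = 1 + 2 * \<nu> / \<kappa>"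
  have T: "T \<ge> 1" "\<nu> / T \<le> \<kappa> / 2"
  proof -
    show "T \<ge> 1" using \<nu>_pos \<kappa>_pos by (simp add: T_def)
    have "\<nu> * 2 \<le> \<kappa> * T" using \<nu>_pos \<kappa>_pos by (simp add: T_def distrib_left)
    then show "\<nu> / T \<le> \<kappa> / 2" using \<open>T \<ge> 1\<close> by (simp add: field_simps)
  qed
  have pw: "1 / T * ((dotp d x u)\<^sup>2 - 1 / T * ((n\<^sup>2 * D x ^ 4 + (dotp d x u) ^ 4 / n\<^sup>2) / 2)) \<le> (min (D x) 1 * G u x)\<^sup>2" for x
  proof -
    define a where "a = (dotp d x u)\<^sup>2"
    define y where "y = (D x)\<^sup>2"
    have a: "a = y * (G u x)\<^sup>2" by (simp add: a_def y_def dotp_eq_D_G power_mult_distrib)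
    have y: "y \<ge> 0" by (simp add: y_def)
    \<comment> \<open>The weight \<open>n\<close> balances the two fourth moments: after integration
      both are at most \<open>\<nu> * n\<^sup>2\<close>.\<close>
    have "0 \<le> (n * y - a / n)\<^sup>2" by simp
    then have "y * a \<le> (n\<^sup>2 * y\<^sup>2 + a\<^sup>2 / n\<^sup>2) / 2" using n by (simp add: power2_diff power_mult_distrib power_divide)
    then have am: "y * a \<le> (n\<^sup>2 * D x ^ 4 + (dotp d x u) ^ 4 / n\<^sup>2) / 2"
      by (simp add: y_def a_def flip: power_mult)
    have "1 / T * (a - 1 / T * ((n\<^sup>2 * D x ^ 4 + (dotp d x u) ^ 4 / n\<^sup>2) / 2)) \<le> 1 / T * (a - 1 / T * (y * a))"
      using T am by (intro mult_left_mono diff_left_mono) auto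
    also have "\<dots> = ((y / T) * (1 - y / T)) * (G u x)\<^sup>2" by (simp add: a algebra_simps)
    also have "\<dots> \<le> (min (D x) 1)\<^sup>2 * (G u x)\<^sup>2"
    proof (intro mult_right_mono)
      \<comment> \<open>For radius at most 1 the left side is at most \<open>y\<close>, because
        \<open>T \<ge> 1\<close>. Beyond that it is still at most 1, as any product of a number and
        its complement to 1.\<close>
      show "y / T * (1 - y / T) \<le> (min (D x) 1)\<^sup>2"
      proof (cases "D x \<le> 1")
        case True
        have "y / T * (1 - y / T) \<le> y / T * 1" using y T by (intro mult_left_mono) auto
        also have "\<dots> \<le> y" using divide_left_mono[of 1 T y] y T by simp
        finally show ?thesis using True by (simp add: y_def)
      next
        case False
        have "0 \<le> (y / T - 1 / 2)\<^sup>2" by simp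
        then have "y / T * (1 - y / T) \<le> 1" by (simp add: power2_eq_square algebra_simps)
        then show ?thesis using False by simp
      qed
    qed auto
    finally show ?thesis by (simp add: a_def power_mult_distrib)
  qed
  have i2: "integrable P (\<lambda>x. (min (D x) 1 * G u x)\<^sup>2)"
  proof (rule Bochner_Integration.integrable_bound[OF integrable_dotp_sq[of u]])
    show "AE x in P. norm ((min (D x) 1 * G u x)\<^sup>2) \<le> norm ((dotp d x u)\<^sup>2)"
    proof (intro AE_I2)
      fix x
      have "(min (D x) 1)\<^sup>2 * (G u x)\<^sup>2 \<le> (D x)\<^sup>2 * (G u x)\<^sup>2"
        using D_nonneg[of x] by (intro mult_right_mono power_mono) auto
      then show "norm ((min (D x) 1 * G u x)\<^sup>2) \<le> norm ((dotp d x u)\<^sup>2)"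
        by (simp add: dotp_eq_D_G power_mult_distrib)
    qed
  qed auto
  have "curv \<nu> \<kappa> * n\<^sup>2 = 1 / T * (\<kappa> - \<kappa> / 2) * n\<^sup>2" by (simp add: curv_def T_def)
  also have "\<dots> \<le> 1 / T * (\<kappa> - \<nu> / T) * n\<^sup>2" using T by (intro mult_right_mono mult_left_mono) auto
  also have "\<dots> = 1 / T * (\<kappa> * n\<^sup>2 - 1 / T * ((n\<^sup>2 * \<nu> + \<nu> * n ^ 4 / n\<^sup>2) / 2))"
  proof -
    have n4: "n ^ 4 = n\<^sup>2 * n\<^sup>2" using power_add[of n 2 2] by simp
    have cancel: "a * (b * b) / b = a * b" if "b \<noteq> 0" for a b :: real using that by simp
    have "\<nu> * n ^ 4 / n\<^sup>2 = \<nu> * n\<^sup>2" unfolding n4 by (rule cancel) (use n in simp)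
    then have "(n\<^sup>2 * \<nu> + \<nu> * n ^ 4 / n\<^sup>2) / 2 = \<nu> * n\<^sup>2" by (simp only: mult.commute[of "n\<^sup>2" \<nu>]) simp
    then show ?thesis by (simp add: algebra_simps)
  qed
  also have "\<dots> \<le> 1 / T * ((LINT x|P. (dotp d x u)\<^sup>2) - 1 / T * ((n\<^sup>2 * (LINT x|P. D x ^ 4) + (LINT x|P. (dotp d x u) ^ 4) / n\<^sup>2) / 2))"
    using T n second_moment_lower[of u] fourth_moment(2)[of u] D_pow4(2)
    by (intro mult_left_mono diff_mono divide_right_mono add_mono) (auto simp: n_def)
  also have "\<dots> = (LINT x|P. 1 / T * ((dotp d x u)\<^sup>2 - 1 / T * ((n\<^sup>2 * D x ^ 4 + (dotp d x u) ^ 4 / n\<^sup>2) / 2)))"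
    using integrable_dotp_sq[of u] fourth_moment(1)[of u] D_pow4(1) by simp
  also have "\<dots> \<le> (LINT x|P. (min (D x) 1 * G u x)\<^sup>2)"
    using integrable_dotp_sq[of u] fourth_moment(1)[of u] D_pow4(1) i2 pw by (intro integral_mono) auto
  finally show ?thesis by (simp add: n_def)
qed

lemma curv_pos: "curv \<nu> \<kappa> > 0"
  using \<nu>_pos \<kappa>_pos by (auto simp: curv_def intro!: divide_pos_pos add_pos_pos)

text \<open>Truncating at level 1 costs only a constant in curvature and makes each
  \<open>Z j\<close> at most \<open>G (coord_vec j)\<close> in absolute value. The diagonal of the
  empirical form then has exponential moments independent of \<open>N\<close>, as
  \<open>restricted_curvature\<close> demands.\<close>

lemma sample_curvature:
  fixes N s m :: nat and t :: real
  assumes sd: "0 < s" "s \<le> d" and "m \<ge> 2" "N > 0"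
    and N1: "(curv \<nu> \<kappa>)\<^sup>2 / (4 * \<nu>) * N \<ge> t\<^sup>2 + 1 + (real m + 2 * real s) * ln (exp 1 * d / s)"
    and N2: "real N \<ge> t\<^sup>2 + 1 + s * ln (exp 1 * d / s)"
  shows "\<exists>A\<in>sets (PiM {..<N} (\<lambda>_. P \<Otimes>\<^sub>M R)). measure (PiM {..<N} (\<lambda>_. P \<Otimes>\<^sub>M R)) A \<ge> 1 - exp (- t\<^sup>2) \<and>
    (\<forall>\<omega>\<in>A. \<forall>v. 1 / real N * (\<Sum>i<N. (min (D (fst (\<omega> i))) 1 * G v (fst (\<omega> i)))\<^sup>2)
       \<ge> curv \<nu> \<kappa> / 4 * (norm2 d v)\<^sup>2 - ((ln sphere_const + 1) / csub) / (real m - 1) * (norm1 d v)\<^sup>2)"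
proof -
  define Z where "Z j z = min (D (fst z)) 1 * G (coord_vec j) (fst z)" for j and z :: "(nat \<Rightarrow> real) \<times> real"
  have Z: "dotp d (\<lambda>j. Z j z) u = min (D (fst z)) 1 * G u (fst z)" for z u
    unfolding G_eq_sum[of u] by (simp add: dotp_def Z_def sum_distrib_left mult.assoc)
  define X where "X u x = min (D x) 1 * G u x" for u x
  have X_meas [measurable]: "X u \<in> borel_measurable P" for u unfolding X_def[abs_def] by measurable
  have X4: "X u x ^ 4 \<le> (dotp d x u) ^ 4" for u x
  proof -
    have "(min (D x) 1) ^ 4 * (G u x) ^ 4 \<le> (D x) ^ 4 * (G u x) ^ 4"
      using D_nonneg[of x] by (intro mult_right_mono power_mono) auto
    then show ?thesis by (simp add: X_def dotp_eq_D_G power_mult_distrib)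
  qed
  have X4i: "integrable P (\<lambda>x. X u x ^ 4)" for u
    by (rule Bochner_Integration.integrable_bound[OF fourth_moment(1)[of u]]) (use X4 in auto)
  have "\<exists>A\<in>sets (PiM {..<N} (\<lambda>_. P \<Otimes>\<^sub>M R)). measure (PiM {..<N} (\<lambda>_. P \<Otimes>\<^sub>M R)) A \<ge> 1 - exp (- t\<^sup>2) \<and>
    (\<forall>\<omega>\<in>A. \<forall>v. 1 / real N * (\<Sum>i<N. (dotp d (\<lambda>j. Z j (\<omega> i)) v)\<^sup>2)
       \<ge> curv \<nu> \<kappa> / 4 * (norm2 d v)\<^sup>2 - ((ln sphere_const + 1) / csub) / (real m - 1) * (norm1 d v)\<^sup>2)"
  proof (rule PR.restricted_curvature[OF _ _ _ _ _ curv_pos \<nu>_pos csub_pos sphere_const_ge_1 sd \<open>m \<ge> 2\<close> \<open>N > 0\<close> N1 N2])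
    show "Z j \<in> borel_measurable (P \<Otimes>\<^sub>M R)" for j unfolding Z_def[abs_def] by measurable
    show "integrable (P \<Otimes>\<^sub>M R) (\<lambda>x. dotp d (\<lambda>j. Z j x) u ^ 4)" for u
      unfolding Z using PR_fst_integrable[OF X4i[of u]] by (simp add: X_def)
    show "(LINT x|(P \<Otimes>\<^sub>M R). dotp d (\<lambda>j. Z j x) u ^ 4) \<le> \<nu> * norm2 d u ^ 4" for u
    proof -
      have "(LINT x|(P \<Otimes>\<^sub>M R). dotp d (\<lambda>j. Z j x) u ^ 4) = (LINT x|P. X u x ^ 4)"
        unfolding Z using PR_fst_integral[of "\<lambda>x. X u x ^ 4"] by (simp add: X_def)
      also have "\<dots> \<le> (LINT x|P. dotp d x u ^ 4)"
        using X4i fourth_moment(1) X4 by (intro integral_mono) auto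
      also have "\<dots> \<le> \<nu> * norm2 d u ^ 4" by (rule fourth_moment)
      finally show ?thesis .
    qed
    show "curv \<nu> \<kappa> * (norm2 d u)\<^sup>2 \<le> (LINT x|(P \<Otimes>\<^sub>M R). (dotp d (\<lambda>j. Z j x) u)\<^sup>2)" for u
    proof -
      have "(LINT x|(P \<Otimes>\<^sub>M R). (dotp d (\<lambda>j. Z j x) u)\<^sup>2) = (LINT x|P. (X u x)\<^sup>2)"
        unfolding Z using PR_fst_integral[of "\<lambda>x. (X u x)\<^sup>2"] by (simp add: X_def)
      then show ?thesis using truncated_second_moment[of u] by (simp add: X_def)
    qed
    show "(\<integral>\<^sup>+x. ennreal (exp (csub * (Z j x)\<^sup>2)) \<partial>(P \<Otimes>\<^sub>M R)) \<le> ennreal sphere_const" if j: "j < d" for j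
    proof -
      have "(\<integral>\<^sup>+x. ennreal (exp (csub * (Z j x)\<^sup>2)) \<partial>(P \<Otimes>\<^sub>M R)) \<le> (\<integral>\<^sup>+x. ennreal (exp (csub * (G (coord_vec j) (fst x))\<^sup>2)) \<partial>(P \<Otimes>\<^sub>M R))"
      proof (intro nn_integral_mono ennreal_leI)
        fix z :: "(nat \<Rightarrow> real) \<times> real"
        have "(min (D (fst z)) 1)\<^sup>2 * (G (coord_vec j) (fst z))\<^sup>2 \<le> 1 * (G (coord_vec j) (fst z))\<^sup>2"
          using D_nonneg[of "fst z"] by (intro mult_right_mono power_le_one) auto
        then have "csub * (Z j z)\<^sup>2 \<le> csub * (G (coord_vec j) (fst z))\<^sup>2"
          using csub_pos by (intro mult_left_mono) (auto simp: Z_def power_mult_distrib)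
        then show "exp (csub * (Z j z)\<^sup>2) \<le> exp (csub * (G (coord_vec j) (fst z))\<^sup>2)" by simp
      qed
      also have "\<dots> = (\<integral>\<^sup>+x. ennreal (exp (csub * (G (coord_vec j) x)\<^sup>2)) \<partial>P)" by (rule PR_fst_nn) measurable
      also have "\<dots> \<le> ennreal sphere_const" by (rule subgaussian_coord[OF j])
      finally show ?thesis .
    qed
  qed
  then show ?thesis unfolding Z .
qed

lemma sample_noise:
  fixes N s :: nat and \<beta> :: real
  assumes sd: "0 < s" "s \<le> d" and N: "N > 0" and \<beta>: "\<beta> > 2" and \<tau>: "\<tau> = trunc_level N q"
  shows "\<exists>A\<in>sets (PiM {..<N} (\<lambda>_. P \<Otimes>\<^sub>M R)). measure (PiM {..<N} (\<lambda>_. P \<Otimes>\<^sub>M R)) A \<ge> 1 - exp (- \<beta>) \<and>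
    (\<forall>\<omega>\<in>A. \<forall>v. \<bar>1 / N * (\<Sum>i<N. mlt \<tau> (\<omega> i) * G v (fst (\<omega> i)))\<bar>
       \<le> noise_const cm Cm * (\<beta> * sqrt (ln (exp 1 * d / s) / N)) * (norm1 d v + sqrt s * norm2 d v))"
proof -
  have \<tau>1: "\<tau> \<ge> 0" by (simp add: \<tau> trunc_level_def)
  \<comment> \<open>The exponent is \<open>8 / (q + 4)\<close>, which is below 1 because
    \<open>q > 4\<close>.\<close>
  have \<tau>4: "\<tau> ^ 4 \<le> real N"
  proof -
    have "\<tau> ^ 4 = \<tau> powr 4" using \<tau>1 by simp
    also have "\<dots> = real N powr (8 / (q + 4))" by (simp add: \<tau> trunc_level_def powr_powr)
    also have "\<dots> \<le> real N powr 1" using N q_gt by (intro powr_mono) (auto simp: field_simps)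
    finally show ?thesis using N by simp
  qed
  interpret mp: multiplier "P \<Otimes>\<^sub>M R" "mlt \<tau>" "\<lambda>j z. G (coord_vec j) (fst z)" d cm Cm
  proof (intro multiplier.intro multiplier_axioms.intro)
    show "prob_space (P \<Otimes>\<^sub>M R)" by (rule PR.prob_space_axioms)
    show "(\<lambda>z. G (coord_vec j) (fst z)) \<in> borel_measurable (P \<Otimes>\<^sub>M R)" for j by (rule G_fst_meas)
    show "(\<integral>\<^sup>+z. ennreal ((mlt \<tau> z)\<^sup>2 * exp (cm * (G (coord_vec j) (fst z))\<^sup>2)) \<partial>(P \<Otimes>\<^sub>M R)) \<le> ennreal Cm"
      if "j < d" for j by (rule mlt_m2_exp[OF that \<tau>1])
  qed (rule mlt_meas cm_pos mult_const_pos)+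
  show ?thesis
    using mp.noise_bound[OF sd N \<beta> mlt_exp_m2[OF N \<tau>1 \<tau>4] mlt_bias[OF _ N \<tau>]]
    unfolding G_eq_sum[symmetric] .
qed

end

section \<open>The Lasso estimate\<close>

lemma lasso_objective_cong:
  assumes "\<And>i. i < d \<Longrightarrow> \<theta> i = \<theta>' i"
  shows "lasso_objective d N \<tau> lam x y \<theta> = lasso_objective d N \<tau> lam x y \<theta>'"
proof -
  have "dotp d u \<theta> = dotp d u \<theta>'" for u using assms by (intro dotp_cong) auto
  moreover have "norm1 d \<theta> = norm1 d \<theta>'" using assms by (simp add: norm1_def)
  ultimately show ?thesis by (simp add: lasso_objective_def)
qed

text \<open>Both squared norms equal the quadratic form of \<open>S\<close> at
  \<open>\<theta>\<close>, because \<open>B\<close> and the symmetric root \<open>H\<close> have the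
  same product with their own transposes.\<close>

lemma psd_sqrt_norm:
  assumes "is_psd_sqrt d H S" and B: "\<And>i j. i < d \<Longrightarrow> j < d \<Longrightarrow> (\<Sum>k<d. B i k * B j k) = S i j"
  shows "norm2 d (\<lambda>k. \<Sum>i<d. B i k * \<theta> i) = norm2 d (matvec d H \<theta>)"
proof -
  have sym: "H i j = H j i" if "i < d" "j < d" for i j using assms(1) that by (simp add: is_psd_sqrt_def)
  have H: "(\<Sum>k<d. H i k * H j k) = S i j" if "i < d" "j < d" for i j
  proof -
    have "(\<Sum>k<d. H i k * H j k) = (\<Sum>k<d. H i k * H k j)"
      by (intro sum.cong refl arg_cong2[where f = "(*)"] sym) (use that in auto)
    also have "\<dots> = S i j" using assms(1) that unfolding is_psd_sqrt_def by blast
    finally show ?thesis .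
  qed
  have "(norm2 d (\<lambda>k. \<Sum>i<d. B i k * \<theta> i))\<^sup>2 = (\<Sum>k<d. (\<Sum>i<d. B i k * \<theta> i) * (\<Sum>i<d. B i k * \<theta> i))"
    unfolding norm2_sq by (simp add: power2_eq_square)
  also have "\<dots> = (\<Sum>k<d. (\<Sum>i<d. H i k * \<theta> i) * (\<Sum>i<d. H i k * \<theta> i))"
    by (rule trans[OF gram_form[OF B, symmetric] gram_form[OF H]])
  also have "\<dots> = (\<Sum>k<d. (matvec d H \<theta> k)\<^sup>2)"
  proof (intro sum.cong refl)
    fix k assume "k \<in> {..<d}"
    then have "(\<Sum>i<d. H i k * \<theta> i) = matvec d H \<theta> k"
      unfolding matvec_def by (auto intro!: sum.cong simp: sym)
    then show "(\<Sum>i<d. H i k * \<theta> i) * (\<Sum>i<d. H i k * \<theta> i) = (matvec d H \<theta> k)\<^sup>2"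
      by (simp add: power2_eq_square)
  qed
  also have "\<dots> = (norm2 d (matvec d H \<theta>))\<^sup>2" by (rule norm2_sq[symmetric])
  finally show ?thesis using norm2_nonneg by (simp only: power2_eq_iff_nonneg)
qed

context elliptical_model
begin

text \<open>Deterministic: the minimiser is compared with \<eta> times \<open>\<theta>\<close> on a
  sample where noise and curvature are controlled. Since the actual truncation level is at least 1,
  curvature of the design cut at 1 is inherited by the truncated design.\<close>

lemma lasso_error_bound:
  fixes N s :: nat and \<omega> :: "nat \<Rightarrow> (nat \<Rightarrow> real) \<times> real" and a b r lam \<rho> C3 \<beta> l :: real
  assumes sd: "0 < s" and N: "N > 0" and \<beta>: "\<beta> > 0" and l: "l > 0"
    and \<theta>0: "norm0 d \<theta>0 = s" "norm1 d (\<lambda>i. eta0 * \<theta> i - \<theta>0 i) \<le> \<rho>" "\<rho> \<le> r * s * lam" "r \<ge> 0"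
    and lam: "lam = 8 * C3 * (\<beta> * sqrt (l / N))" "C3 > 0"
    and noise: "\<And>v. \<bar>1 / N * (\<Sum>i<N. mlt (trunc_level N q) (\<omega> i) * G v (fst (\<omega> i)))\<bar>
       \<le> C3 * (\<beta> * sqrt (l / N)) * (norm1 d v + sqrt s * norm2 d v)"
    and curvature: "\<And>v. 1 / real N * (\<Sum>i<N. (min (D (fst (\<omega> i))) 1 * G v (fst (\<omega> i)))\<^sup>2)
       \<ge> a * (norm2 d v)\<^sup>2 - b * (norm1 d v)\<^sup>2 / s" and ab: "a > 0" "b \<ge> 0" "72 * b \<le> a"
    and est: "is_estimator d N q lam (\<lambda>i. fst (\<omega> i)) (\<lambda>i. response d f \<theta> (\<omega> i)) \<theta>h"
  shows "norm2 d (\<lambda>i. \<theta>h i - eta0 * \<theta> i) \<le> (10 / a + r) * (lam * sqrt s)"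
    and "norm1 d (\<lambda>i. \<theta>h i - eta0 * \<theta> i) \<le> (30 / a + 6 * r) * (lam * s)"
proof -
  define \<tau> where "\<tau> = trunc_level N q"
  define X where "X i = trunc_vec d \<tau> (fst (\<omega> i))" for i
  define Yt where "Yt i = trunc_real \<tau> (Y (\<omega> i))" for i
  define \<theta>1 where "\<theta>1 i = eta0 * \<theta> i" for i
  define v where "v = (\<lambda>i. \<theta>h i - \<theta>1 i)"
  have \<tau>1: "\<tau> \<ge> 1" using N q_gt by (simp add: \<tau>_def trunc_level_def ge_one_powr_ge_zero)
  have lam0: "lam > 0" using lam \<beta> l N by simp
  have dX: "dotp d (X i) u = min (D (fst (\<omega> i))) \<tau> * G u (fst (\<omega> i))" for i u
    unfolding X_def by (rule dotp_trunc_vec)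
  have d\<theta>1: "dotp d u \<theta>1 = eta0 * dotp d u \<theta>" for u
    by (simp add: dotp_def \<theta>1_def[abs_def] sum_distrib_left mult_ac)
  have opt: "1 / real N * (\<Sum>i<N. (dotp d (X i) \<theta>h - Yt i)\<^sup>2) + lam * norm1 d \<theta>h
      \<le> 1 / real N * (\<Sum>i<N. (dotp d (X i) \<theta>1 - Yt i)\<^sup>2) + lam * norm1 d \<theta>1"
  proof -
    define obj where "obj = lasso_objective d N \<tau> lam (\<lambda>i. fst (\<omega> i)) (\<lambda>i. response d f \<theta> (\<omega> i))"
    \<comment> \<open>The minimisation runs over extensional functions, so the comparison point is
      restricted to the index range; the objective does not see the difference.\<close>
    have "obj \<theta>h \<le> obj (restrict \<theta>1 {..<d})"
      using est unfolding is_estimator_def is_arg_min_linorder \<tau>_def[symmetric] obj_def[symmetric] by (simp add: Rd_def)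
    also have "\<dots> = obj \<theta>1" unfolding obj_def by (intro lasso_objective_cong) simp
    finally show ?thesis by (simp add: obj_def lasso_objective_def X_def Yt_def Y_def)
  qed
  have noise': "\<bar>1 / real N * (\<Sum>i<N. (Yt i - dotp d (X i) \<theta>1) * dotp d (X i) v)\<bar>
      \<le> lam / 8 * (norm1 d v + sqrt s * norm2 d v)"
  proof -
    have "(Yt i - dotp d (X i) \<theta>1) * dotp d (X i) v = mlt \<tau> (\<omega> i) * G v (fst (\<omega> i))" for i
      by (simp add: d\<theta>1 dX Yt_def mlt_def mult_ac)
    then show ?thesis using noise[of v] by (simp add: \<tau>_def lam(1))
  qed
  note basic = lasso_basic_inequality[OF opt v_def lam0 noise' \<theta>0(1) \<theta>0(2)[folded \<theta>1_def]]
  have Q0: "1 / real N * (\<Sum>i<N. (dotp d (X i) v)\<^sup>2) \<ge> 0" by (intro mult_nonneg_nonneg sum_nonneg) auto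
  have "(\<Sum>i<N. (min (D (fst (\<omega> i))) 1 * G v (fst (\<omega> i)))\<^sup>2) \<le> (\<Sum>i<N. (dotp d (X i) v)\<^sup>2)"
    unfolding dX power_mult_distrib using \<tau>1 D_nonneg by (intro sum_mono mult_right_mono power_mono) auto
  then have "1 / real N * (\<Sum>i<N. (min (D (fst (\<omega> i))) 1 * G v (fst (\<omega> i)))\<^sup>2) \<le> 1 / real N * (\<Sum>i<N. (dotp d (X i) v)\<^sup>2)"
    by (intro mult_left_mono) auto
  then have curv: "1 / real N * (\<Sum>i<N. (dotp d (X i) v)\<^sup>2) \<ge> a * (norm2 d v)\<^sup>2 - b * (norm1 d v)\<^sup>2 / s"
    using curvature[of v] by linarith
  have n1: "norm1 d v \<ge> 0" and \<rho>0: "0 \<le> \<rho>"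
    using \<theta>0(2) by (auto simp: norm1_def sum_nonneg intro: order_trans[OF sum_nonneg])
  note rates = lasso_rates[OF basic curv Q0 lam0 _ ab n1 norm2_nonneg \<rho>0 \<theta>0(3,4)]
  show "norm2 d (\<lambda>i. \<theta>h i - eta0 * \<theta> i) \<le> (10 / a + r) * (lam * sqrt s)"
    "norm1 d (\<lambda>i. \<theta>h i - eta0 * \<theta> i) \<le> (30 / a + 6 * r) * (lam * s)"
    using rates sd by (simp_all add: v_def \<theta>1_def)
qed

end

text \<open>Dividing by \<open>\<delta> * Q\<close> turns the two parts of the sum into
  \<open>t / Q\<close> and a multiple of \<open>sqrt w\<close>. The factor
  \<open>Q\<^sup>2 + (\<delta> * Q)\<^sup>2\<close> restores both at once: its first summand gives
  back \<open>t\<^sup>2\<close>, its second gives back \<open>w\<close>. The cross term and the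
  excess of \<beta> over 1 only help.\<close>

lemma sample_size_split:
  fixes \<delta> Q t \<beta> w Kk N :: real
  assumes "N \<ge> Kk * (Q\<^sup>2 + (\<delta> * Q)\<^sup>2) * ((\<delta> * t + \<beta> * sqrt w) / (\<delta> * Q))\<^sup>2"
    and "\<delta> > 0" "Q > 0" "Kk \<ge> 0" "w \<ge> 0" "t \<ge> 0" "\<beta> \<ge> 1"
  shows "N \<ge> Kk * (t\<^sup>2 + w)"
proof -
  have "(\<delta> * t)\<^sup>2 + w \<le> (\<delta> * t)\<^sup>2 + \<beta>\<^sup>2 * w"
    using assms mult_right_mono[of 1 "\<beta>\<^sup>2" w] one_le_power[of \<beta> 2] by simp
  also have "\<dots> \<le> (\<delta> * t + \<beta> * sqrt w)\<^sup>2"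
    using assms by (simp add: power2_sum power_mult_distrib)
  finally have 1: "(\<delta> * t)\<^sup>2 + w \<le> (\<delta> * t + \<beta> * sqrt w)\<^sup>2" .
  have "t\<^sup>2 + w \<le> (Q\<^sup>2 + (\<delta> * Q)\<^sup>2) * (((\<delta> * t)\<^sup>2 + w) / (\<delta> * Q)\<^sup>2)"
  proof -
    have "(Q\<^sup>2 + (\<delta> * Q)\<^sup>2) * (((\<delta> * t)\<^sup>2 + w) / (\<delta> * Q)\<^sup>2) = (t\<^sup>2 + w) + (w / \<delta>\<^sup>2 + \<delta>\<^sup>2 * t\<^sup>2)"
      using assms by (simp add: power_mult_distrib divide_simps) (simp add: algebra_simps)
    moreover have "0 \<le> w / \<delta>\<^sup>2 + \<delta>\<^sup>2 * t\<^sup>2" using assms by simp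
    ultimately show ?thesis by linarith
  qed
  also have "\<dots> \<le> (Q\<^sup>2 + (\<delta> * Q)\<^sup>2) * ((\<delta> * t + \<beta> * sqrt w)\<^sup>2 / (\<delta> * Q)\<^sup>2)"
    using 1 by (intro mult_left_mono divide_right_mono) auto
  finally have "Kk * (t\<^sup>2 + w) \<le> Kk * ((Q\<^sup>2 + (\<delta> * Q)\<^sup>2) * ((\<delta> * t + \<beta> * sqrt w)\<^sup>2 / (\<delta> * Q)\<^sup>2))"
    using assms by (intro mult_left_mono)
  also have "\<dots> = Kk * (Q\<^sup>2 + (\<delta> * Q)\<^sup>2) * ((\<delta> * t + \<beta> * sqrt w) / (\<delta> * Q))\<^sup>2"
    by (simp add: power_divide)
  finally show ?thesis using assms(1) by linarith
qed

theorem theorem2p2: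
  fixes \<epsilon> q \<nu> \<nu>q \<kappa> \<delta> Q :: real
  assumes "\<epsilon> > 0" "\<nu> > 0" "\<nu>q > 0" "\<kappa> > 0"
    and "q = 4 * (1 + \<epsilon>)"
    and "\<delta> = 1 / 2 * sqrt (\<kappa> / 2)"
    and "Q = \<kappa>\<^sup>2 / (8 * \<nu>)"
  shows "\<exists>c c0 c1 C0 C1 :: real. c > 0 \<and> c0 > 0 \<and> c1 > 0 \<and> C0 > 0 \<and> C1 > 0 \<and>
    (\<forall>(d :: nat) (N :: nat) (s :: nat)
       (P :: (nat \<Rightarrow> real) measure) (R :: real measure) (Mu :: real measure)
       (B :: nat \<Rightarrow> nat \<Rightarrow> real) (H :: nat \<Rightarrow> nat \<Rightarrow> real)
       (f :: real \<times> real \<Rightarrow> real) (\<theta>s :: nat \<Rightarrow> real) (\<theta>0 :: nat \<Rightarrow> real)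
       (\<eta> :: real) (\<beta> :: real) (t :: real) (lam :: real).
       \<theta>s \<in> Rd d \<longrightarrow>
       single_index_model d P R f \<theta>s \<longrightarrow>
       elliptical d P Mu B \<longrightarrow>
       is_psd_sqrt d H (second_moment P) \<longrightarrow>
       norm2 d (matvec d H \<theta>s) = 1 \<longrightarrow>
       \<eta> = eta d P R f \<theta>s \<longrightarrow>
       \<eta> \<noteq> 0 \<longrightarrow>
       moment_assumptions d P R f \<theta>s q \<nu> \<nu>q \<kappa> \<longrightarrow>
       \<beta> > 2 \<longrightarrow> t > 2 \<longrightarrow>
       \<theta>0 \<in> Rd d \<longrightarrow>
       norm0 d \<theta>0 = s \<longrightarrow>
       norm1 d (\<lambda>i. \<eta> * \<theta>s i - \<theta>0 i) \<le> c * (s * sqrt (ln (exp 1 * d / s)) / sqrt N) \<longrightarrow>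
       real N \<ge> c0 * ((\<delta> * t + \<beta> * sqrt (s * ln (exp 1 * d / s))) / (\<delta> * Q))\<^sup>2
          + 4 / Q\<^sup>2 * ((LINT m|Mu. m\<^sup>2)\<^sup>2 * lambda_max d (second_moment P) / (real d)\<^sup>2) \<longrightarrow>
       lam = c1 * \<beta> * sqrt (ln (exp 1 * d / s) / N) \<longrightarrow>
       (\<exists>A\<in>sets (sample_space N P R).
          measure (sample_space N P R) A \<ge> 1 - exp (- \<beta>) - exp (- t\<^sup>2) \<and>
          (\<forall>\<omega>\<in>A. \<forall>\<theta>hat.
             is_estimator d N q lam (\<lambda>i. fst (\<omega> i)) (\<lambda>i. response d f \<theta>s (\<omega> i)) \<theta>hat \<longrightarrow>
             norm2 d (\<lambda>i. \<theta>hat i - \<eta> * \<theta>s i)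
               \<le> C0 * (\<beta> * sqrt (s * ln (exp 1 * d / s)) / sqrt N) \<and>
             norm1 d (\<lambda>i. \<theta>hat i - \<eta> * \<theta>s i)
               \<le> C1 * (\<beta> * s * sqrt (ln (exp 1 * d / s)) / sqrt N))))"
proof -
  have q: "q > 4" using assms(1,5) by simp
  have \<delta>Q: "\<delta> > 0" "Q > 0" unfolding assms(6,7) using assms(2,4) by simp_all
  define k0 where "k0 = curv \<nu> \<kappa>"
  define a where "a = k0 / 4"
  define A0 where "A0 = (ln sphere_const + 1) / subg_rate \<nu> \<kappa>"
  \<comment> \<open>The number of Maurey draws per unit of \<open>s\<close>, large enough that the
    l1-defect satisfies the condition \<open>72 * b \<le> a\<close> of
    \<open>lasso_rates\<close>.\<close>
  define Ms where "Ms = nat \<lceil>72 * A0 / a\<rceil> + 1"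
  define C3 where "C3 = noise_const (mult_rate q \<nu> \<nu>q \<kappa>) (mult_const q \<nu> \<nu>q \<kappa>)"
  \<comment> \<open>Puts the noise at the level \<open>lam / 8\<close> that the basic inequality
    expects.\<close>
  define c1 where "c1 = 8 * C3"
  define r where "r = 1 / c1"
  define \<kappa>2 where "\<kappa>2 = k0\<^sup>2 / (4 * \<nu>)"
  \<comment> \<open>The first summand pays for the union over integer vectors, whose tail rate is
    \<open>\<kappa>2\<close>; the second pays for the diagonal, whose rate is 1.\<close>
  define Kk where "Kk = (real Ms + 6) / \<kappa>2 + (real Ms + 6)"
  define c0 where "c0 = Kk * (Q\<^sup>2 + (\<delta> * Q)\<^sup>2)"
  define C0 where "C0 = (10 / a + r) * c1"
  define C1 where "C1 = (30 / a + 6 * r) * c1"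
  have k0: "k0 > 0" using assms by (auto simp: k0_def curv_def intro!: divide_pos_pos add_pos_pos)
  then have a: "a > 0" by (simp add: a_def)
  have C3: "C3 > 0" unfolding C3_def using assms q by (intro noise_const_pos mult_rate_pos mult_const_pos)
  then have c1: "c1 > 0" and r: "r > 0" by (auto simp: c1_def r_def)
  have \<kappa>2: "\<kappa>2 > 0" using k0 assms by (simp add: \<kappa>2_def)
  have A0: "A0 \<ge> 0" using sphere_const_ge_1 assms by (auto simp: A0_def subg_rate_def)
  have Kk: "Kk > 0" "Kk \<ge> real Ms + 6" "\<kappa>2 * Kk \<ge> real Ms + 6"
  proof -
    have "(real Ms + 6) / \<kappa>2 > 0" using \<kappa>2 by (intro divide_pos_pos) auto
    then show "Kk \<ge> real Ms + 6" by (simp add: Kk_def)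
    then show "Kk > 0" by linarith
    have "\<kappa>2 * (b / \<kappa>2) = b" for b using \<kappa>2 by simp
    then have "\<kappa>2 * Kk = (real Ms + 6) + \<kappa>2 * (real Ms + 6)" unfolding Kk_def distrib_left[of \<kappa>2 "(real Ms + 6) / \<kappa>2"] by (simp only:)
    moreover have "0 \<le> \<kappa>2 * (real Ms + 6)" using \<kappa>2 by simp
    ultimately show "\<kappa>2 * Kk \<ge> real Ms + 6" by linarith
  qed
  have c0: "c0 > 0" unfolding c0_def using Kk \<delta>Q by (intro mult_pos_pos add_pos_nonneg) auto
  have C01: "C0 > 0" "C1 > 0" using a r c1 by (auto simp: C0_def C1_def intro!: mult_pos_pos add_pos_pos)
  have Ms: "Ms > 0" "72 * (A0 / Ms) \<le> a"
  proof -
    show "Ms > 0" by (simp add: Ms_def)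
    have "72 * A0 / a \<le> Ms" unfolding Ms_def by linarith
    then show "72 * (A0 / Ms) \<le> a" using a \<open>Ms > 0\<close> by (simp add: field_simps)
  qed
  show ?thesis
  \<comment> \<open>The constant \<open>c = 1\<close> suffices: \<open>lam\<close> contains the same
    rate times \<open>c1 * \<beta>\<close>, so the approximation error is at most
    \<open>s * lam / c1\<close> because \<beta> exceeds 1.\<close>
  proof (rule exI[of _ 1], rule exI[of _ c0], rule exI[of _ c1], rule exI[of _ C0], rule exI[of _ C1],
      intro conjI c0 c1 C01 allI impI)
    fix d N s :: nat and P :: "(nat \<Rightarrow> real) measure" and R Mu :: "real measure"
      and B H :: "nat \<Rightarrow> nat \<Rightarrow> real" and f :: "real \<times> real \<Rightarrow> real" and \<theta>s \<theta>0 :: "nat \<Rightarrow> real"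
      and \<eta> \<beta> t lam :: real
    assume \<theta>s: "\<theta>s \<in> Rd d" and model: "single_index_model d P R f \<theta>s" and ell: "elliptical d P Mu B"
      and psd: "is_psd_sqrt d H (second_moment P)" and unit: "norm2 d (matvec d H \<theta>s) = 1"
      and \<eta>: "\<eta> = eta d P R f \<theta>s" "\<eta> \<noteq> 0" and mom: "moment_assumptions d P R f \<theta>s q \<nu> \<nu>q \<kappa>"
      and \<beta>: "\<beta> > 2" and t: "t > 2" and \<theta>0: "\<theta>0 \<in> Rd d" "norm0 d \<theta>0 = s"
      and approx: "norm1 d (\<lambda>i. \<eta> * \<theta>s i - \<theta>0 i) \<le> 1 * (s * sqrt (ln (exp 1 * d / s)) / sqrt N)"
      and N_ge: "real N \<ge> c0 * ((\<delta> * t + \<beta> * sqrt (s * ln (exp 1 * d / s))) / (\<delta> * Q))\<^sup>2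
          + 4 / Q\<^sup>2 * ((LINT m|Mu. m\<^sup>2)\<^sup>2 * lambda_max d (second_moment P) / (real d)\<^sup>2)"
      and lam: "lam = c1 * \<beta> * sqrt (ln (exp 1 * d / s) / N)"
    have d: "d > 0" using unit by (cases d) (auto simp: norm2_def)
    have BBt: "(\<Sum>k<d. B i k * B j k) = second_moment P i j" if "i < d" "j < d" for i j
      using ell that by (simp add: elliptical_def)
    interpret E: elliptical_model d P R f \<theta>s Mu B q \<nu> \<nu>q \<kappa>
      using d model ell mom assms(2-4) q psd_sqrt_norm[OF psd BBt, of \<theta>s] unit
      by (intro elliptical_model.intro) simp_all
    have \<eta>0: "\<eta> = E.eta0" by (simp add: \<eta> E.eta0_def)
    \<comment> \<open>For \<open>s = 0\<close> the approximation bound would be zero and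
      \<open>\<theta>0\<close> would vanish. Then \<eta> times \<open>\<theta>s\<close> is zero, and
      \<eta> being nonzero contradicts the normalisation.\<close>
    have s: "0 < s" "s \<le> d"
    proof -
      show "s \<le> d" using card_mono[of "{..<d}" "{i. i < d \<and> \<theta>0 i \<noteq> 0}"] \<theta>0(2) by (auto simp: norm0_def)
      show "0 < s"
      proof (rule ccontr)
        assume "\<not> 0 < s"
        then have "norm1 d (\<lambda>i. \<eta> * \<theta>s i - \<theta>0 i) \<le> 0" using approx by simp
        then have "(\<Sum>i<d. \<bar>\<eta> * \<theta>s i - \<theta>0 i\<bar>) = 0" by (simp add: norm1_def antisym sum_nonneg)
        then have z: "\<eta> * \<theta>s i = \<theta>0 i" if "i < d" for i using that by (simp add: sum_nonneg_eq_0_iff)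
        have "{i. i < d \<and> \<theta>0 i \<noteq> 0} = {}" using \<theta>0(2) \<open>\<not> 0 < s\<close> by (simp add: norm0_def)
        then have "\<theta>s i = 0" if "i < d" for i using z[OF that] \<eta>(2) that by auto
        then have "norm2 d (matvec d H \<theta>s) = 0" by (simp add: norm2_def matvec_def L2_set_def)
        then show False using unit by simp
      qed
    qed
    define l where "l = ln (exp 1 * d / s)"
    have l: "l \<ge> 1" using ln_dim_ratio[OF s] by (simp add: l_def)
    define w where "w = real s * l"
    have w: "w \<ge> l"
      using s l mult_right_mono[of 1 "real s" l] by (simp add: w_def)
    have "0 \<le> 4 / Q\<^sup>2 * ((LINT m|Mu. m\<^sup>2)\<^sup>2 * lambda_max d (second_moment P) / (real d)\<^sup>2)"
      using lambda_max_nonneg[OF d BBt] by simp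
    then have "real N \<ge> c0 * ((\<delta> * t + \<beta> * sqrt w) / (\<delta> * Q))\<^sup>2"
      using N_ge by (simp add: w_def l_def)
    then have N_Kk: "real N \<ge> Kk * (t\<^sup>2 + w)"
      unfolding c0_def by (rule sample_size_split) (use \<delta>Q Kk w l t \<beta> in auto)
    have t2: "t\<^sup>2 \<ge> 1" using t by (simp add: one_le_power)
    \<comment> \<open>Maurey's method is run with \<open>m = Ms * s + 1\<close>, so that its
      denominator \<open>m - 1\<close> is exactly \<open>Ms * s\<close>. The surplus of 6 over
      \<open>Ms\<close> covers the constant 1, the extra draw and the term
      \<open>2 * s\<close>.\<close>
    have size: "(real Ms + 6) * (t\<^sup>2 + w) \<ge> t\<^sup>2 + 1 + (real (Ms * s + 1) + 2 * real s) * l"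
    proof -
      have "(real (Ms * s + 1) + 2 * real s) * l = real Ms * w + l + 2 * w" by (simp add: w_def algebra_simps)
      also have "\<dots> \<le> real Ms * w + 6 * w" using w l by simp
      finally have "(real (Ms * s + 1) + 2 * real s) * l \<le> real Ms * w + 6 * w" .
      moreover have "0 \<le> real Ms * t\<^sup>2" by simp
      moreover have "(real Ms + 6) * (t\<^sup>2 + w) = real Ms * t\<^sup>2 + real Ms * w + 6 * t\<^sup>2 + 6 * w"
        by (simp add: algebra_simps)
      ultimately show ?thesis using t2 by linarith
    qed
    have tw: "t\<^sup>2 + w \<ge> 0" using w l by simp
    have N_pos: "N > 0"
    proof -
      have "0 < Kk * (t\<^sup>2 + w)" using Kk(1) t2 w l by (intro mult_pos_pos) auto
      then show ?thesis using N_Kk by (cases N) auto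
    qed
    have N1: "(curv \<nu> \<kappa>)\<^sup>2 / (4 * \<nu>) * N \<ge> t\<^sup>2 + 1 + (real (Ms * s + 1) + 2 * real s) * ln (exp 1 * d / s)"
    proof -
      have "(real Ms + 6) * (t\<^sup>2 + w) \<le> (\<kappa>2 * Kk) * (t\<^sup>2 + w)" using Kk(3) tw by (rule mult_right_mono)
      also have "\<dots> \<le> \<kappa>2 * N" using mult_left_mono[OF N_Kk, of \<kappa>2] \<kappa>2 by (simp add: mult.assoc)
      finally show ?thesis using size by (simp add: \<kappa>2_def k0_def l_def)
    qed
    have N2: "real N \<ge> t\<^sup>2 + 1 + s * ln (exp 1 * d / s)"
    proof -
      have "(real Ms + 6) * (t\<^sup>2 + w) \<le> Kk * (t\<^sup>2 + w)" using Kk(2) tw by (rule mult_right_mono)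
      moreover have "1 * w \<le> (real (Ms * s + 1) + 2 * real s) * l"
        unfolding w_def mult_1 using l by (intro mult_right_mono) auto
      ultimately show ?thesis using size N_Kk by (simp add: w_def l_def)
    qed
    define S where "S = sample_space N P R"
    interpret S: prob_space S
      unfolding S_def sample_space_def by (intro prob_space_PiM E.PR.prob_space_axioms)
    obtain A1 where A1: "A1 \<in> sets S" "S.prob A1 \<ge> 1 - exp (- t\<^sup>2)"
      "\<And>\<omega> v. \<omega> \<in> A1 \<Longrightarrow> 1 / real N * (\<Sum>i<N. (min (E.D (fst (\<omega> i))) 1 * E.G v (fst (\<omega> i)))\<^sup>2)
         \<ge> k0 / 4 * (norm2 d v)\<^sup>2 - A0 / (real (Ms * s + 1) - 1) * (norm1 d v)\<^sup>2"
      using E.sample_curvature[OF s _ N_pos N1 N2] s Ms(1)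
      unfolding S_def sample_space_def k0_def A0_def by auto
    obtain A2 where A2: "A2 \<in> sets S" "S.prob A2 \<ge> 1 - exp (- \<beta>)"
      "\<And>\<omega> v. \<omega> \<in> A2 \<Longrightarrow> \<bar>1 / N * (\<Sum>i<N. E.mlt (trunc_level N q) (\<omega> i) * E.G v (fst (\<omega> i)))\<bar>
       \<le> C3 * (\<beta> * sqrt (l / N)) * (norm1 d v + sqrt s * norm2 d v)"
      using E.sample_noise[OF s N_pos \<beta> refl] unfolding S_def sample_space_def C3_def l_def by blast
    have "S.prob (A1 \<union> A2) = S.prob A1 + S.prob A2 - S.prob (A1 \<inter> A2)"
      using A1(1) A2(1) by (intro measure_Un3) (auto simp: fmeasurable_def S.emeasure_eq_measure)
    then have "S.prob (A1 \<inter> A2) \<ge> 1 - exp (- \<beta>) - exp (- t\<^sup>2)"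
      using A1(2) A2(2) S.prob_le_1[of "A1 \<union> A2"] by linarith
    moreover have "A1 \<inter> A2 \<in> sets S" using A1(1) A2(1) by auto
    moreover have "norm2 d (\<lambda>i. \<theta>hat i - \<eta> * \<theta>s i) \<le> C0 * (\<beta> * sqrt (s * ln (exp 1 * d / s)) / sqrt N) \<and>
        norm1 d (\<lambda>i. \<theta>hat i - \<eta> * \<theta>s i) \<le> C1 * (\<beta> * s * sqrt (ln (exp 1 * d / s)) / sqrt N)"
      if \<omega>: "\<omega> \<in> A1 \<inter> A2"
        and est: "is_estimator d N q lam (\<lambda>i. fst (\<omega> i)) (\<lambda>i. response d f \<theta>s (\<omega> i)) \<theta>hat" for \<omega> \<theta>hat
    proof -
      have lam': "lam = 8 * C3 * (\<beta> * sqrt (l / N))" by (simp add: lam c1_def l_def)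
      define \<rho> where "\<rho> = s * sqrt l / sqrt N"
      have \<rho>: "\<rho> \<le> r * s * lam"
      proof -
        have "r * s * lam = \<beta> * \<rho>" using c1 by (simp add: lam r_def \<rho>_def l_def real_sqrt_divide)
        moreover have "0 \<le> \<rho>" using l by (simp add: \<rho>_def)
        ultimately show ?thesis using \<beta> mult_right_mono[of 1 \<beta> \<rho>] by simp
      qed
      have app: "norm1 d (\<lambda>i. E.eta0 * \<theta>s i - \<theta>0 i) \<le> \<rho>" using approx by (simp add: \<rho>_def l_def \<eta>0)
      have cv: "1 / real N * (\<Sum>i<N. (min (E.D (fst (\<omega> i))) 1 * E.G v (fst (\<omega> i)))\<^sup>2)
         \<ge> a * (norm2 d v)\<^sup>2 - A0 / Ms * (norm1 d v)\<^sup>2 / s" for v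
      proof -
        have "A0 / (real (Ms * s + 1) - 1) * (norm1 d v)\<^sup>2 = A0 / Ms * (norm1 d v)\<^sup>2 / s" by simp
        then show ?thesis using A1(3)[of \<omega> v] \<omega> by (simp add: a_def)
      qed
      have A0Ms: "0 \<le> A0 / Ms" using A0 by simp
      have noise: "\<bar>1 / N * (\<Sum>i<N. E.mlt (trunc_level N q) (\<omega> i) * E.G v (fst (\<omega> i)))\<bar>
        \<le> C3 * (\<beta> * sqrt (l / N)) * (norm1 d v + sqrt s * norm2 d v)" for v
        using A2(3) \<omega> by blast
      have \<beta>l: "\<beta> > 0" "l > 0" using \<beta> l by auto
      note bounds = E.lasso_error_bound[OF s(1) N_pos \<beta>l \<theta>0(2) app \<rho> less_imp_le[OF r] lam' C3 noise cv a A0Ms Ms(2) est]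
      have "lam * sqrt s = c1 * (\<beta> * sqrt (s * l) / sqrt N)"
        by (simp add: lam l_def real_sqrt_mult real_sqrt_divide)
      moreover have "lam * s = c1 * (\<beta> * s * sqrt l / sqrt N)"
        by (simp add: lam l_def real_sqrt_divide)
      ultimately show ?thesis using bounds unfolding \<eta>0 C0_def C1_def l_def by (simp add: mult.assoc)
    qed
    ultimately show "\<exists>A\<in>sets (sample_space N P R).
          measure (sample_space N P R) A \<ge> 1 - exp (- \<beta>) - exp (- t\<^sup>2) \<and>
          (\<forall>\<omega>\<in>A. \<forall>\<theta>hat.
             is_estimator d N q lam (\<lambda>i. fst (\<omega> i)) (\<lambda>i. response d f \<theta>s (\<omega> i)) \<theta>hat \<longrightarrow>
             norm2 d (\<lambda>i. \<theta>hat i - \<eta> * \<theta>s i)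
               \<le> C0 * (\<beta> * sqrt (s * ln (exp 1 * d / s)) / sqrt N) \<and>
             norm1 d (\<lambda>i. \<theta>hat i - \<eta> * \<theta>s i)
               \<le> C1 * (\<beta> * s * sqrt (ln (exp 1 * d / s)) / sqrt N))"
      unfolding S_def by blast
  qed simp
qed

end
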